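(* Any simple $\mathcal H[W]$-module $M$ such that the action of $(\mathbb C\mathbf X)^W$ on $M$ is locally finite is isomorphic to $Z_\chi$ for a certain $\chi\in\widehat W^\lambda$, $\lambda\in\Lambda/W$.
   Context: Let $\Delta\subset\mathfrak h$ be a finite reduced root system with Weyl group $W$, and let $\mathbf X\subset\mathfrak h^\vee$, $\mathbf Y\subset\mathfrak h$ be $W$-invariant lattices associated with $\Delta$ (such as the (co)root and weight lattices), with the natural $W$-invariant non-degenerate pairing $\langle\,,\rangle:\mathbf X\times\mathbf Y\to\frac1n\mathbb Z$, $n$ a positive integer. Fix $q\in\mathbb C^*$, not a root of unity, together with an $n$-th root $q^{1/n}$, and put $q^{a/n}:=(q^{1/n})^a$ for $a\in\mathbb Z$. The quantum torus $\mathcal H$ is the $\mathbb C$-algebra with basis $\{e^xe^y : x\in\mathbf X,y\in\mathbf Y\}$, containing the group algebras $\mathbb C\mathbf X$ and $\mathbb C\mathbf Y$ as subalgebras, with $e^xe^y=q^{\langle x,y\rangle}e^ye^x$. $W$ acts on $\mathcal H$ by algebra automorphisms $h\mapsto{}^wh$, with ${}^w(e^x)=e^{w(x)}$, ${}^w(e^y)=e^{w(y)}$. For a subgroup $W'\subset W$, the twisted group algebra $\mathcal H[W']$ is $\mathcal H\otimes_{\mathbb C}\mathbb C[W']$ with product $(f\otimes w)(g\otimes u)=(f\cdot{}^wg)\otimes(wu)$. A commutative algebra $A$ acts locally finitely on $M$ if $\dim_{\mathbb C}A\cdot m<\infty$ for all $m\in M$. $T:=\mathrm{Hom}(\mathbf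 X,\mathbb C^* )$; for $y\in\mathbf Y$ let $q^y\in T$ be given by $x(q^y)=q^{\langle x,y\rangle}$; $\Lambda:=T/q^{\mathbf Y}$. $W$ acts on $T$ and on $\Lambda$. For $\lambda\in T$, $W^\lambda\subset W$ is the isotropy group of the image of $\lambda$ in $\Lambda$, and $\widehat W^\lambda$ is the set of isomorphism classes of simple complex $W^\lambda$-modules. $\mathsf{M}_\lambda$ is the $\mathcal H$-module with basis $\{v_\mu : \mu\in\lambda\cdot q^{\mathbf Y}\}$ and $e^y(v_\mu)=v_{\mu q^y}$, $e^x(v_\mu)=x(\mu)v_\mu$; it is an $\mathcal H[W^\lambda]$-module via $w:v_\mu\mapsto v_{w(\mu)}$. For $\chi\in\widehat W^\lambda$, $V_\chi:=\mathsf{M}_\lambda\otimes_{\mathbb C}\chi$ as an $\mathcal H[W^\lambda]$-module ($\mathcal H$ acting on the first factor, $W^\lambda$ diagonally), and $Z_\chi:=\mathcal H[W]\otimes_{\mathcal H[W^\lambda]}V_\chi$. "$\lambda\in\Lambda/W$" means that $\lambda$ may be taken from a set of representatives in $T$ of the $W$-orbits in $\Lambda$. *)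

theory Defs
  imports
    "HOL-Analysis.Analysis"
    "HOL-Algebra.Module"
    "HOL-Algebra.Bij"
    "HOL-Algebra.Generated_Groups"
    "HOL-Algebra.Free_Abelian_Groups"
begin

section \<open>Left modules over a possibly noncommutative ring\<close>

text \<open>
  The locale \<open>module\<close> of HOL-Algebra assumes a commutative ring of scalars. We reuse its record
  type (whose ring multiplication and unit on the module play no role and are left
  \<open>undefined\<close> below) and its predicate \<open>submodule\<close>, which makes no assumption on the scalars.
\<close>

locale left_module = R?: ring R + M?: abelian_group M
  for R (structure) and M :: "('a, 'm, 'x) module_scheme" (structure) +
  assumes smult_closed: "a \<in> carrier R \<Longrightarrow> m \<in> carrier M \<Longrightarrow> a \<odot>\<^bsub>M\<^esub> m \<in> carrier M"
    and smult_l_distr: "a \<in> carrier R \<Longrightarrow> b \<in> carrier R \<Longrightarrow> m \<in> carrier M \<Longrightarrow>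
      (a \<oplus>\<^bsub>R\<^esub> b) \<odot>\<^bsub>M\<^esub> m = a \<odot>\<^bsub>M\<^esub> m \<oplus>\<^bsub>M\<^esub> b \<odot>\<^bsub>M\<^esub> m"
    and smult_r_distr: "a \<in> carrier R \<Longrightarrow> m \<in> carrier M \<Longrightarrow> m' \<in> carrier M \<Longrightarrow>
      a \<odot>\<^bsub>M\<^esub> (m \<oplus>\<^bsub>M\<^esub> m') = a \<odot>\<^bsub>M\<^esub> m \<oplus>\<^bsub>M\<^esub> a \<odot>\<^bsub>M\<^esub> m'"
    and smult_assoc: "a \<in> carrier R \<Longrightarrow> b \<in> carrier R \<Longrightarrow> m \<in> carrier M \<Longrightarrow>
      (a \<otimes>\<^bsub>R\<^esub> b) \<odot>\<^bsub>M\<^esub> m = a \<odot>\<^bsub>M\<^esub> (b \<odot>\<^bsub>M\<^esub> m)"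
    and smult_one: "m \<in> carrier M \<Longrightarrow> \<one>\<^bsub>R\<^esub> \<odot>\<^bsub>M\<^esub> m = m"

definition simple_module :: "('a, 'r) ring_scheme \<Rightarrow> ('a, 'm, 'x) module_scheme \<Rightarrow> bool" where
  "simple_module R M \<longleftrightarrow> left_module R M \<and> carrier M \<noteq> {\<zero>\<^bsub>M\<^esub>} \<and>
     (\<forall>N. submodule N R M \<longrightarrow> N = {\<zero>\<^bsub>M\<^esub>} \<or> N = carrier M)"

definition module_isomorphic ::
    "('a, 'r) ring_scheme \<Rightarrow> ('a, 'm, 'x) module_scheme \<Rightarrow> ('a, 'n, 'y) module_scheme \<Rightarrow> bool" where
  "module_isomorphic R M N \<longleftrightarrow> (\<exists>f. bij_betw f (carrier M) (carrier N) \<and>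
     (\<forall>m\<in>carrier M. \<forall>m'\<in>carrier M. f (m \<oplus>\<^bsub>M\<^esub> m') = f m \<oplus>\<^bsub>N\<^esub> f m') \<and>
     (\<forall>a\<in>carrier R. \<forall>m\<in>carrier M. f (a \<odot>\<^bsub>M\<^esub> m) = a \<odot>\<^bsub>N\<^esub> f m))"

text \<open>
  For a \<open>\<complex>\<close>-algebra \<open>R\<close> with structure map \<open>\<iota>\<close>, every \<open>R\<close>-module \<open>M\<close> is a complex vector space.
\<close>

definition complex_span ::
    "(complex \<Rightarrow> 'a) \<Rightarrow> ('a, 'm, 'x) module_scheme \<Rightarrow> 'm set \<Rightarrow> 'm set" where
  "complex_span \<iota> M S = {\<Oplus>\<^bsub>M\<^esub>s\<in>S. \<iota> (c s) \<odot>\<^bsub>M\<^esub> s | c. True}"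

definition locally_finite_action ::
    "(complex \<Rightarrow> 'a) \<Rightarrow> 'a set \<Rightarrow> ('a, 'm, 'x) module_scheme \<Rightarrow> bool" where
  "locally_finite_action \<iota> A M \<longleftrightarrow> (\<forall>m\<in>carrier M.
     \<exists>S. finite S \<and> S \<subseteq> {a \<odot>\<^bsub>M\<^esub> m | a. a \<in> A} \<and> {a \<odot>\<^bsub>M\<^esub> m | a. a \<in> A} \<subseteq> complex_span \<iota> M S)"


section \<open>Tensor products over a noncommutative ring\<close>

text \<open>
  \<open>M \<otimes>\<^sub>R N\<close> for a right \<open>R\<close>-module \<open>M\<close> (right action \<open>\<rho>\<close>) and a left \<open>R\<close>-module \<open>N\<close> (left action
  \<open>\<sigma>\<close>), where \<open>R\<close> is given by its carrier: the free abelian group on \<open>M \<times> N\<close> modulo the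
  subgroup generated by the usual relations. A map \<open>g\<close> sending \<open>(m, n)\<close> to a formal sum of
  pairs and respecting the relations induces an endomorphism of \<open>M \<otimes>\<^sub>R N\<close>.
\<close>

definition tensor_relations ::
    "'r set \<Rightarrow> ('m, 'x) ring_scheme \<Rightarrow> ('m \<Rightarrow> 'r \<Rightarrow> 'm) \<Rightarrow> ('n, 'y) ring_scheme \<Rightarrow> ('r \<Rightarrow> 'n \<Rightarrow> 'n)
      \<Rightarrow> ('m \<times> 'n \<Rightarrow>\<^sub>0 int) set" where
  "tensor_relations R M \<rho> N \<sigma> =
     {frag_of (m \<oplus>\<^bsub>M\<^esub> m', n) - frag_of (m, n) - frag_of (m', n) | m m' n.
        m \<in> carrier M \<and> m' \<in> carrier M \<and> n \<in> carrier N} \<union>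
     {frag_of (m, n \<oplus>\<^bsub>N\<^esub> n') - frag_of (m, n) - frag_of (m, n') | m n n'.
        m \<in> carrier M \<and> n \<in> carrier N \<and> n' \<in> carrier N} \<union>
     {frag_of (\<rho> m r, n) - frag_of (m, \<sigma> r n) | m r n.
        m \<in> carrier M \<and> r \<in> R \<and> n \<in> carrier N}"

definition tensor_module ::
    "'r set \<Rightarrow> ('m, 'x) ring_scheme \<Rightarrow> ('m \<Rightarrow> 'r \<Rightarrow> 'm) \<Rightarrow> ('n, 'y) ring_scheme \<Rightarrow> ('r \<Rightarrow> 'n \<Rightarrow> 'n)
      \<Rightarrow> ('a \<Rightarrow> 'm \<times> 'n \<Rightarrow> 'm \<times> 'n \<Rightarrow>\<^sub>0 int) \<Rightarrow> ('a, ('m \<times> 'n \<Rightarrow>\<^sub>0 int) set) module" where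
  "tensor_module R M \<rho> N \<sigma> g =
     (let F = free_Abelian_group (carrier M \<times> carrier N);
          K = generate F (tensor_relations R M \<rho> N \<sigma>)
      in \<lparr>carrier = carrier (F Mod K), monoid.mult = undefined, one = undefined,
          ring.zero = \<one>\<^bsub>F Mod K\<^esub>, add = (\<otimes>\<^bsub>F Mod K\<^esub>),
          smult = (\<lambda>a C. \<Union>c\<in>C. K #>\<^bsub>F\<^esub> frag_extend (g a) c)\<rparr>)"


section \<open>Root systems, Weyl groups and lattices\<close>

type_synonym 'h dual = "'h \<Rightarrow>\<^sub>L real"

definition reflection :: "'h::euclidean_space \<Rightarrow> 'h \<Rightarrow> 'h" where
  "reflection \<alpha> v = v - (2 * (v \<bullet> \<alpha>) / (\<alpha> \<bullet> \<alpha>)) *\<^sub>R \<alpha>"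

definition reduced_root_system :: "'h::euclidean_space set \<Rightarrow> bool" where
  "reduced_root_system \<Delta> \<longleftrightarrow> finite \<Delta> \<and> 0 \<notin> \<Delta> \<and> span \<Delta> = UNIV \<and>
     (\<forall>\<alpha>\<in>\<Delta>. reflection \<alpha> ` \<Delta> = \<Delta>) \<and>
     (\<forall>\<alpha>\<in>\<Delta>. \<forall>\<beta>\<in>\<Delta>. 2 * (\<beta> \<bullet> \<alpha>) / (\<alpha> \<bullet> \<alpha>) \<in> \<int>) \<and>
     (\<forall>\<alpha>\<in>\<Delta>. \<forall>c. c *\<^sub>R \<alpha> \<in> \<Delta> \<longrightarrow> c = 1 \<or> c = -1)"

definition weyl_group :: "'h::euclidean_space set \<Rightarrow> ('h \<Rightarrow> 'h) set" where
  "weyl_group \<Delta> = generate (BijGroup UNIV) (reflection ` \<Delta>)"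

abbreviation winv :: "('h \<Rightarrow> 'h) \<Rightarrow> 'h \<Rightarrow> 'h" where
  "winv w \<equiv> inv_into UNIV w"

text \<open>The contragredient action on the dual space.\<close>

definition dual_act :: "('h \<Rightarrow> 'h) \<Rightarrow> 'h::euclidean_space dual \<Rightarrow> 'h dual" where
  "dual_act w x = Blinfun (\<lambda>v. blinfun_apply x (winv w v))"

definition is_lattice :: "'v::real_vector set \<Rightarrow> bool" where
  "is_lattice L \<longleftrightarrow> (\<exists>B. finite B \<and> independent B \<and> span B = UNIV \<and>
     L = {\<Sum>b\<in>B. of_int (c b) *\<^sub>R b | c :: 'v \<Rightarrow> int. True})"


section \<open>The quantum torus and twisted group algebras\<close>

text \<open>
  Here and below \<open>r\<close> stands for \<open>q\<^sup>1\<^sup>/\<^sup>n\<close>, and \<open>qpow n r t\<close> for \<open>q\<^sup>t\<close> with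
  \<open>t\<close> in \<open>(1/n)\<int>\<close>; for such \<open>t\<close> the argument of the floor is an integer.
\<close>

definition qpow :: "nat \<Rightarrow> complex \<Rightarrow> real \<Rightarrow> complex" where
  "qpow n r t = r powi \<lfloor>real n * t\<rfloor>"

text \<open>
  The function \<open>f\<close> represents the sum of all \<open>f(x,y) e\<^sup>x e\<^sup>y\<close>. The product comes from
  \<open>e\<^sup>x e\<^sup>y e\<^sup>x\<^sup>' e\<^sup>y\<^sup>' = q\<^sup>-\<^sup>\<langle>\<^sup>x\<^sup>'\<^sup>,\<^sup>y\<^sup>\<rangle> e\<^sup>x\<^sup>+\<^sup>x\<^sup>' e\<^sup>y\<^sup>+\<^sup>y\<^sup>'\<close>, a consequence of
  \<open>e\<^sup>x\<^sup>' e\<^sup>y = q\<^sup>\<langle>\<^sup>x\<^sup>'\<^sup>,\<^sup>y\<^sup>\<rangle> e\<^sup>y e\<^sup>x\<^sup>'\<close>.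
\<close>

type_synonym 'h qtorus_elem = "'h dual \<times> 'h \<Rightarrow>\<^sub>0 complex"

definition qtorus ::
    "'h::euclidean_space dual set \<Rightarrow> 'h set \<Rightarrow> nat \<Rightarrow> complex \<Rightarrow> 'h qtorus_elem ring" where
  "qtorus X Y n r =
     \<lparr>carrier = {f. Poly_Mapping.keys f \<subseteq> X \<times> Y},
      monoid.mult = (\<lambda>f g. \<Sum>(x, y)\<in>Poly_Mapping.keys f. \<Sum>(x', y')\<in>Poly_Mapping.keys g.
        Poly_Mapping.single (x + x', y + y')
          (Poly_Mapping.lookup f (x, y) * Poly_Mapping.lookup g (x', y')
            * qpow n r (- blinfun_apply x' y))),
      one = Poly_Mapping.single (0, 0) 1, ring.zero = 0, add = (+)\<rparr>"

lemma qtorus_commutation: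
  fixes x :: "'h::euclidean_space dual" and y :: 'h and r :: complex
  assumes "n > 0" and "r \<noteq> 0" and "blinfun_apply x y = of_int a / of_nat n"
  defines "ex \<equiv> Poly_Mapping.single (x, 0) 1" and "ey \<equiv> Poly_Mapping.single (0, y) 1"
  shows "ex \<otimes>\<^bsub>qtorus X Y n r\<^esub> ey = Poly_Mapping.single (x, y) 1"
    and "ex \<otimes>\<^bsub>qtorus X Y n r\<^esub> ey =
      Poly_Mapping.single (0, 0) (qpow n r (blinfun_apply x y)) \<otimes>\<^bsub>qtorus X Y n r\<^esub>
        (ey \<otimes>\<^bsub>qtorus X Y n r\<^esub> ex)"
  using assms
  by (simp_all add: qtorus_def qpow_def blinfun.zero_left blinfun.zero_right
      power_int_minus)

definition qtorus_act :: "('h \<Rightarrow> 'h) \<Rightarrow> 'h::euclidean_space qtorus_elem \<Rightarrow> 'h qtorus_elem" where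
  "qtorus_act w f = (\<Sum>(x, y)\<in>Poly_Mapping.keys f.
     Poly_Mapping.single (dual_act w x, w y) (Poly_Mapping.lookup f (x, y)))"

text \<open>
  The twisted group algebra \<open>K[G]\<close> of a finite group \<open>G\<close> of bijections acting on the ring \<open>K\<close>
  through \<open>act\<close>. The function \<open>F\<close> represents the sum of all \<open>F(w) \<otimes> w\<close>. Hence the product
  rule \<open>(f \<otimes> w)(g \<otimes> w') = f \<cdot> \<^sup>wg \<otimes> ww'\<close> reads
  \<open>(F G)(u) = \<Sum>\<^sub>w F(w) \<cdot> \<^sup>w(G(w\<^sup>-\<^sup>1u))\<close>.
\<close>

definition twisted_group_algebra ::
    "('k, 'x) ring_scheme \<Rightarrow> (('h \<Rightarrow> 'h) \<Rightarrow> 'k \<Rightarrow> 'k) \<Rightarrow> ('h \<Rightarrow> 'h) set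
      \<Rightarrow> (('h \<Rightarrow> 'h) \<Rightarrow> 'k) ring" where
  "twisted_group_algebra K act G =
     \<lparr>carrier = {F. (\<forall>w\<in>G. F w \<in> carrier K) \<and> (\<forall>w. w \<notin> G \<longrightarrow> F w = \<zero>\<^bsub>K\<^esub>)},
      monoid.mult = (\<lambda>F F' u. \<Oplus>\<^bsub>K\<^esub>w\<in>G. F w \<otimes>\<^bsub>K\<^esub> act w (F' (winv w \<circ> u))),
      one = (\<lambda>u. if u = id then \<one>\<^bsub>K\<^esub> else \<zero>\<^bsub>K\<^esub>), ring.zero = (\<lambda>u. \<zero>\<^bsub>K\<^esub>),
      add = (\<lambda>F F' u. F u \<oplus>\<^bsub>K\<^esub> F' u)\<rparr>"

text \<open>The element \<open>k \<otimes> w\<close>.\<close>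

definition tga_elem :: "('k, 'x) ring_scheme \<Rightarrow> 'k \<Rightarrow> ('h \<Rightarrow> 'h) \<Rightarrow> ('h \<Rightarrow> 'h) \<Rightarrow> 'k" where
  "tga_elem K k w = (\<lambda>u. if u = w then k else \<zero>\<^bsub>K\<^esub>)"

definition complex_ring :: "complex ring" where
  "complex_ring = \<lparr>carrier = UNIV, monoid.mult = (*), one = 1, ring.zero = 0, add = (+)\<rparr>"

text \<open>The ordinary group algebra \<open>\<complex>[G]\<close>; its modules are the complex \<open>G\<close>-modules.\<close>

definition group_algebra :: "('h \<Rightarrow> 'h) set \<Rightarrow> (('h \<Rightarrow> 'h) \<Rightarrow> complex) ring" where
  "group_algebra G = twisted_group_algebra complex_ring (\<lambda>w c. c) G"

text \<open>
  Simple modules of a finite group are finite-dimensional, so every isomorphism class has a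
  member whose carrier lies in \<open>nat \<Rightarrow> complex\<close>. Isomorphic modules are not identified here.
\<close>

definition simple_group_modules ::
    "('h \<Rightarrow> 'h) set \<Rightarrow> (('h \<Rightarrow> 'h) \<Rightarrow> complex, nat \<Rightarrow> complex) module set" where
  "simple_group_modules G = {\<xi>. simple_module (group_algebra G) \<xi>}"

text \<open>\<open>\<H>[G]\<close> for a subgroup \<open>G\<close> of the Weyl group.\<close>

definition qtorus_tga ::
    "'h::euclidean_space dual set \<Rightarrow> 'h set \<Rightarrow> nat \<Rightarrow> complex \<Rightarrow> ('h \<Rightarrow> 'h) set
      \<Rightarrow> (('h \<Rightarrow> 'h) \<Rightarrow> 'h qtorus_elem) ring" where
  "qtorus_tga X Y n r G = twisted_group_algebra (qtorus X Y n r) qtorus_act G"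

text \<open>The structure map \<open>\<complex> \<rightarrow> \<H>[W]\<close> and the image of \<open>(\<complex>X)\<^sup>W\<close> in \<open>\<H>[W]\<close>.\<close>

definition qtorus_scalar ::
    "'h::euclidean_space dual set \<Rightarrow> 'h set \<Rightarrow> nat \<Rightarrow> complex \<Rightarrow> complex
      \<Rightarrow> ('h \<Rightarrow> 'h) \<Rightarrow> 'h qtorus_elem" where
  "qtorus_scalar X Y n r c = tga_elem (qtorus X Y n r) (Poly_Mapping.single (0, 0) c) id"

definition invariant_CX ::
    "'h::euclidean_space set \<Rightarrow> 'h dual set \<Rightarrow> 'h set \<Rightarrow> nat \<Rightarrow> complex
      \<Rightarrow> (('h \<Rightarrow> 'h) \<Rightarrow> 'h qtorus_elem) set" where
  "invariant_CX \<Delta> X Y n r =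
     {tga_elem (qtorus X Y n r) f id | f. Poly_Mapping.keys f \<subseteq> X \<times> {0} \<and>
        (\<forall>w\<in>weyl_group \<Delta>. qtorus_act w f = f)}"


section \<open>The torus \<open>T\<close>, the quotient \<open>\<Lambda> = T/q\<^sup>Y\<close> and the modules\<close>

text \<open>
  The letters \<open>\<lambda>\<close> and \<open>\<chi>\<close> are binders in HOL and HOL-Analysis; in terms, the point \<open>\<lambda>\<close> of \<open>T\<close>
  is called \<open>l\<close> and the module \<open>\<chi>\<close> is called \<open>\<xi>\<close>.
\<close>

type_synonym 'h torus_elem = "'h dual \<Rightarrow> complex"

definition torus :: "'h::euclidean_space dual set \<Rightarrow> 'h torus_elem monoid" where
  "torus X =
     \<lparr>carrier = {\<mu> \<in> extensional X. (\<forall>x\<in>X. \<mu> x \<noteq> 0) \<and> (\<forall>x\<in>X. \<forall>x'\<in>X. \<mu> (x + x') = \<mu> x * \<mu> x')},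
      monoid.mult = (\<lambda>\<mu> \<nu>. \<lambda>x\<in>X. \<mu> x * \<nu> x), one = (\<lambda>x\<in>X. 1)\<rparr>"

definition qchar :: "'h::euclidean_space dual set \<Rightarrow> nat \<Rightarrow> complex \<Rightarrow> 'h \<Rightarrow> 'h torus_elem" where
  "qchar X n r y = (\<lambda>x\<in>X. qpow n r (blinfun_apply x y))"

definition torus_act ::
    "'h::euclidean_space dual set \<Rightarrow> ('h \<Rightarrow> 'h) \<Rightarrow> 'h torus_elem \<Rightarrow> 'h torus_elem" where
  "torus_act X w \<mu> = (\<lambda>x\<in>X. \<mu> (dual_act (winv w) x))"

text \<open>The image of \<open>\<lambda>\<close> in \<open>\<Lambda>\<close>, that is, the coset \<open>\<lambda> \<cdot> q\<^sup>Y\<close>; \<open>W\<close> acts on cosets elementwise.\<close>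

definition torus_class ::
    "'h::euclidean_space dual set \<Rightarrow> 'h set \<Rightarrow> nat \<Rightarrow> complex \<Rightarrow> 'h torus_elem
      \<Rightarrow> 'h torus_elem set" where
  "torus_class X Y n r l = (qchar X n r ` Y) #>\<^bsub>torus X\<^esub> l"

definition Lambda ::
    "'h::euclidean_space dual set \<Rightarrow> 'h set \<Rightarrow> nat \<Rightarrow> complex \<Rightarrow> 'h torus_elem set set" where
  "Lambda X Y n r = carrier (torus X Mod (qchar X n r ` Y))"

definition Lambda_orbit ::
    "'h::euclidean_space set \<Rightarrow> 'h dual set \<Rightarrow> 'h torus_elem set \<Rightarrow> 'h torus_elem set set" where
  "Lambda_orbit \<Delta> X C = {torus_act X w ` C | w. w \<in> weyl_group \<Delta>}"

text \<open>A set of representatives in \<open>T\<close> of the \<open>W\<close>-orbits in \<open>\<Lambda>\<close>.\<close>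

definition orbit_representatives ::
    "'h::euclidean_space set \<Rightarrow> 'h dual set \<Rightarrow> 'h set \<Rightarrow> nat \<Rightarrow> complex \<Rightarrow> 'h torus_elem set
      \<Rightarrow> bool" where
  "orbit_representatives \<Delta> X Y n r S \<longleftrightarrow> S \<subseteq> carrier (torus X) \<and>
     bij_betw (\<lambda>l. Lambda_orbit \<Delta> X (torus_class X Y n r l)) S
       (Lambda_orbit \<Delta> X ` Lambda X Y n r)"

definition isotropy_group ::
    "'h::euclidean_space set \<Rightarrow> 'h dual set \<Rightarrow> 'h set \<Rightarrow> nat \<Rightarrow> complex \<Rightarrow> 'h torus_elem
      \<Rightarrow> ('h \<Rightarrow> 'h) set" where
  "isotropy_group \<Delta> X Y n r l =
     {w \<in> weyl_group \<Delta>. torus_act X w ` torus_class X Y n r l = torus_class X Y n r l}"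

text \<open>
  Elements of \<open>M\<^sub>\<lambda>\<close> are finitely supported functions on \<open>\<lambda> \<cdot> q\<^sup>Y\<close>, with
  \<open>v\<^sub>\<mu> = Poly_Mapping.single \<mu> 1\<close>. By the definition of the action,
  \<open>e\<^sup>x e\<^sup>y v\<^sub>\<mu> = x(\<nu>) v\<^sub>\<nu>\<close> with \<open>\<nu> = \<mu> q\<^sup>y\<close>, where \<open>x(\<nu>)\<close> is the value \<open>\<nu> x\<close>.
\<close>

definition Mlambda_torus_act ::
    "'h::euclidean_space dual set \<Rightarrow> nat \<Rightarrow> complex \<Rightarrow> 'h qtorus_elem
      \<Rightarrow> ('h torus_elem \<Rightarrow>\<^sub>0 complex) \<Rightarrow> ('h torus_elem \<Rightarrow>\<^sub>0 complex)" where
  "Mlambda_torus_act X n r f v =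
     (\<Sum>(x, y)\<in>Poly_Mapping.keys f. \<Sum>\<mu>\<in>Poly_Mapping.keys v.
        let \<nu> = \<mu> \<otimes>\<^bsub>torus X\<^esub> qchar X n r y in
        Poly_Mapping.single \<nu> (Poly_Mapping.lookup f (x, y) * Poly_Mapping.lookup v \<mu> * \<nu> x))"

definition Mlambda_weyl_act ::
    "'h::euclidean_space dual set \<Rightarrow> ('h \<Rightarrow> 'h)
      \<Rightarrow> ('h torus_elem \<Rightarrow>\<^sub>0 complex) \<Rightarrow> ('h torus_elem \<Rightarrow>\<^sub>0 complex)" where
  "Mlambda_weyl_act X w v =
     (\<Sum>\<mu>\<in>Poly_Mapping.keys v. Poly_Mapping.single (torus_act X w \<mu>) (Poly_Mapping.lookup v \<mu>))"

definition Mlambda ::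
    "'h::euclidean_space set \<Rightarrow> 'h dual set \<Rightarrow> 'h set \<Rightarrow> nat \<Rightarrow> complex \<Rightarrow> 'h torus_elem
      \<Rightarrow> (('h \<Rightarrow> 'h) \<Rightarrow> 'h qtorus_elem, 'h torus_elem \<Rightarrow>\<^sub>0 complex) module" where
  "Mlambda \<Delta> X Y n r l =
     \<lparr>carrier = {v. Poly_Mapping.keys v \<subseteq> torus_class X Y n r l},
      monoid.mult = undefined, one = undefined, ring.zero = 0, add = (+),
      smult = (\<lambda>F v. \<Sum>w\<in>isotropy_group \<Delta> X Y n r l.
        Mlambda_torus_act X n r (F w) (Mlambda_weyl_act X w v))\<rparr>"

text \<open>
  \<open>V\<^sub>\<xi> = M\<^sub>\<lambda> \<otimes>\<^sub>\<complex> \<xi>\<close> for a \<open>\<complex>[W\<^sup>\<lambda>]\<close>-module \<open>\<xi>\<close>, with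
  \<open>(f \<otimes> w) (v \<otimes> t) = (f \<otimes> w) v \<otimes> w t\<close>.
\<close>

definition V_module ::
    "'h::euclidean_space set \<Rightarrow> 'h dual set \<Rightarrow> 'h set \<Rightarrow> nat \<Rightarrow> complex \<Rightarrow> 'h torus_elem
      \<Rightarrow> (('h \<Rightarrow> 'h) \<Rightarrow> complex, 'c) module
      \<Rightarrow> (('h \<Rightarrow> 'h) \<Rightarrow> 'h qtorus_elem,
          (('h torus_elem \<Rightarrow>\<^sub>0 complex) \<times> 'c \<Rightarrow>\<^sub>0 int) set) module" where
  "V_module \<Delta> X Y n r l \<xi> =
     tensor_module UNIV
       (Mlambda \<Delta> X Y n r l) (\<lambda>v c. Poly_Mapping.map (\<lambda>z. z * c) v)
       \<xi> (\<lambda>c t. tga_elem complex_ring c id \<odot>\<^bsub>\<xi>\<^esub> t)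
       (\<lambda>F (v, t). \<Sum>w\<in>isotropy_group \<Delta> X Y n r l.
          frag_of (tga_elem (qtorus X Y n r) (F w) w \<odot>\<^bsub>Mlambda \<Delta> X Y n r l\<^esub> v,
                   tga_elem complex_ring 1 w \<odot>\<^bsub>\<xi>\<^esub> t))"

text \<open>\<open>Z\<^sub>\<xi> = \<H>[W] \<otimes> V\<^sub>\<xi>\<close> over \<open>\<H>[W\<^sup>\<lambda>]\<close>, which is literally a subring of \<open>\<H>[W]\<close>.\<close>

definition Z_module ::
    "'h::euclidean_space set \<Rightarrow> 'h dual set \<Rightarrow> 'h set \<Rightarrow> nat \<Rightarrow> complex \<Rightarrow> 'h torus_elem
      \<Rightarrow> (('h \<Rightarrow> 'h) \<Rightarrow> complex, 'c) module
      \<Rightarrow> (('h \<Rightarrow> 'h) \<Rightarrow> 'h qtorus_elem,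
          ((('h \<Rightarrow> 'h) \<Rightarrow> 'h qtorus_elem) \<times>
            (('h torus_elem \<Rightarrow>\<^sub>0 complex) \<times> 'c \<Rightarrow>\<^sub>0 int) set \<Rightarrow>\<^sub>0 int) set) module" where
  "Z_module \<Delta> X Y n r l \<xi> =
     (let HW = qtorus_tga X Y n r (weyl_group \<Delta>);
          V = V_module \<Delta> X Y n r l \<xi>
      in tensor_module (carrier (qtorus_tga X Y n r (isotropy_group \<Delta> X Y n r l)))
           HW (\<otimes>\<^bsub>HW\<^esub>) V (\<odot>\<^bsub>V\<^esub>)
           (\<lambda>F (b, v). frag_of (F \<otimes>\<^bsub>HW\<^esub> b, v)))"

end

theory Submission
  imports Defs "HOL-Computational_Algebra.Fundamental_Theorem_Algebra"
begin

text \<open>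
  The proof is a Clifford--Mackey argument whose ``normal subgroup'' is the quantum torus.

  Existence of a weight. The Laurent polynomials \<open>\<complex>X\<close> are integral over their invariants: \<open>e\<^sup>x\<close> is a root of
  the orbit polynomial \<open>\<Prod>\<^sub>w (t - e\<^sup>w\<^sup>x)\<close>. Invariants act locally finitely, so each of them is killed, on a given
  vector, by a nonzero complex polynomial, and over \<open>\<complex>\<close> this produces eigenvectors. Taking eigenvectors first for
  the finitely many coefficients of the orbit polynomials of a basis of \<open>X\<close>, then for the \<open>e\<^sup>x\<close> of that basis,
  gives a nonzero vector on which all of \<open>\<complex>X\<close> acts through one point \<open>\<mu>\<close> of \<open>T\<close> (\<open>weight_vector_exists\<close>). The
  elements \<open>e\<^sup>y\<close> and \<open>w\<close> carry the weight space of \<open>\<mu>\<close> onto those of \<open>\<mu> q\<^sup>y\<close> and \<open>w \<mu>\<close>, so \<open>\<mu>\<close> may be replaced by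
  the chosen representative \<open>l\<close> of its orbit.

  The module \<open>\<xi>\<close>. As \<open>q\<close> is not a root of unity and the pairing is non-degenerate, \<open>y \<mapsto> q\<^sup>y\<close> is injective on
  \<open>Y\<close>. Hence each \<open>w\<close> in the isotropy group \<open>G\<close> of the class of \<open>l\<close> determines a unique \<open>y\<close>, called
  \<open>cocycle w\<close>, with \<open>w l = l q\<^sup>y\<close>, and \<open>w \<mapsto> e\<^sup>-\<^sup>y w\<close> makes the weight space of \<open>l\<close> a \<open>G\<close>-module
  (\<open>untwist_mult\<close>). Distinct weights can be separated by elements of \<open>\<complex>X\<close> (\<open>separate_weights\<close>), so the part
  of weight \<open>l\<close> of the \<open>\<H>[W]\<close>-module generated by a \<open>G\<close>-submodule is that submodule. Simplicity of \<open>M\<close>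
  therefore passes to the weight space (\<open>weight_space_simple\<close>), which is then spanned by the orbit of one vector and so has a copy \<open>\<xi>\<close> consisting of
  sequences of complex numbers.

  The isomorphism. The universal property of the two tensor products gives a homomorphism
  \<open>F \<otimes> (v\<^sub>\<mu> \<otimes> t) \<mapsto> F e\<^sup>y t\<close>, where \<open>\<mu> = l q\<^sup>y\<close>, from the induced module to \<open>M\<close>. It is onto because \<open>M\<close> is simple.
  It is one-to-one because every element of the induced module is a sum of elements \<open>w \<otimes> (v\<^sub>\<mu> \<otimes> t)\<close> whose images
  have pairwise different weights (\<open>normal_form_exists\<close>), and separating the weights kills these summands
  one at a time (\<open>normal_form_inj\<close>).
\<close>

section \<open>Finitely supported functions and linear systems\<close>

abbreviation single where "single \<equiv> Poly_Mapping.single"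
abbreviation keys where "keys \<equiv> Poly_Mapping.keys"
abbreviation lookup where "lookup \<equiv> Poly_Mapping.lookup"

lemma poly_mapping_keys_induct [consumes 1, case_names zero add]:
  fixes f :: "'a \<Rightarrow>\<^sub>0 'b::comm_monoid_add"
  assumes "keys f \<subseteq> A"
    and zero: "P 0"
    and add: "\<And>k c g. k \<in> A \<Longrightarrow> keys g \<subseteq> A \<Longrightarrow> P g \<Longrightarrow> P (single k c + g)"
  shows "P f"
proof -
  have fin: "finite K \<Longrightarrow> K \<subseteq> A \<Longrightarrow>
    P (\<Sum>k\<in>K. single k (lookup f k)) \<and>
    keys (\<Sum>k\<in>K. single k (lookup f k)) \<subseteq> A" for K
  proof (induction K rule: finite_induct)
    case empty
    then show ?case using zero by simp
  next
    case (insert k K)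
    let ?g = "\<Sum>k\<in>K. single k (lookup f k)"
    have "keys (single k (lookup f k) + ?g) \<subseteq> A"
      using insert Poly_Mapping.keys_add[of "single k (lookup f k)" ?g]
      by (auto split: if_splits)
    then show ?case using insert add[of k ?g] by auto
  qed
  have "f = (\<Sum>k\<in>keys f. single k (lookup f k))"
    by (rule poly_mapping_eqI)
      (auto simp: lookup_sum lookup_single when_def in_keys_iff)
  then show ?thesis using fin[of "keys f"] assms(1) by simp
qed

text \<open>
  Gaussian elimination: one equation is used to eliminate one unknown.
\<close>

lemma homogeneous_system_nontrivial:
  fixes c :: "'k \<Rightarrow> 's \<Rightarrow> complex"
  assumes "finite S" and "finite K" and "card S < card K"
  shows "\<exists>d. (\<exists>k\<in>K. d k \<noteq> 0) \<and> (\<forall>s\<in>S. (\<Sum>k\<in>K. d k * c k s) = 0)"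
  using assms
proof (induction S arbitrary: K c rule: finite_induct)
  case empty
  then obtain k where "k \<in> K" by fastforce
  then show ?case by (intro exI[of _ "\<lambda>_. 1"]) auto
next
  case (insert s0 S)
  show ?case
  proof (cases "\<forall>k\<in>K. c k s0 = 0")
    case True
    have "card S < card K" using insert by simp
    from insert.IH[OF insert.prems(1) this, of c] True show ?thesis by auto
  next
    case False
    then obtain k0 where k0: "k0 \<in> K" "c k0 s0 \<noteq> 0" by auto
    define c' where "c' k s = c k s - c k s0 / c k0 s0 * c k0 s" for k s
    have "card S < card (K - {k0})" using insert k0 by auto
    from insert.IH[OF _ this, of c'] insert.prems(1)
    obtain d where d: "\<exists>k\<in>K - {k0}. d k \<noteq> 0" "\<forall>s\<in>S. (\<Sum>k\<in>K - {k0}. d k * c' k s) = 0" by auto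
    \<comment> \<open>the value of the eliminated unknown, forced by the equation for \<open>s0\<close>\<close>
    define e where "e = - (\<Sum>k\<in>K - {k0}. d k * (c k s0 / c k0 s0))"
    let ?d = "d(k0 := e)"
    have split: "(\<Sum>k\<in>K. ?d k * c k s) = e * c k0 s + (\<Sum>k\<in>K - {k0}. d k * c k s)" for s
      using insert.prems(1) k0(1) by (subst sum.remove[of _ k0]) (auto intro!: sum.cong)
    have eq: "e * c k0 s + (\<Sum>k\<in>K - {k0}. d k * c k s) = (\<Sum>k\<in>K - {k0}. d k * c' k s)" for s
      unfolding e_def c'_def
      by (simp add: sum_distrib_left sum_subtractf algebra_simps)
    have "(\<Sum>k\<in>K - {k0}. d k * c' k s0) = 0"
      unfolding c'_def using k0 by simp
    then have "\<forall>s\<in>insert s0 S. (\<Sum>k\<in>K. ?d k * c k s) = 0"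
      unfolding split eq using d(2) by auto
    moreover have "\<exists>k\<in>K. ?d k \<noteq> 0" using d(1) by auto
    ultimately show ?thesis by blast
  qed
qed

section \<open>Tensor products as quotients of free abelian groups\<close>

lemma comm_group_cong:
  assumes "comm_group G" and "carrier H = carrier G" "(\<otimes>\<^bsub>H\<^esub>) = (\<otimes>\<^bsub>G\<^esub>)" "\<one>\<^bsub>H\<^esub> = \<one>\<^bsub>G\<^esub>"
  shows "comm_group H"
  using assms
  unfolding comm_group_def comm_monoid_def monoid_def comm_monoid_axioms_def
    group_def group_axioms_def Units_def assms(2-4) by blast

text \<open>
  Both tensor products in the definition of the induced module are instances: the first has the field as its ring
  of scalars, the second a noncommutative ring.
\<close>

locale tensor_data =
  A?: abelian_group A + B?: abelian_group B
  for R :: "'r set" and A :: "('m, 'x) ring_scheme" (structure) and \<rho> :: "'m \<Rightarrow> 'r \<Rightarrow> 'm"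
    and B :: "('n, 'y) ring_scheme" (structure) and \<sigma> :: "'r \<Rightarrow> 'n \<Rightarrow> 'n" +
  assumes \<rho>_closed: "a \<in> carrier A \<Longrightarrow> r \<in> R \<Longrightarrow> \<rho> a r \<in> carrier A"
    and \<sigma>_closed: "b \<in> carrier B \<Longrightarrow> r \<in> R \<Longrightarrow> \<sigma> r b \<in> carrier B"
begin

abbreviation formal_sums where "formal_sums \<equiv> free_Abelian_group (carrier A \<times> carrier B)"
abbreviation relations where "relations \<equiv> generate formal_sums (tensor_relations R A \<rho> B \<sigma>)"

definition coset :: "('m \<times> 'n \<Rightarrow>\<^sub>0 int) \<Rightarrow> ('m \<times> 'n \<Rightarrow>\<^sub>0 int) set" where
  "coset c = relations #>\<^bsub>formal_sums\<^esub> c"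

definition tens :: "'m \<Rightarrow> 'n \<Rightarrow> ('m \<times> 'n \<Rightarrow>\<^sub>0 int) set" where
  "tens a b = coset (frag_of (a, b))"

lemma tensor_relations_subset: "tensor_relations R A \<rho> B \<sigma> \<subseteq> carrier formal_sums"
proof -
  have *: "frag_of p - frag_of p' - frag_of p'' \<in> carrier formal_sums"
    if "p \<in> carrier A \<times> carrier B" "p' \<in> carrier A \<times> carrier B" "p'' \<in> carrier A \<times> carrier B" for p p' p''
    using that by (auto dest!: subsetD[OF keys_diff])
  have **: "frag_of p - frag_of p' \<in> carrier formal_sums"
    if "p \<in> carrier A \<times> carrier B" "p' \<in> carrier A \<times> carrier B" for p p'
    using that by (auto dest!: subsetD[OF keys_diff])
  show ?thesis
    unfolding tensor_relations_def
    using \<rho>_closed \<sigma>_closed by (auto intro!: * ** simp del: carrier_free_Abelian_group_iff)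
qed

lemma relations_subgroup: "subgroup relations formal_sums"
  by (rule group.generate_is_subgroup) (use tensor_relations_subset in auto)

lemma relations_normal: "relations \<lhd> formal_sums"
  by (intro comm_group.subgroup_imp_normal relations_subgroup abelian_free_Abelian_group)

text \<open>
  The relations will be checked for endomorphisms that send a pair to a sum over a group; this reduces such a check
  to single summands.
\<close>

lemma relations_sum: "(\<And>i. i \<in> I \<Longrightarrow> f i \<in> relations) \<Longrightarrow> (\<Sum>i\<in>I. f i) \<in> relations"
proof (induction I rule: infinite_finite_induct)
  case (insert i I)
  then show ?case
    using subgroup.m_closed[OF relations_subgroup, of "f i" "sum f I"] by simp
qed (use subgroup.one_closed[OF relations_subgroup] in auto)

lemma rel_add_left: "a \<in> carrier A \<Longrightarrow> a' \<in> carrier A \<Longrightarrow> b \<in> carrier B \<Longrightarrow>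
    frag_of (a \<oplus>\<^bsub>A\<^esub> a', b) - frag_of (a, b) - frag_of (a', b) \<in> relations"
  by (rule generate.incl) (auto simp: tensor_relations_def)

lemma rel_add_right: "a \<in> carrier A \<Longrightarrow> b \<in> carrier B \<Longrightarrow> b' \<in> carrier B \<Longrightarrow>
    frag_of (a, b \<oplus>\<^bsub>B\<^esub> b') - frag_of (a, b) - frag_of (a, b') \<in> relations"
  by (rule generate.incl) (auto simp: tensor_relations_def)

lemma rel_balanced: "a \<in> carrier A \<Longrightarrow> b \<in> carrier B \<Longrightarrow> s \<in> R \<Longrightarrow>
    frag_of (\<rho> a s, b) - frag_of (a, \<sigma> s b) \<in> relations"
  by (rule generate.incl) (unfold tensor_relations_def, blast)

context
  fixes g :: "'a \<Rightarrow> 'm \<times> 'n \<Rightarrow> 'm \<times> 'n \<Rightarrow>\<^sub>0 int"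
begin

abbreviation T where "T \<equiv> tensor_module R A \<rho> B \<sigma> g"

lemma tensor_simps:
  "carrier T = carrier (formal_sums Mod relations)"
  "(\<oplus>\<^bsub>T\<^esub>) = (\<otimes>\<^bsub>formal_sums Mod relations\<^esub>)"
  "\<zero>\<^bsub>T\<^esub> = \<one>\<^bsub>formal_sums Mod relations\<^esub>"
  by (simp_all add: tensor_module_def Let_def)

lemma abelian_group_tensor: "abelian_group T"
proof -
  have "comm_group (formal_sums Mod relations)"
    by (intro comm_group.abelian_FactGroup abelian_free_Abelian_group relations_subgroup)
  then have "comm_group (add_monoid T)"
    by (rule comm_group_cong) (simp_all only: tensor_simps partial_object.select_convs monoid.select_convs)
  then show "abelian_group T"
    by (simp add: abelian_group_def abelian_monoid_def abelian_group_axioms_def comm_group_def)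
qed

interpretation T: abelian_group T by (rule abelian_group_tensor)

lemma tensor_carrier: "carrier T = coset ` carrier formal_sums"
  unfolding coset_def by (auto simp: tensor_module_def Let_def FactGroup_def RCOSETS_def)

lemma coset_closed: "c \<in> carrier formal_sums \<Longrightarrow> coset c \<in> carrier T"
  by (simp add: tensor_carrier)

lemma tens_closed [simp]: "a \<in> carrier A \<Longrightarrow> b \<in> carrier B \<Longrightarrow> tens a b \<in> carrier T"
  unfolding tens_def by (rule coset_closed) (auto)

lemma coset_add: "c \<in> carrier formal_sums \<Longrightarrow> c' \<in> carrier formal_sums \<Longrightarrow>
    coset (c + c') = coset c \<oplus>\<^bsub>T\<^esub> coset c'"
  using normal.rcos_sum[OF relations_normal, of c c']
  by (simp add: tensor_module_def Let_def FactGroup_def coset_def)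

lemma coset_eq_zero: "c \<in> relations \<Longrightarrow> coset c = \<zero>\<^bsub>T\<^esub>"
  using subgroup.rcos_const[OF relations_subgroup, of c]
  by (simp add: tensor_module_def Let_def FactGroup_def coset_def)

lemma coset_0: "coset 0 = \<zero>\<^bsub>T\<^esub>"
  using subgroup.one_closed[OF relations_subgroup] by (intro coset_eq_zero) simp

lemma coset_diff: 
  assumes "c \<in> carrier formal_sums" "c' \<in> carrier formal_sums"
  shows "coset (c - c') = coset c \<ominus>\<^bsub>T\<^esub> coset c'"
proof -
  have d: "c - c' \<in> carrier formal_sums" using assms keys_diff[of c c'] by auto
  have "coset c = coset (c - c') \<oplus>\<^bsub>T\<^esub> coset c'" using coset_add[OF d assms(2)] by simp
  then show ?thesis using coset_closed[OF d] coset_closed[OF assms(1)] coset_closed[OF assms(2)]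
    by (simp add: a_minus_def T.a_assoc T.r_neg)
qed

lemma coset_eqI: 
  assumes "c \<in> carrier formal_sums" "c' \<in> carrier formal_sums" "c - c' \<in> relations"
  shows "coset c = coset c'"
proof -
  have "coset c = coset ((c - c') + c')" by simp
  also have "\<dots> = coset (c - c') \<oplus>\<^bsub>T\<^esub> coset c'"
    using assms keys_diff[of c c'] by (intro coset_add) auto
  also have "\<dots> = coset c'" using assms coset_closed[OF assms(2)] by (simp add: coset_eq_zero)
  finally show ?thesis .
qed

lemma tens_add_left:
  assumes "a \<in> carrier A" "a' \<in> carrier A" "b \<in> carrier B"
  shows "tens (a \<oplus>\<^bsub>A\<^esub> a') b = tens a b \<oplus>\<^bsub>T\<^esub> tens a' b"
proof -
  have k: "frag_of (a, b) + frag_of (a', b) \<in> carrier formal_sums"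
    using assms by (auto dest!: subsetD[OF Poly_Mapping.keys_add])
  show ?thesis unfolding tens_def
    using assms k rel_add_left[OF assms]
    by (subst coset_add[symmetric]) (simp_all add: coset_eqI diff_diff_eq)
qed

lemma tens_add_right:
  assumes "a \<in> carrier A" "b \<in> carrier B" "b' \<in> carrier B"
  shows "tens a (b \<oplus>\<^bsub>B\<^esub> b') = tens a b \<oplus>\<^bsub>T\<^esub> tens a b'"
proof -
  have k: "frag_of (a, b) + frag_of (a, b') \<in> carrier formal_sums"
    using assms by (auto dest!: subsetD[OF Poly_Mapping.keys_add])
  show ?thesis unfolding tens_def
    using assms k rel_add_right[OF assms]
    by (subst coset_add[symmetric]) (simp_all add: coset_eqI diff_diff_eq)
qed

lemma tens_balanced:
  assumes "a \<in> carrier A" "b \<in> carrier B" "s \<in> R"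
  shows "tens (\<rho> a s) b = tens a (\<sigma> s b)"
  unfolding tens_def using assms \<rho>_closed \<sigma>_closed rel_balanced[OF assms]
  by (intro coset_eqI) (auto)

lemma tens_zero_left: "b \<in> carrier B \<Longrightarrow> tens \<zero>\<^bsub>A\<^esub> b = \<zero>\<^bsub>T\<^esub>"
  using tens_add_left[of "\<zero>\<^bsub>A\<^esub>" "\<zero>\<^bsub>A\<^esub>" b] T.add.l_cancel_one'[of "tens \<zero>\<^bsub>A\<^esub> b" "tens \<zero>\<^bsub>A\<^esub> b"] by auto

lemma tens_zero_right: "a \<in> carrier A \<Longrightarrow> tens a \<zero>\<^bsub>B\<^esub> = \<zero>\<^bsub>T\<^esub>"
  using tens_add_right[of a "\<zero>\<^bsub>B\<^esub>" "\<zero>\<^bsub>B\<^esub>"] T.add.l_cancel_one'[of "tens a \<zero>\<^bsub>B\<^esub>" "tens a \<zero>\<^bsub>B\<^esub>"] by auto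

lemma tens_minus_left: 
  assumes "a \<in> carrier A" "b \<in> carrier B" shows "tens (\<ominus>\<^bsub>A\<^esub> a) b = \<ominus>\<^bsub>T\<^esub> tens a b"
proof -
  have "tens (\<ominus>\<^bsub>A\<^esub> a) b \<oplus>\<^bsub>T\<^esub> tens a b = \<zero>\<^bsub>T\<^esub>"
    using assms tens_add_left[of "\<ominus>\<^bsub>A\<^esub> a" a b] A.l_neg[of a] tens_zero_left by simp
  then show ?thesis using assms by (intro T.minus_equality[symmetric]) auto
qed

text \<open>
  Negatives need no case of their own: minus a pure tensor is again a pure tensor. The induction runs over formal
  differences, so it has to treat a formal sum together with its negative.
\<close>

lemma tensor_induct [consumes 1, case_names tens add]:
  assumes z: "z \<in> carrier T"
    and tens: "\<And>a b. a \<in> carrier A \<Longrightarrow> b \<in> carrier B \<Longrightarrow> P (tens a b)"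
    and add: "\<And>z z'. z \<in> carrier T \<Longrightarrow> z' \<in> carrier T \<Longrightarrow> P z \<Longrightarrow> P z' \<Longrightarrow> P (z \<oplus>\<^bsub>T\<^esub> z')"
  shows "P z"
proof -
  obtain c where c: "keys c \<subseteq> carrier A \<times> carrier B" "z = coset c"
    using z by (auto simp: tensor_carrier)
  have "keys c \<subseteq> carrier A \<times> carrier B \<and> P (coset c) \<and> P (coset (- c))"
    using c(1)
  proof (induction c rule: frag_induction)
    case zero
    have "P \<zero>\<^bsub>T\<^esub>" using tens[of "\<zero>\<^bsub>A\<^esub>" "\<zero>\<^bsub>B\<^esub>"] by (simp add: tens_zero_left)
    then show ?case by (simp add: coset_0)
  next
    case (one p)
    then obtain a b where p: "p = (a, b)" "a \<in> carrier A" "b \<in> carrier B" by auto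
    have "coset (0 - frag_of p) = tens (\<ominus>\<^bsub>A\<^esub> a) b"
      using p by (subst coset_diff) (auto simp: coset_0 tens_minus_left a_minus_def
          tens_def[symmetric])
    then show ?case using tens p by (auto simp: tens_def[symmetric])
  next
    case (diff c c')
    have m: "keys (c - c') \<subseteq> carrier A \<times> carrier B" using diff keys_diff[of c c'] by auto
    have "coset (c + - c') = coset c \<oplus>\<^bsub>T\<^esub> coset (- c')" using diff by (intro coset_add) auto
    moreover have "coset (c' + - c) = coset c' \<oplus>\<^bsub>T\<^esub> coset (- c)" using diff by (intro coset_add) auto
    moreover have "coset c \<in> carrier T" "coset (- c) \<in> carrier T" "coset c' \<in> carrier T" "coset (- c') \<in> carrier T"
      using diff by (auto intro!: coset_closed)
    ultimately show ?case using diff m add[of "coset c" "coset (- c')"] add[of "coset c'" "coset (- c)"] by simp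
  qed
  then show ?thesis using c by simp
qed

text \<open>
  A biadditive balanced map extends to formal sums by freeness, and its kernel contains the generators of
  the relations.
\<close>

lemma tensor_universal:
  assumes "abelian_group D"
    and \<beta>: "\<And>a b. a \<in> carrier A \<Longrightarrow> b \<in> carrier B \<Longrightarrow> \<beta> a b \<in> carrier D"
    and add_left: "\<And>a a' b. a \<in> carrier A \<Longrightarrow> a' \<in> carrier A \<Longrightarrow> b \<in> carrier B \<Longrightarrow>
      \<beta> (a \<oplus>\<^bsub>A\<^esub> a') b = \<beta> a b \<oplus>\<^bsub>D\<^esub> \<beta> a' b"
    and add_right: "\<And>a b b'. a \<in> carrier A \<Longrightarrow> b \<in> carrier B \<Longrightarrow> b' \<in> carrier B \<Longrightarrow>
      \<beta> a (b \<oplus>\<^bsub>B\<^esub> b') = \<beta> a b \<oplus>\<^bsub>D\<^esub> \<beta> a b'"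
    and balanced: "\<And>a b s. a \<in> carrier A \<Longrightarrow> b \<in> carrier B \<Longrightarrow> s \<in> R \<Longrightarrow> \<beta> (\<rho> a s) b = \<beta> a (\<sigma> s b)"
  shows "\<exists>\<phi>. \<phi> \<in> hom (add_monoid T) (add_monoid D) \<and>
    (\<forall>a\<in>carrier A. \<forall>b\<in>carrier B. \<phi> (tens a b) = \<beta> a b)"
proof -
  interpret D: abelian_group D by fact
  have "case_prod \<beta> ` (carrier A \<times> carrier B) \<subseteq> carrier (add_monoid D)" using \<beta> by auto
  from comm_group.free_Abelian_group_universal[OF D.a_comm_group this]
  obtain h where h: "h \<in> hom formal_sums (add_monoid D)"
      "\<And>p. p \<in> carrier A \<times> carrier B \<Longrightarrow> h (frag_of p) = case_prod \<beta> p"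
    by auto
  interpret h: group_hom formal_sums "add_monoid D" h
    using h(1) by (simp add: group_hom_def group_hom_axioms_def D.a_group)
  have fo: "frag_of p \<in> carrier formal_sums" if "p \<in> carrier A \<times> carrier B" for p
    using that by simp
  have hdiff: "h (c - c') = h c \<ominus>\<^bsub>D\<^esub> h c'" if "c \<in> carrier formal_sums" "c' \<in> carrier formal_sums" for c c'
  proof -
    have d: "c - c' \<in> carrier formal_sums" using that keys_diff[of c c'] by auto
    have "h c = h (c - c') \<oplus>\<^bsub>D\<^esub> h c'" using h.hom_mult[OF d that(2)] by simp
    then show ?thesis using h.hom_closed[OF d] h.hom_closed[OF that(2)]
      by (simp add: a_minus_def D.a_assoc D.r_neg)
  qed
  have dcl: "c - c' \<in> carrier formal_sums" if "c \<in> carrier formal_sums" "c' \<in> carrier formal_sums" for c c'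
    using that keys_diff[of c c'] by auto
  have dd: "(u \<oplus>\<^bsub>D\<^esub> v) \<ominus>\<^bsub>D\<^esub> u \<ominus>\<^bsub>D\<^esub> v = \<zero>\<^bsub>D\<^esub>" if "u \<in> carrier D" "v \<in> carrier D" for u v
  proof -
    have "(u \<oplus>\<^bsub>D\<^esub> v) \<ominus>\<^bsub>D\<^esub> u = (v \<oplus>\<^bsub>D\<^esub> u) \<ominus>\<^bsub>D\<^esub> u" using that by (simp add: D.a_comm)
    also have "\<dots> = v" using that by (simp add: a_minus_def D.a_assoc D.r_neg)
    finally show ?thesis using that by (simp add: a_minus_def D.r_neg)
  qed
  have "tensor_relations R A \<rho> B \<sigma> \<subseteq> kernel formal_sums (add_monoid D) h"
  proof
    fix c assume c: "c \<in> tensor_relations R A \<rho> B \<sigma>"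
    then have "h c = \<zero>\<^bsub>D\<^esub>"
      unfolding tensor_relations_def
      by (auto simp: hdiff fo dcl h(2) add_left add_right balanced dd[unfolded a_minus_def] \<beta> \<rho>_closed \<sigma>_closed a_minus_def D.r_neg
          simp del: carrier_free_Abelian_group_iff)
    then show "c \<in> kernel formal_sums (add_monoid D) h"
      using subsetD[OF tensor_relations_subset c] by (simp add: kernel_def)
  qed
  then have "relations \<subseteq> kernel formal_sums (add_monoid D) h"
    using group.generate_subgroup_incl[OF group_free_Abelian_group _ h.subgroup_kernel] by blast
  from h.FactGroup_universal_kernel[OF relations_normal this]
  obtain \<phi> where "\<phi> \<in> hom (formal_sums Mod relations) (add_monoid D)"
     "\<And>x. x \<in> carrier formal_sums \<Longrightarrow> \<phi> (coset x) = h x"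
    unfolding coset_def by metis
  then show ?thesis using h(2) fo unfolding tens_def by (intro exI[of _ \<phi>]) (auto simp: hom_def tensor_simps)
qed

text \<open>
  The definition of scalar multiplication unites the cosets obtained from all representatives. They coincide as soon
  as the endomorphism induced by \<open>g s\<close> preserves the relations, which is checked on generators.
\<close>

lemma smult_coset:
  assumes g: "\<And>a b. a \<in> carrier A \<Longrightarrow> b \<in> carrier B \<Longrightarrow> g s (a, b) \<in> carrier formal_sums"
    and add_left: "\<And>a a' b. a \<in> carrier A \<Longrightarrow> a' \<in> carrier A \<Longrightarrow> b \<in> carrier B \<Longrightarrow>
      g s (a \<oplus>\<^bsub>A\<^esub> a', b) - g s (a, b) - g s (a', b) \<in> relations"
    and add_right: "\<And>a b b'. a \<in> carrier A \<Longrightarrow> b \<in> carrier B \<Longrightarrow> b' \<in> carrier B \<Longrightarrow>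
      g s (a, b \<oplus>\<^bsub>B\<^esub> b') - g s (a, b) - g s (a, b') \<in> relations"
    and balanced: "\<And>a b t. a \<in> carrier A \<Longrightarrow> b \<in> carrier B \<Longrightarrow> t \<in> R \<Longrightarrow>
      g s (\<rho> a t, b) - g s (a, \<sigma> t b) \<in> relations"
  shows "c \<in> carrier formal_sums \<Longrightarrow> s \<odot>\<^bsub>T\<^esub> coset c = coset (frag_extend (g s) c)"
    and "c \<in> carrier formal_sums \<Longrightarrow> frag_extend (g s) c \<in> carrier formal_sums"
proof -
  have cl: "frag_extend (g s) c \<in> carrier formal_sums" if "c \<in> carrier formal_sums" for c
  proof -
    have "keys (frag_extend (g s) c) \<subseteq> (\<Union>p\<in>keys c. keys (g s p))"
      by (rule keys_frag_extend)
    also have "\<dots> \<subseteq> carrier A \<times> carrier B"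
    proof (rule UN_least)
      fix p assume "p \<in> keys c"
      then have "p \<in> carrier A \<times> carrier B" using that by auto
      then show "keys (g s p) \<subseteq> carrier A \<times> carrier B"
        using g[of "fst p" "snd p"] by (cases p) auto
    qed
    finally show ?thesis by simp
  qed
  then show "c \<in> carrier formal_sums \<Longrightarrow> frag_extend (g s) c \<in> carrier formal_sums" .
  have "tensor_relations R A \<rho> B \<sigma> \<subseteq> {c \<in> carrier formal_sums. frag_extend (g s) c \<in> relations}"
  proof
    fix c assume c: "c \<in> tensor_relations R A \<rho> B \<sigma>"
    have "frag_extend (g s) c \<in> relations"
      using c[unfolded tensor_relations_def]
      by (auto simp: frag_extend_diff intro: add_left add_right balanced)
    then show "c \<in> {c \<in> carrier formal_sums. frag_extend (g s) c \<in> relations}"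
      using tensor_relations_subset c by blast
  qed
  moreover have "subgroup {c \<in> carrier formal_sums. frag_extend (g s) c \<in> relations} formal_sums"
  proof (rule group.subgroupI)
    show "{c \<in> carrier formal_sums. frag_extend (g s) c \<in> relations} \<noteq> {}"
      using subgroup.one_closed[OF relations_subgroup] by (auto intro!: exI[of _ 0])
  next
    fix c assume "c \<in> {c \<in> carrier formal_sums. frag_extend (g s) c \<in> relations}"
    then show "inv\<^bsub>formal_sums\<^esub> c \<in> {c \<in> carrier formal_sums. frag_extend (g s) c \<in> relations}"
      using subgroup.m_inv_closed[OF relations_subgroup, of "frag_extend (g s) c"] cl[of c]
      by (auto simp: frag_extend_minus)
  next
    fix c c' assume "c \<in> {c \<in> carrier formal_sums. frag_extend (g s) c \<in> relations}"
      "c' \<in> {c \<in> carrier formal_sums. frag_extend (g s) c \<in> relations}"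
    then show "c \<otimes>\<^bsub>formal_sums\<^esub> c' \<in> {c \<in> carrier formal_sums. frag_extend (g s) c \<in> relations}"
      using subgroup.m_closed[OF relations_subgroup, of "frag_extend (g s) c" "frag_extend (g s) c'"]
        Poly_Mapping.keys_add[of c c']
      by (auto simp: frag_extend_add)
  qed auto
  ultimately have rel: "frag_extend (g s) k \<in> relations" if "k \<in> relations" for k
    using group.generate_subgroup_incl[of formal_sums] that by auto
  assume c: "c \<in> carrier formal_sums"
  have "coset (frag_extend (g s) d) = coset (frag_extend (g s) c)" if d: "d \<in> coset c" for d
  proof -
    obtain k where k: "k \<in> relations" "d = k + c" using d by (auto simp: coset_def r_coset_def)
    then have kc: "k \<in> carrier formal_sums" using subgroup.subset[OF relations_subgroup] by blast
    have "coset (frag_extend (g s) d) = coset (frag_extend (g s) k) \<oplus>\<^bsub>T\<^esub> coset (frag_extend (g s) c)"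
      unfolding k(2) frag_extend_add using cl kc c by (intro coset_add) auto
    also have "\<dots> = coset (frag_extend (g s) c)"
      using coset_eq_zero[OF rel[OF k(1)]] coset_closed[OF cl[OF c]] by simp
    finally show ?thesis .
  qed
  moreover have "c \<in> coset c"
    using subgroup.one_closed[OF relations_subgroup] by (auto simp: coset_def r_coset_def)
  moreover have "s \<odot>\<^bsub>T\<^esub> coset c = (\<Union>d\<in>coset c. coset (frag_extend (g s) d))"
    by (simp add: tensor_module_def Let_def coset_def)
  ultimately show "s \<odot>\<^bsub>T\<^esub> coset c = coset (frag_extend (g s) c)" by blast
qed

end

end

context tensor_data
begin

lemma smult_additive:
  assumes smult: "\<And>c. c \<in> carrier formal_sums \<Longrightarrow> s \<odot>\<^bsub>T g\<^esub> coset c = coset (frag_extend (g s) c)"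
    and closed: "\<And>c. c \<in> carrier formal_sums \<Longrightarrow> frag_extend (g s) c \<in> carrier formal_sums"
  shows "z \<in> carrier (T g) \<Longrightarrow> s \<odot>\<^bsub>T g\<^esub> z \<in> carrier (T g)"
    and "z \<in> carrier (T g) \<Longrightarrow> z' \<in> carrier (T g) \<Longrightarrow> s \<odot>\<^bsub>T g\<^esub> (z \<oplus>\<^bsub>T g\<^esub> z') = s \<odot>\<^bsub>T g\<^esub> z \<oplus>\<^bsub>T g\<^esub> s \<odot>\<^bsub>T g\<^esub> z'"
    and "a \<in> carrier A \<Longrightarrow> b \<in> carrier B \<Longrightarrow> s \<odot>\<^bsub>T g\<^esub> tens a b = coset (g s (a, b))"
proof -
  show "s \<odot>\<^bsub>T g\<^esub> z \<in> carrier (T g)" if z: "z \<in> carrier (T g)"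
  proof -
    obtain c where c: "c \<in> carrier formal_sums" "z = coset c" using z unfolding tensor_carrier by blast
    show ?thesis unfolding c(2) smult[OF c(1)] by (rule coset_closed[OF closed[OF c(1)]])
  qed
  show "s \<odot>\<^bsub>T g\<^esub> (z \<oplus>\<^bsub>T g\<^esub> z') = s \<odot>\<^bsub>T g\<^esub> z \<oplus>\<^bsub>T g\<^esub> s \<odot>\<^bsub>T g\<^esub> z'" if z: "z \<in> carrier (T g)" "z' \<in> carrier (T g)"
  proof -
    obtain c where c: "c \<in> carrier formal_sums" "z = coset c" using z unfolding tensor_carrier by blast
    obtain c' where c': "c' \<in> carrier formal_sums" "z' = coset c'" using z unfolding tensor_carrier by blast
    have cc: "c + c' \<in> carrier formal_sums"
      using group.subgroup_self[OF group_free_Abelian_group] c(1) c'(1) by (metis mult_free_Abelian_group subgroup.m_closed)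
    show ?thesis unfolding c(2) c'(2) coset_add[OF c(1) c'(1), symmetric] smult[OF c(1)] smult[OF c'(1)] smult[OF cc]
        frag_extend_add by (rule coset_add[OF closed[OF c(1)] closed[OF c'(1)]])
  qed
  show "s \<odot>\<^bsub>T g\<^esub> tens a b = coset (g s (a, b))" if "a \<in> carrier A" "b \<in> carrier B"
    unfolding tens_def using that by (subst smult) auto
qed

end

section \<open>The Weyl group and lattices\<close>

locale weyl_data =
  fixes \<Delta> :: "'h::euclidean_space set"
  assumes root_system: "reduced_root_system \<Delta>"
begin

abbreviation W where "W \<equiv> weyl_group \<Delta>"

lemma reflection_linear: "linear (reflection \<alpha>)" for \<alpha> :: 'h
  by (rule linearI) (simp_all add: reflection_def inner_add_left algebra_simps add_divide_distrib)

lemma reflection_involution: "\<alpha> \<noteq> 0 \<Longrightarrow> reflection \<alpha> \<circ> reflection \<alpha> = id" for \<alpha> :: 'h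
  by (rule ext) (simp add: reflection_def inner_diff_left algebra_simps)

lemma reflection_Bij: "\<alpha> \<in> \<Delta> \<Longrightarrow> reflection \<alpha> \<in> Bij UNIV"
  using root_system reflection_involution[of \<alpha>]
  by (auto simp: Bij_def reduced_root_system_def intro: o_bij)

lemma reflections_subset: "reflection ` \<Delta> \<subseteq> carrier (BijGroup UNIV)"
  using reflection_Bij by (auto simp: BijGroup_def)

lemma BijGroup_mult: "f \<in> Bij UNIV \<Longrightarrow> g \<in> Bij UNIV \<Longrightarrow> f \<otimes>\<^bsub>BijGroup UNIV\<^esub> g = f \<circ> g" for f g :: "'h \<Rightarrow> 'h"
  by (auto simp: BijGroup_def compose_def)

lemma BijGroup_one: "\<one>\<^bsub>BijGroup UNIV\<^esub> = (id :: 'h \<Rightarrow> 'h)"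
  by (auto simp: BijGroup_def)

lemma W_subgroup: "subgroup W (BijGroup UNIV)"
  unfolding weyl_group_def by (rule group.generate_is_subgroup[OF group_BijGroup reflections_subset])

lemma W_Bij: "w \<in> W \<Longrightarrow> w \<in> Bij UNIV"
  using subgroup.subset[OF W_subgroup] by (auto simp: BijGroup_def)

lemma W_id [simp]: "id \<in> W"
  using subgroup.one_closed[OF W_subgroup] by (simp add: BijGroup_one)

lemma W_comp [simp]: "w \<in> W \<Longrightarrow> u \<in> W \<Longrightarrow> w \<circ> u \<in> W"
  using subgroup.m_closed[OF W_subgroup, of w u] by (simp add: BijGroup_mult W_Bij)

lemma W_inv [simp]: "w \<in> W \<Longrightarrow> winv w \<in> W"
  using subgroup.m_inv_closed[OF W_subgroup, of w] by (simp add: inv_BijGroup W_Bij restrict_UNIV)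

lemma W_bij: "w \<in> W \<Longrightarrow> bij w"
  using W_Bij by (auto simp: Bij_def)

lemma W_winv_apply: "w \<in> W \<Longrightarrow> winv w (w v) = v" "w \<in> W \<Longrightarrow> w (winv w v) = v"
  using W_bij[of w] by (auto simp: bij_def surj_f_inv_f)

lemma W_winv_comp [simp]: "w \<in> W \<Longrightarrow> winv w \<circ> w = id" "w \<in> W \<Longrightarrow> w \<circ> winv w = id"
  by (auto simp: fun_eq_iff W_winv_apply)

lemma W_winv_winv [simp]: "w \<in> W \<Longrightarrow> winv (winv w) = w"
  using W_bij by (simp add: inv_inv_eq)

lemma reflection_stable: "\<alpha> \<in> \<Delta> \<Longrightarrow> reflection \<alpha> ` \<Delta> = \<Delta>"
  using root_system by (simp add: reduced_root_system_def)

text \<open>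
  The inverse of a generator causes no trouble in the induction because reflections are involutions.
\<close>

lemma W_linear_stable: "w \<in> W \<Longrightarrow> linear w \<and> w ` \<Delta> = \<Delta>"
  unfolding weyl_group_def
proof (induction w rule: generate.induct)
  case one
  then show ?case unfolding BijGroup_one by (intro conjI linear_id) auto
next
  case (incl h)
  then show ?case using reflection_linear reflection_stable by blast
next
  case (inv h)
  then obtain \<alpha> where \<alpha>: "h = reflection \<alpha>" "\<alpha> \<in> \<Delta>" by auto
  then have "\<alpha> \<noteq> 0" using root_system by (auto simp: reduced_root_system_def)
  then have "inv\<^bsub>BijGroup UNIV\<^esub> h = h"
    using \<alpha> reflection_Bij[of \<alpha>] reflection_involution[of \<alpha>]
    by (intro group.inv_equality[OF group_BijGroup])
      (auto simp: BijGroup_mult BijGroup_one, auto simp: BijGroup_def)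
  then show ?case using \<alpha> reflection_linear reflection_stable by simp
next
  case (eng h1 h2)
  then have "h1 \<in> Bij UNIV" "h2 \<in> Bij UNIV" using W_Bij by (auto simp: weyl_group_def)
  then show ?case using eng unfolding BijGroup_mult[OF \<open>h1 \<in> Bij UNIV\<close> \<open>h2 \<in> Bij UNIV\<close>]
    by (intro conjI linear_compose) (auto simp only: image_comp[symmetric])
qed

lemma W_linear: "w \<in> W \<Longrightarrow> linear w"
  using W_linear_stable by blast

lemma W_zero: "w \<in> W \<Longrightarrow> w 0 = 0"
  and W_minus: "w \<in> W \<Longrightarrow> w (- v) = - w v"
  using W_linear by (auto simp: linear_0 linear_neg)

text \<open>
  Linear maps are determined by their values on the spanning set \<open>\<Delta>\<close>, which \<open>W\<close> permutes.
\<close>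

lemma W_finite [simp]: "finite W"
proof -
  have fin: "finite \<Delta>" and sp: "span \<Delta> = UNIV" using root_system by (auto simp: reduced_root_system_def)
  have "inj_on (\<lambda>w. restrict w \<Delta>) W"
  proof (rule inj_onI)
    fix w u assume "w \<in> W" "u \<in> W" and eq: "restrict w \<Delta> = restrict u \<Delta>"
    then have "\<And>x. x \<in> \<Delta> \<Longrightarrow> w x = u x" by (metis restrict_apply')
    then show "w = u"
      using linear_eq_on_span[OF W_linear[OF \<open>w \<in> W\<close>] W_linear[OF \<open>u \<in> W\<close>], of \<Delta>] sp by blast
  qed
  moreover have "(\<lambda>w. restrict w \<Delta>) ` W \<subseteq> \<Delta> \<rightarrow>\<^sub>E \<Delta>"
    using W_linear_stable by (fastforce simp: PiE_def)
  moreover have "finite (\<Delta> \<rightarrow>\<^sub>E \<Delta>)" using fin by (simp add: finite_PiE)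
  ultimately show ?thesis by (meson finite_imageD finite_subset)
qed

lemma dual_act_apply [simp]: "w \<in> W \<Longrightarrow> blinfun_apply (dual_act w x) v = blinfun_apply x (winv w v)"
  unfolding dual_act_def
proof (subst bounded_linear_Blinfun_apply)
  assume "w \<in> W"
  then have "linear (winv w)" using W_linear W_inv by blast
  then have "bounded_linear (winv w)" by (rule linear_conv_bounded_linear[THEN iffD1])
  then show "bounded_linear (\<lambda>v. blinfun_apply x (winv w v))"
    by (rule bounded_linear_compose[OF blinfun.bounded_linear_right])
qed auto

lemma dual_act_add [simp]: "w \<in> W \<Longrightarrow> dual_act w (x + x') = dual_act w x + dual_act w x'"
  by (rule blinfun_eqI) (simp add: blinfun.add_left)

lemma dual_act_zero [simp]: "w \<in> W \<Longrightarrow> dual_act w 0 = 0"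
  by (rule blinfun_eqI) (simp add: blinfun.zero_left)

lemma winv_comp: "w \<in> W \<Longrightarrow> u \<in> W \<Longrightarrow> winv (w \<circ> u) = winv u \<circ> winv w"
  by (simp add: o_inv_distrib W_bij)

lemma dual_act_comp: "w \<in> W \<Longrightarrow> u \<in> W \<Longrightarrow> dual_act (w \<circ> u) x = dual_act w (dual_act u x)"
  by (rule blinfun_eqI) (simp add: winv_comp)

lemma dual_act_id [simp]: "dual_act id x = x" for x :: "'h dual"
  by (rule blinfun_eqI) (simp add: dual_act_apply[OF W_id])

lemma dual_act_winv [simp]: "w \<in> W \<Longrightarrow> dual_act w (dual_act (winv w) x) = x"
   "w \<in> W \<Longrightarrow> dual_act (winv w) (dual_act w x) = x"
  by (simp_all add: dual_act_comp[symmetric])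

end

lemma lattice_group:
  assumes "is_lattice L"
  shows "0 \<in> L" and "x \<in> L \<Longrightarrow> y \<in> L \<Longrightarrow> x + y \<in> L" and "x \<in> L \<Longrightarrow> - x \<in> L"
proof -
  obtain B where B: "finite B" "L = {\<Sum>b\<in>B. of_int (c b) *\<^sub>R b | c :: _ \<Rightarrow> int. True}"
    using assms by (auto simp: is_lattice_def)
  show "0 \<in> L" unfolding B(2) by (rule CollectI, rule exI[of _ "\<lambda>_. 0"]) auto
  show "x + y \<in> L" if xy: "x \<in> L" "y \<in> L"
  proof -
    obtain c d :: "_ \<Rightarrow> int" where "x = (\<Sum>b\<in>B. of_int (c b) *\<^sub>R b)" "y = (\<Sum>b\<in>B. of_int (d b) *\<^sub>R b)"
      using xy unfolding B(2) by blast
    then have "x + y = (\<Sum>b\<in>B. of_int (c b + d b) *\<^sub>R b)" by (simp add: sum.distrib scaleR_add_left)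
    then show ?thesis unfolding B(2) by (intro CollectI exI[of _ "\<lambda>b. c b + d b"]) auto
  qed
  show "- x \<in> L" if x: "x \<in> L"
  proof -
    obtain c :: "_ \<Rightarrow> int" where "x = (\<Sum>b\<in>B. of_int (c b) *\<^sub>R b)" using x unfolding B(2) by blast
    then have "- x = (\<Sum>b\<in>B. of_int (- c b) *\<^sub>R b)" by (simp add: sum_negf)
    then show ?thesis unfolding B(2) by (intro CollectI exI[of _ "\<lambda>b. - c b"]) auto
  qed
qed

lemma lattice_basis:
  assumes "is_lattice L"
  obtains B where "finite B" "B \<subseteq> L" "span B = UNIV"
    "L = {\<Sum>b\<in>B. of_int (c b) *\<^sub>R b | c :: _ \<Rightarrow> int. True}"
proof -
  obtain B where B: "finite B" "span B = UNIV" "L = {\<Sum>b\<in>B. of_int (c b) *\<^sub>R b | c :: _ \<Rightarrow> int. True}"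
    using assms by (auto simp: is_lattice_def)
  have "b \<in> L" if "b \<in> B" for b
  proof -
    have "(\<Sum>b'\<in>B. of_int (if b' = b then 1 else 0 :: int) *\<^sub>R b') = (\<Sum>b'\<in>B. if b' = b then b' else 0)"
      by (rule sum.cong) auto
    then have "b = (\<Sum>b'\<in>B. of_int (if b' = b then 1 else 0 :: int) *\<^sub>R b')"
      using B(1) that by (simp add: sum.delta)
    then show ?thesis unfolding B(3) by (intro CollectI exI[of _ "\<lambda>b'. if b' = b then 1 else 0"]) simp
  qed
  then show thesis using that B by blast
qed

text \<open>
  Stated for a fixed basis \<open>B\<close> so that one finite basis can be used for all properties under consideration.
\<close>

lemma lattice_induct [consumes 2, case_names basis zero add minus]:
  assumes "is_lattice L" and "x \<in> L" and "finite B" and "B \<subseteq> L"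
    and L: "L = {\<Sum>b\<in>B. of_int (c b) *\<^sub>R b | c :: _ \<Rightarrow> int. True}"
    and basis: "\<And>b. b \<in> B \<Longrightarrow> P b" and zero: "P 0"
    and add: "\<And>x y. x \<in> L \<Longrightarrow> y \<in> L \<Longrightarrow> P x \<Longrightarrow> P y \<Longrightarrow> P (x + y)"
    and minus: "\<And>x. x \<in> L \<Longrightarrow> P x \<Longrightarrow> P (- x)"
  shows "P x"
proof -
  note group = lattice_group[OF assms(1)]
  have nat: "of_nat k *\<^sub>R b \<in> L \<and> P (of_nat k *\<^sub>R b)" if "b \<in> B" for b k
    by (induction k) (use basis zero add that assms(4) group in \<open>auto simp: scaleR_add_left\<close>)
  have int: "of_int k *\<^sub>R b \<in> L \<and> P (of_int k *\<^sub>R b)" if "b \<in> B" for b k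
  proof (cases k rule: int_cases2)
    case (nonneg m)
    then show ?thesis using nat[OF that, of m] by simp
  next
    case (nonpos m)
    then show ?thesis using nat[OF that, of m] minus[of "of_nat m *\<^sub>R b"] group(3)[of "of_nat m *\<^sub>R b"] by simp
  qed
  have "(\<Sum>b\<in>K. of_int (c b) *\<^sub>R b) \<in> L \<and> P (\<Sum>b\<in>K. of_int (c b) *\<^sub>R b)" if "finite K" "K \<subseteq> B" for K and c :: "_ \<Rightarrow> int"
    using that by (induction K rule: finite_induct) (use zero add int group in auto)
  then show ?thesis using assms(2,3) unfolding L by blast
qed

section \<open>The torus and its translations\<close>

lemma qpow_root:
  assumes "n > 0" "t = of_int a / of_nat n" shows "qpow n r t = r powi a"
  using assms by (simp add: qpow_def)

text \<open>
  The number \<open>r\<close> is the chosen root \<open>q\<^sup>1\<^sup>/\<^sup>n\<close>; the assumptions on \<open>q\<close> are expressed through it.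
\<close>

locale torus_data = weyl_data \<Delta> for \<Delta> :: "'h::euclidean_space set" +
  fixes X :: "'h dual set" and Y :: "'h set" and n :: nat and r :: complex
  assumes lattice_X: "is_lattice X" and lattice_Y: "is_lattice Y"
    and W_X: "w \<in> weyl_group \<Delta> \<Longrightarrow> dual_act w ` X = X"
    and W_Y: "w \<in> weyl_group \<Delta> \<Longrightarrow> w ` Y = Y"
    and n_pos: "n > 0"
    and pairing: "\<forall>x\<in>X. \<forall>y\<in>Y. \<exists>a::int. blinfun_apply x y = of_int a / of_nat n"
    and r_nonzero: "r \<noteq> 0"
    and r_not_root: "k > 0 \<Longrightarrow> r ^ k \<noteq> 1"
begin

lemmas X_group [simp] = lattice_group[OF lattice_X]
lemmas Y_group [simp] = lattice_group[OF lattice_Y]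

lemma W_X_closed [simp]: "w \<in> W \<Longrightarrow> x \<in> X \<Longrightarrow> dual_act w x \<in> X"
  and W_Y_closed [simp]: "w \<in> W \<Longrightarrow> y \<in> Y \<Longrightarrow> w y \<in> Y"
  using W_X W_Y by blast+

abbreviation qp :: "'h dual \<Rightarrow> 'h \<Rightarrow> complex" where
  "qp x y \<equiv> qpow n r (blinfun_apply x y)"

lemma qp_pow: assumes "x \<in> X" "y \<in> Y" 
  obtains a where "blinfun_apply x y = of_int a / of_nat n" "qp x y = r powi a"
  using pairing qpow_root[OF n_pos] assms by metis

lemma qp_nonzero [simp]: "x \<in> X \<Longrightarrow> y \<in> Y \<Longrightarrow> qp x y \<noteq> 0"
  using qp_pow r_nonzero by (metis power_int_not_zero)

lemma qp_add_left: "x \<in> X \<Longrightarrow> x' \<in> X \<Longrightarrow> y \<in> Y \<Longrightarrow> qp (x + x') y = qp x y * qp x' y"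
proof -
  assume *: "x \<in> X" "x' \<in> X" "y \<in> Y"
  obtain a where a: "blinfun_apply x y = of_int a / of_nat n" "qp x y = r powi a" using qp_pow * by blast
  obtain b where b: "blinfun_apply x' y = of_int b / of_nat n" "qp x' y = r powi b" using qp_pow * by blast
  have "blinfun_apply (x + x') y = of_int (a + b) / of_nat n"
    using a b by (simp add: blinfun.add_left add_divide_distrib)
  from qpow_root[OF n_pos this] show ?thesis using a b r_nonzero by (simp add: power_int_add)
qed

lemma qp_add_right: "x \<in> X \<Longrightarrow> y \<in> Y \<Longrightarrow> y' \<in> Y \<Longrightarrow> qp x (y + y') = qp x y * qp x y'"
proof -
  assume *: "x \<in> X" "y \<in> Y" "y' \<in> Y"
  obtain a where a: "blinfun_apply x y = of_int a / of_nat n" "qp x y = r powi a" using qp_pow * by blast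
  obtain b where b: "blinfun_apply x y' = of_int b / of_nat n" "qp x y' = r powi b" using qp_pow * by blast
  have "blinfun_apply x (y + y') = of_int (a + b) / of_nat n"
    using a b by (simp add: blinfun.add_right add_divide_distrib)
  from qpow_root[OF n_pos this] show ?thesis using a b r_nonzero by (simp add: power_int_add)
qed

lemma qpow_minus: "x \<in> X \<Longrightarrow> y \<in> Y \<Longrightarrow> qpow n r (- blinfun_apply x y) = inverse (qp x y)"
proof -
  assume *: "x \<in> X" "y \<in> Y"
  obtain a where a: "blinfun_apply x y = of_int a / of_nat n" "qp x y = r powi a" using qp_pow * by blast
  have "- blinfun_apply x y = of_int (- a) / of_nat n" using a by simp
  from qpow_root[OF n_pos this] show ?thesis using a by (simp add: power_int_minus)
qed

lemma qpow_0 [simp]: "qpow n r 0 = 1" by (simp add: qpow_def)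

lemma qp_zero [simp]: "qp 0 y = 1"
  by (simp add: blinfun.zero_left)

lemma qp_minus_right: "x \<in> X \<Longrightarrow> y \<in> Y \<Longrightarrow> qp x (- y) = inverse (qp x y)"
  using qpow_minus by (simp add: blinfun.minus_right)

lemma r_powi_inj: assumes "r powi a = 1" shows "a = 0"
proof (cases a rule: int_cases2)
  case (nonneg k)
  then show ?thesis using assms r_not_root[of k] by (cases "k = 0") auto
next
  case (nonpos k)
  then show ?thesis using assms r_not_root[of k] by (cases "k = 0") (auto simp: power_int_minus)
qed

text \<open>
  A power of \<open>r\<close> equals one only for exponent zero, so \<open>y\<close> is orthogonal to a basis of the dual space.
\<close>

lemma qp_nondegenerate:
  assumes "y \<in> Y" "\<And>x. x \<in> X \<Longrightarrow> qp x y = 1"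
  shows "y = 0"
proof -
  have pair0: "blinfun_apply x y = 0" if x: "x \<in> X" for x
  proof -
    obtain a where "blinfun_apply x y = of_int a / of_nat n" "qp x y = r powi a"
      using qp_pow[OF x assms(1)] by blast
    then show ?thesis using assms(2)[OF x] r_powi_inj[of a] by auto
  qed
  obtain B where "finite B" "B \<subseteq> X" and B: "span B = UNIV" by (rule lattice_basis[OF lattice_X])
  define z where "z = blinfun_inner_left y"
  have "z \<in> span B" using B by auto
  then have "blinfun_apply z y = 0"
    by (induction rule: span_induct_alt)
      (use pair0 \<open>B \<subseteq> X\<close> in \<open>auto simp: blinfun.add_left blinfun.scaleR_left blinfun.zero_left\<close>)
  then show ?thesis by (simp add: z_def)
qed

abbreviation TT where "TT \<equiv> carrier (torus X)"

text \<open>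
  The translate \<open>\<mu> q\<^sup>y\<close>.
\<close>

definition shift :: "'h torus_elem \<Rightarrow> 'h \<Rightarrow> 'h torus_elem" where
  "shift \<mu> y = (\<lambda>x\<in>X. \<mu> x * qp x y)"

lemma torusI: "\<mu> \<in> extensional X \<Longrightarrow> (\<And>x. x \<in> X \<Longrightarrow> \<mu> x \<noteq> 0) \<Longrightarrow> 
    (\<And>x x'. x \<in> X \<Longrightarrow> x' \<in> X \<Longrightarrow> \<mu> (x + x') = \<mu> x * \<mu> x') \<Longrightarrow> \<mu> \<in> TT"
  by (simp add: torus_def)

lemma torusD: assumes "\<mu> \<in> TT" shows "\<mu> \<in> extensional X" "x \<in> X \<Longrightarrow> \<mu> x \<noteq> 0"
  "x \<in> X \<Longrightarrow> x' \<in> X \<Longrightarrow> \<mu> (x + x') = \<mu> x * \<mu> x'"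
  using assms by (auto simp: torus_def)

lemma torus_zero [simp]: "\<mu> \<in> TT \<Longrightarrow> \<mu> 0 = 1"
  using torusD(2,3)[of \<mu> 0] torusD(3)[of \<mu> 0 0] by auto

lemma torus_eqI: "\<mu> \<in> TT \<Longrightarrow> \<nu> \<in> TT \<Longrightarrow> (\<And>x. x \<in> X \<Longrightarrow> \<mu> x = \<nu> x) \<Longrightarrow> \<mu> = \<nu>"
  by (meson extensionalityI torusD(1))

lemma shift_closed [simp]: "\<mu> \<in> TT \<Longrightarrow> y \<in> Y \<Longrightarrow> shift \<mu> y \<in> TT"
  by (rule torusI) (auto simp: shift_def torusD qp_add_left)

lemma shift_apply: "x \<in> X \<Longrightarrow> shift \<mu> y x = \<mu> x * qp x y" by (simp add: shift_def)

lemma shift_eq: "\<mu> \<in> TT \<Longrightarrow> y \<in> Y \<Longrightarrow> \<mu> \<otimes>\<^bsub>torus X\<^esub> qchar X n r y = shift \<mu> y"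
  by (auto simp: torus_def qchar_def shift_def)

lemma shift_shift: "\<mu> \<in> TT \<Longrightarrow> y \<in> Y \<Longrightarrow> y' \<in> Y \<Longrightarrow> shift (shift \<mu> y) y' = shift \<mu> (y + y')"
  by (rule torus_eqI) (auto simp: shift_apply qp_add_right)

lemma shift_0 [simp]: "\<mu> \<in> TT \<Longrightarrow> shift \<mu> 0 = \<mu>"
  by (rule torus_eqI) (auto simp: shift_apply)

text \<open>
  The class of a point is thus a torsor under \<open>Y\<close>. This is where \<open>q\<close> must not be a root of unity.
\<close>

lemma shift_inj: assumes "\<mu> \<in> TT" "y \<in> Y" "y' \<in> Y" "shift \<mu> y = shift \<mu> y'" shows "y = y'"
proof -
  have "qp x (y - y') = 1" if "x \<in> X" for x
  proof -
    have "\<mu> x * qp x y = \<mu> x * qp x y'" using assms(4) that by (metis shift_apply)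
    then have "qp x y = qp x y'" using torusD[OF assms(1)] that by auto
    then have "qp x (y + - y') = 1" using assms that by (subst qp_add_right) (auto simp: qp_minus_right)
    then show ?thesis by simp
  qed
  moreover have "y - y' \<in> Y" using Y_group(2)[OF assms(2) Y_group(3)[OF assms(3)]] by simp
  ultimately show ?thesis using qp_nondegenerate[of "y - y'"] by auto
qed

lemma torus_act_apply: "x \<in> X \<Longrightarrow> torus_act X w \<mu> x = \<mu> (dual_act (winv w) x)"
  by (simp add: torus_act_def)

lemma torus_act_closed [simp]: "\<mu> \<in> TT \<Longrightarrow> w \<in> W \<Longrightarrow> torus_act X w \<mu> \<in> TT"
  by (rule torusI) (auto simp: torus_act_apply torusD, simp add: torus_act_def)

lemma torus_act_comp: "\<mu> \<in> TT \<Longrightarrow> w \<in> W \<Longrightarrow> u \<in> W \<Longrightarrow>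
    torus_act X (w \<circ> u) \<mu> = torus_act X w (torus_act X u \<mu>)"
  by (rule torus_eqI) (auto simp: torus_act_apply winv_comp dual_act_comp)

lemma torus_act_id [simp]: "\<mu> \<in> TT \<Longrightarrow> torus_act X id \<mu> = \<mu>"
  by (rule torus_eqI) (auto simp: torus_act_apply)

lemma torus_act_shift: "\<mu> \<in> TT \<Longrightarrow> w \<in> W \<Longrightarrow> y \<in> Y \<Longrightarrow>
    torus_act X w (shift \<mu> y) = shift (torus_act X w \<mu>) (w y)"
  by (rule torus_eqI) (auto simp: torus_act_apply shift_apply)

lemma torus_act_winv [simp]: "\<mu> \<in> TT \<Longrightarrow> w \<in> W \<Longrightarrow> torus_act X (winv w) (torus_act X w \<mu>) = \<mu>"
   "\<mu> \<in> TT \<Longrightarrow> w \<in> W \<Longrightarrow> torus_act X w (torus_act X (winv w) \<mu>) = \<mu>"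
  by (simp_all add: torus_act_comp[symmetric])

lemma torus_class_eq: "l \<in> TT \<Longrightarrow> torus_class X Y n r l = shift l ` Y"
proof -
  assume l: "l \<in> TT"
  have "qchar X n r y \<otimes>\<^bsub>torus X\<^esub> l = shift l y" if "y \<in> Y" for y
    by (auto simp: torus_def qchar_def shift_def mult.commute)
  then show ?thesis by (auto simp: torus_class_def r_coset_def)
qed

end

section \<open>Monomials of the twisted group algebra\<close>

context torus_data
begin

abbreviation K where "K \<equiv> qtorus X Y n r"
abbreviation HG where "HG G \<equiv> qtorus_tga X Y n r G"
abbreviation HW where "HW \<equiv> HG W"

lemma K_carrier: "f \<in> carrier K \<longleftrightarrow> keys f \<subseteq> X \<times> Y"
  by (simp add: qtorus_def)

lemma K_zero_closed [simp]: "0 \<in> carrier K"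
  by (simp add: K_carrier)

lemma K_simps [simp]: "\<zero>\<^bsub>K\<^esub> = 0"
    "\<one>\<^bsub>K\<^esub> = single (0, 0) 1" "(\<oplus>\<^bsub>K\<^esub>) = (+)"
  by (simp_all add: qtorus_def)

lemma K_add_closed: "f \<in> carrier K \<Longrightarrow> g \<in> carrier K \<Longrightarrow> f + g \<in> carrier K"
  using Poly_Mapping.keys_add[of f g] by (auto simp: K_carrier)

lemma K_sum_closed: "(\<And>i. i \<in> I \<Longrightarrow> f i \<in> carrier K) \<Longrightarrow> sum f I \<in> carrier K"
  by (induction I rule: infinite_finite_induct) (use K_add_closed in auto)

lemma K_single_closed: "x \<in> X \<Longrightarrow> y \<in> Y \<Longrightarrow> single (x, y) c \<in> carrier K"
  by (auto simp: K_carrier)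

lemma K_finsum:
  assumes "finite I" "\<And>i. i \<in> I \<Longrightarrow> f i \<in> carrier K"
  shows "finsum K f I = sum f I"
proof -
  interpret K: abelian_monoid K
    by (rule abelian_monoidI) (use K_add_closed in \<open>auto simp: add_ac\<close>)
  show ?thesis using assms
    by (induction I rule: finite_induct) (auto simp: Pi_def)
qed

lemma K_mult_single: 
  "single (x, y) c \<otimes>\<^bsub>K\<^esub> single (x', y') c' =
   single (x + x', y + y') (c * c' * qpow n r (- blinfun_apply x' y))"
  by (cases "c = 0"; cases "c' = 0") (simp_all add: qtorus_def)

lemma K_mult_zero [simp]: "0 \<otimes>\<^bsub>K\<^esub> g = 0" "f \<otimes>\<^bsub>K\<^esub> 0 = 0"
  by (simp_all add: qtorus_def)

lemma K_mult_closed: 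
  assumes "f \<in> carrier K" "g \<in> carrier K" shows "f \<otimes>\<^bsub>K\<^esub> g \<in> carrier K"
proof -
  have "(\<Sum>p\<in>keys f. \<Sum>p'\<in>keys g.
        single (fst p + fst p', snd p + snd p')
          (lookup f (fst p, snd p) * lookup g (fst p', snd p')
            * qpow n r (- blinfun_apply (fst p') (snd p)))) \<in> carrier K"
    by (intro K_sum_closed K_single_closed X_group Y_group) (use assms in \<open>auto simp: K_carrier\<close>)
  then show ?thesis by (simp add: qtorus_def split_def)
qed

lemma qtorus_act_single: "qtorus_act w (single (x, y) c) = single (dual_act w x, w y) c"
  by (cases "c = 0") (simp_all add: qtorus_act_def)

lemma qtorus_act_0 [simp]: "qtorus_act w 0 = 0"
  by (simp add: qtorus_act_def)

lemma qtorus_act_closed: "w \<in> W \<Longrightarrow> f \<in> carrier K \<Longrightarrow> qtorus_act w f \<in> carrier K"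
  unfolding qtorus_act_def split_def by (intro K_sum_closed K_single_closed) (auto simp: K_carrier)

lemma HG_simps: "carrier (HG G) = {F. (\<forall>w\<in>G. F w \<in> carrier K) \<and> (\<forall>w. w \<notin> G \<longrightarrow> F w = 0)}"
   "\<zero>\<^bsub>HG G\<^esub> = (\<lambda>_. 0)" "(\<oplus>\<^bsub>HG G\<^esub>) = (\<lambda>F F' u. F u + F' u)" "\<one>\<^bsub>HG G\<^esub> = tga_elem K \<one>\<^bsub>K\<^esub> id"
  by (simp_all add: qtorus_tga_def twisted_group_algebra_def tga_elem_def fun_eq_iff)

lemma HG_mult_apply:
  assumes "G \<subseteq> W" "\<And>w. F w \<in> carrier K" "\<And>w. F' w \<in> carrier K"
  shows "(F \<otimes>\<^bsub>HG G\<^esub> F') u = (\<Sum>w\<in>G. F w \<otimes>\<^bsub>K\<^esub> qtorus_act w (F' (winv w \<circ> u)))"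
proof -
  have "(\<Oplus>\<^bsub>K\<^esub>w\<in>G. F w \<otimes>\<^bsub>K\<^esub> qtorus_act w (F' (winv w \<circ> u))) = (\<Sum>w\<in>G. F w \<otimes>\<^bsub>K\<^esub> qtorus_act w (F' (winv w \<circ> u)))"
    by (rule K_finsum) (use assms finite_subset[OF assms(1)] in \<open>auto intro!: K_mult_closed qtorus_act_closed\<close>)
  then show ?thesis by (simp add: qtorus_tga_def twisted_group_algebra_def)
qed

lemma tga_elem_apply: "tga_elem K k w u = (if u = w then k else 0)"
  by (simp add: tga_elem_def)

lemma tga_elem_apply_closed: "k \<in> carrier K \<Longrightarrow> tga_elem K k w u \<in> carrier K"
  by (auto simp: tga_elem_apply)

lemma tga_elem_closed: "k \<in> carrier K \<Longrightarrow> w \<in> G \<Longrightarrow> tga_elem K k w \<in> carrier (HG G)"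
  unfolding HG_simps using tga_elem_apply_closed by (auto simp: tga_elem_apply)

lemma HG_apply_closed: "F \<in> carrier (HG G) \<Longrightarrow> F w \<in> carrier K"
  by (cases "w \<in> G") (auto simp: HG_simps)

lemma HG_mono: "G \<subseteq> G' \<Longrightarrow> F \<in> carrier (HG G) \<Longrightarrow> F \<in> carrier (HG G')"
  by (simp add: HG_simps(1)) (metis K_zero_closed subsetD)

lemma tga_mult:
  assumes "w \<in> W" "w' \<in> W" "k \<in> carrier K" "k' \<in> carrier K"
  shows "tga_elem K k w \<otimes>\<^bsub>HW\<^esub> tga_elem K k' w' = tga_elem K (k \<otimes>\<^bsub>K\<^esub> qtorus_act w k') (w \<circ> w')"
proof
  fix u
  have iff: "winv w \<circ> u = w' \<longleftrightarrow> u = w \<circ> w'"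
    using assms(1) by (metis W_winv_comp comp_assoc comp_id id_comp)
  have "(tga_elem K k w \<otimes>\<^bsub>HW\<^esub> tga_elem K k' w') u =
    (\<Sum>v\<in>W. tga_elem K k w v \<otimes>\<^bsub>K\<^esub> qtorus_act v (tga_elem K k' w' (winv v \<circ> u)))"
    by (rule HG_mult_apply) (use assms in \<open>auto simp: tga_elem_apply\<close>)
  also have "\<dots> = (\<Sum>v\<in>W. if v = w then k \<otimes>\<^bsub>K\<^esub> qtorus_act w (tga_elem K k' w' (winv w \<circ> u)) else 0)"
    by (rule sum.cong) (auto simp: tga_elem_apply)
  also have "\<dots> = k \<otimes>\<^bsub>K\<^esub> qtorus_act w (tga_elem K k' w' (winv w \<circ> u))"
    using assms(1) by simp
  also have "\<dots> = tga_elem K (k \<otimes>\<^bsub>K\<^esub> qtorus_act w k') (w \<circ> w') u"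
    using iff by (simp add: tga_elem_apply)
  finally show "(tga_elem K k w \<otimes>\<^bsub>HW\<^esub> tga_elem K k' w') u = tga_elem K (k \<otimes>\<^bsub>K\<^esub> qtorus_act w k') (w \<circ> w') u" .
qed

text \<open>
  The element \<open>c e\<^sup>x e\<^sup>y \<otimes> w\<close>. Products of monomials are monomials, so identities between operators on modules reduce
  to arithmetic of exponents.
\<close>

definition monomial :: "complex \<Rightarrow> 'h dual \<Rightarrow> 'h \<Rightarrow> ('h \<Rightarrow> 'h) \<Rightarrow> ('h \<Rightarrow> 'h) \<Rightarrow> 'h qtorus_elem" where
  "monomial c x y w = tga_elem K (single (x, y) c) w"

lemma monomial_closed: "x \<in> X \<Longrightarrow> y \<in> Y \<Longrightarrow> w \<in> G \<Longrightarrow> monomial c x y w \<in> carrier (HG G)"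
  unfolding monomial_def by (intro tga_elem_closed K_single_closed)

lemma monomial_closed_W [simp]: "x \<in> X \<Longrightarrow> y \<in> Y \<Longrightarrow> w \<in> W \<Longrightarrow> monomial c x y w \<in> carrier HW"
  by (rule monomial_closed)

lemma monomial_mult:
  assumes "w \<in> W" "w' \<in> W" "x \<in> X" "y \<in> Y" "x' \<in> X" "y' \<in> Y"
  shows "monomial c x y w \<otimes>\<^bsub>HW\<^esub> monomial c' x' y' w' =
    monomial (c * c' * qpow n r (- blinfun_apply (dual_act w x') y)) (x + dual_act w x') (y + w y') (w \<circ> w')"
  unfolding monomial_def by (subst tga_mult) (use assms in \<open>auto simp: qtorus_act_single K_mult_single K_single_closed\<close>)

lemma one_eq_monomial: "\<one>\<^bsub>HG G\<^esub> = monomial 1 0 0 id"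
  by (simp add: HG_simps monomial_def)

lemma tga_elem_add: "tga_elem K (k + k') w = tga_elem K k w \<oplus>\<^bsub>HG G\<^esub> tga_elem K k' w"
  by (simp add: HG_simps tga_elem_apply fun_eq_iff)

lemma monomial_add: "monomial (c + c') x y w = monomial c x y w \<oplus>\<^bsub>HG G\<^esub> monomial c' x y w"
  by (simp add: monomial_def single_add tga_elem_add)

lemma monomial_0: "monomial 0 x y w = \<zero>\<^bsub>HG G\<^esub>"
  by (simp add: monomial_def HG_simps tga_elem_apply fun_eq_iff)

lemma tga_elem_0: "tga_elem K 0 w = \<zero>\<^bsub>HG G\<^esub>"
  by (simp add: HG_simps tga_elem_apply fun_eq_iff)

lemma HG_tga_induct [consumes 2, case_names zero add]:
  assumes "G \<subseteq> W" and F: "F \<in> carrier (HG G)"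
    and zero: "P \<zero>\<^bsub>HG G\<^esub>"
    and add: "\<And>k w F. k \<in> carrier K \<Longrightarrow> w \<in> G \<Longrightarrow> F \<in> carrier (HG G) \<Longrightarrow> P F \<Longrightarrow> P (tga_elem K k w \<oplus>\<^bsub>HG G\<^esub> F)"
  shows "P F"
proof -
  have "finite A \<Longrightarrow> A \<subseteq> G \<Longrightarrow> P (\<lambda>u. if u \<in> A then F u else 0)" for A
  proof (induction A rule: finite_induct)
    case empty
    then show ?case using zero by (simp add: HG_simps)
  next
    case (insert w A)
    have eq: "(\<lambda>u. if u \<in> insert w A then F u else 0) = tga_elem K (F w) w \<oplus>\<^bsub>HG G\<^esub> (\<lambda>u. if u \<in> A then F u else 0)"
      by (rule ext) (use insert in \<open>auto simp: HG_simps tga_elem_apply\<close>)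
    have "(\<lambda>u. if u \<in> A then F u else 0) \<in> carrier (HG G)" using F insert by (auto simp: HG_simps)
    then show ?case unfolding eq using insert HG_apply_closed[OF F, of w] by (intro add) auto
  qed
  from this[OF finite_subset[OF assms(1) W_finite] subset_refl]
  have "P (\<lambda>u. if u \<in> G then F u else 0)" .
  moreover have "(\<lambda>u. if u \<in> G then F u else 0) = F" using F by (auto simp: HG_simps fun_eq_iff)
  ultimately show ?thesis by simp
qed

lemma HG_add_closed: "F \<in> carrier (HG G) \<Longrightarrow> F' \<in> carrier (HG G) \<Longrightarrow> F \<oplus>\<^bsub>HG G\<^esub> F' \<in> carrier (HG G)"
  using K_add_closed by (auto simp: HG_simps)

lemma HG_induct [consumes 2, case_names zero add]:
  assumes "G \<subseteq> W" and F: "F \<in> carrier (HG G)"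
    and zero: "P \<zero>\<^bsub>HG G\<^esub>"
    and add: "\<And>c x y w F. x \<in> X \<Longrightarrow> y \<in> Y \<Longrightarrow> w \<in> G \<Longrightarrow> F \<in> carrier (HG G) \<Longrightarrow> P F \<Longrightarrow> P (monomial c x y w \<oplus>\<^bsub>HG G\<^esub> F)"
  shows "P F"
  using assms(1,2)
proof (induction F rule: HG_tga_induct)
  case (add k w F)
  from add(1) have "keys k \<subseteq> X \<times> Y" by (simp add: K_carrier)
  then have "P (tga_elem K k w \<oplus>\<^bsub>HG G\<^esub> F)"
  proof (induction k rule: poly_mapping_keys_induct)
    case zero
    have "tga_elem K 0 w \<oplus>\<^bsub>HG G\<^esub> F = F" by (simp add: HG_simps tga_elem_apply fun_eq_iff)
    then show ?case using add by simp
  next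
    case (add p c g)
    obtain x y where p: "p = (x, y)" "x \<in> X" "y \<in> Y" using add by auto
    have "tga_elem K (single p c + g) w \<oplus>\<^bsub>HG G\<^esub> F = monomial c x y w \<oplus>\<^bsub>HG G\<^esub> (tga_elem K g w \<oplus>\<^bsub>HG G\<^esub> F)"
      unfolding p by (simp add: HG_simps tga_elem_apply monomial_def fun_eq_iff)
    moreover have "tga_elem K g w \<oplus>\<^bsub>HG G\<^esub> F \<in> carrier (HG G)"
      using add \<open>w \<in> G\<close> \<open>F \<in> carrier (HG G)\<close> by (intro HG_add_closed tga_elem_closed) (auto simp: K_carrier)
    ultimately show ?case using assms(4)[OF p(2,3) \<open>w \<in> G\<close>] add by simp
  qed
  then show ?case .
qed (rule zero)

end

section \<open>Weight spaces\<close>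

locale module_data = torus_data \<Delta> X Y n r + left_module "qtorus_tga X Y n r (weyl_group \<Delta>)" M
  for \<Delta> :: "'h::euclidean_space set" and X Y n r
    and M :: "(('h \<Rightarrow> 'h) \<Rightarrow> 'h qtorus_elem, 'm) module" (structure)
begin

abbreviation act :: "(('h \<Rightarrow> 'h) \<Rightarrow> 'h qtorus_elem) \<Rightarrow> 'm \<Rightarrow> 'm" (infixr "\<cdot>" 75)
  where "F \<cdot> m \<equiv> F \<odot> m"

lemma smult_zero_left [simp]: "m \<in> carrier M \<Longrightarrow> \<zero>\<^bsub>HW\<^esub> \<cdot> m = \<zero>"
  using smult_l_distr[of "\<zero>\<^bsub>HW\<^esub>" "\<zero>\<^bsub>HW\<^esub>" m] M.add.l_cancel_one'[of "\<zero>\<^bsub>HW\<^esub> \<cdot> m" "\<zero>\<^bsub>HW\<^esub> \<cdot> m"]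
    smult_closed[of "\<zero>\<^bsub>HW\<^esub>" m] by simp

lemma smult_zero_right [simp]: "F \<in> carrier HW \<Longrightarrow> F \<cdot> \<zero> = \<zero>"
  using smult_r_distr[of F "\<zero>" "\<zero>"] M.add.l_cancel_one'[of "F \<cdot> \<zero>" "F \<cdot> \<zero>"]
    smult_closed[of F "\<zero>"] by simp

abbreviation scal :: "complex \<Rightarrow> ('h \<Rightarrow> 'h) \<Rightarrow> 'h qtorus_elem" where "scal c \<equiv> monomial c 0 0 id"

lemma monomial_smult_monomial:
  assumes "w \<in> W" "w' \<in> W" "x \<in> X" "y \<in> Y" "x' \<in> X" "y' \<in> Y" "m \<in> carrier M"
  shows "monomial c x y w \<cdot> (monomial c' x' y' w' \<cdot> m) =
    monomial (c * c' * qpow n r (- blinfun_apply (dual_act w x') y)) (x + dual_act w x') (y + w y') (w \<circ> w') \<cdot> m"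
  using assms by (simp add: smult_assoc[symmetric] monomial_mult)

lemma scal_monomial: "w \<in> W \<Longrightarrow> x \<in> X \<Longrightarrow> y \<in> Y \<Longrightarrow> m \<in> carrier M \<Longrightarrow> scal c \<cdot> (monomial c' x y w \<cdot> m) = monomial (c * c') x y w \<cdot> m"
  by (simp add: monomial_smult_monomial blinfun.zero_right)

lemma monomial_scal: "w \<in> W \<Longrightarrow> x \<in> X \<Longrightarrow> y \<in> Y \<Longrightarrow> m \<in> carrier M \<Longrightarrow> monomial c' x y w \<cdot> (scal c \<cdot> m) = monomial (c * c') x y w \<cdot> m"
  by (simp add: monomial_smult_monomial blinfun.zero_left mult.commute W_zero)

lemma monomial_closed_M [simp]: "w \<in> W \<Longrightarrow> x \<in> X \<Longrightarrow> y \<in> Y \<Longrightarrow> m \<in> carrier M \<Longrightarrow> monomial c x y w \<cdot> m \<in> carrier M"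
  by (intro smult_closed) auto

lemma scal_1 [simp]: "m \<in> carrier M \<Longrightarrow> scal 1 \<cdot> m = m"
  using smult_one[of m] by (simp add: one_eq_monomial)

lemma scal_0 [simp]: "m \<in> carrier M \<Longrightarrow> scal 0 \<cdot> m = \<zero>"
  using smult_zero_left[of m] monomial_0[where G=W] by simp

lemma scal_scal [simp]: "m \<in> carrier M \<Longrightarrow> scal c \<cdot> (scal d \<cdot> m) = scal (c * d) \<cdot> m"
  by (simp add: scal_monomial)

lemma scal_add: "m \<in> carrier M \<Longrightarrow> scal (c + d) \<cdot> m = scal c \<cdot> m \<oplus> scal d \<cdot> m"
  by (subst monomial_add[where G=W], rule smult_l_distr) auto

lemma scal_minus: "m \<in> carrier M \<Longrightarrow> scal (- 1) \<cdot> m = \<ominus> m"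
proof -
  assume m: "m \<in> carrier M"
  have "scal (- 1) \<cdot> m \<oplus> m = \<zero>" using scal_add[OF m, of "-1" 1] m by simp
  then show ?thesis using m by (intro M.minus_equality[symmetric]) auto
qed

lemma scal_eq_zero: "m \<in> carrier M \<Longrightarrow> scal c \<cdot> m = \<zero> \<Longrightarrow> c = 0 \<or> m = \<zero>"
proof -
  assume m: "m \<in> carrier M" and 0: "scal c \<cdot> m = \<zero>"
  have "m = scal (inverse c) \<cdot> (scal c \<cdot> m)" if "c \<noteq> 0" using that m by simp
  then show ?thesis using 0 by auto
qed

definition weight_space :: "'h torus_elem \<Rightarrow> 'm set" where
  "weight_space \<mu> = {m \<in> carrier M. \<forall>x\<in>X. monomial 1 x 0 id \<cdot> m = scal (\<mu> x) \<cdot> m}"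

lemma weight_space_carrier: "m \<in> weight_space \<mu> \<Longrightarrow> m \<in> carrier M" by (simp add: weight_space_def)

lemma weight_space_zero [simp]: "\<zero> \<in> weight_space \<mu>" by (simp add: weight_space_def)

lemma weight_space_add: "m \<in> weight_space \<mu> \<Longrightarrow> m' \<in> weight_space \<mu> \<Longrightarrow> m \<oplus> m' \<in> weight_space \<mu>"
  by (auto simp: weight_space_def smult_r_distr)

lemma weight_space_scal: 
  assumes "m \<in> weight_space \<mu>" shows "scal c \<cdot> m \<in> weight_space \<mu>"
proof -
  have mc: "m \<in> carrier M" using assms by (simp add: weight_space_def)
  have "monomial 1 x 0 id \<cdot> (scal c \<cdot> m) = scal (\<mu> x) \<cdot> (scal c \<cdot> m)" if x: "x \<in> X" for x
  proof -
    have "monomial 1 x 0 id \<cdot> (scal c \<cdot> m) = monomial (c * 1) x 0 id \<cdot> m"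
      by (rule monomial_scal) (use mc x in auto)
    also have "\<dots> = scal c \<cdot> (monomial 1 x 0 id \<cdot> m)"
      by (rule scal_monomial[symmetric]) (use mc x in auto)
    also have "monomial 1 x 0 id \<cdot> m = scal (\<mu> x) \<cdot> m" using assms x by (simp add: weight_space_def)
    also have "scal c \<cdot> (scal (\<mu> x) \<cdot> m) = scal (\<mu> x) \<cdot> (scal c \<cdot> m)"
      using mc by (simp add: mult.commute)
    finally show ?thesis .
  qed
  then show ?thesis using mc by (simp add: weight_space_def)
qed

lemma weight_space_e: "m \<in> weight_space \<mu> \<Longrightarrow> x \<in> X \<Longrightarrow> monomial c x 0 id \<cdot> m = scal (c * \<mu> x) \<cdot> m"
proof -
  assume m: "m \<in> weight_space \<mu>" and x: "x \<in> X"
  then have mc: "m \<in> carrier M" by (simp add: weight_space_def)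
  have "monomial c x 0 id \<cdot> m = scal c \<cdot> (monomial 1 x 0 id \<cdot> m)" using mc x by (simp add: scal_monomial)
  also have "monomial 1 x 0 id \<cdot> m = scal (\<mu> x) \<cdot> m" using m x by (simp add: weight_space_def)
  also have "scal c \<cdot> (scal (\<mu> x) \<cdot> m) = scal (c * \<mu> x) \<cdot> m" using mc by (rule scal_scal)
  finally show ?thesis .
qed

text \<open>
  The second part says that on a weight vector the factor \<open>e\<^sup>x\<close> of a monomial is a scalar: \<open>e\<^sup>x\<close> stands on the left, so
  it is evaluated at the weight of the image.
\<close>

lemma monomial_weight_space:
  assumes m: "m \<in> weight_space \<mu>" and \<mu>: "\<mu> \<in> TT" and "w \<in> W" "x \<in> X" "y \<in> Y"
  shows "monomial c x y w \<cdot> m \<in> weight_space (shift (torus_act X w \<mu>) y)"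
    and "monomial c x y w \<cdot> m = monomial (c * shift (torus_act X w \<mu>) y x) 0 y w \<cdot> m"
proof -
  note mc = weight_space_carrier[OF m]
  let ?\<nu> = "shift (torus_act X w \<mu>) y"
  have E: "monomial c x y w \<cdot> m = monomial (c * ?\<nu> x) 0 y w \<cdot> m" if "x \<in> X" for x c
  proof -
    let ?x = "dual_act (winv w) x"
    have "monomial (c * qp x y) 0 y w \<cdot> (monomial 1 ?x 0 id \<cdot> m) = monomial (c * qp x y * qpow n r (- blinfun_apply x y)) x y w \<cdot> m"
      using mc assms that by (subst monomial_smult_monomial) (simp_all add: W_zero)
    moreover have "c * qp x y * qpow n r (- blinfun_apply x y) = c" using that assms by (simp add: qpow_minus)
    moreover have "monomial 1 ?x 0 id \<cdot> m = scal (\<mu> ?x) \<cdot> m" using weight_space_e[OF m, of ?x 1] assms that by simp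
    moreover have "monomial (c * qp x y) 0 y w \<cdot> (scal (\<mu> ?x) \<cdot> m) = monomial (\<mu> ?x * (c * qp x y)) 0 y w \<cdot> m"
      using mc assms by (simp add: monomial_scal)
    ultimately have "monomial (\<mu> ?x * (c * qp x y)) 0 y w \<cdot> m = monomial c x y w \<cdot> m" by simp
    then show ?thesis using that by (simp add: shift_apply torus_act_apply mult_ac)
  qed
  show "monomial c x y w \<cdot> m = monomial (c * ?\<nu> x) 0 y w \<cdot> m" by (rule E[OF \<open>x \<in> X\<close>])
  have "monomial 1 x' 0 id \<cdot> (monomial c x y w \<cdot> m) = scal (?\<nu> x') \<cdot> (monomial c x y w \<cdot> m)" if x': "x' \<in> X" for x'
  proof -
    have "monomial 1 x' 0 id \<cdot> (monomial c x y w \<cdot> m) = monomial c (x' + x) y w \<cdot> m"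
      using mc assms x' by (subst monomial_smult_monomial) (auto simp: blinfun.zero_right)
    also have "\<dots> = monomial (c * ?\<nu> (x' + x)) 0 y w \<cdot> m" by (rule E) (use assms x' in auto)
    also have "?\<nu> (x' + x) = ?\<nu> x' * ?\<nu> x" using assms x' torusD[of ?\<nu>] by simp
    also have "monomial (c * (?\<nu> x' * ?\<nu> x)) 0 y w \<cdot> m = scal (?\<nu> x') \<cdot> (monomial (c * ?\<nu> x) 0 y w \<cdot> m)"
      using mc assms by (subst scal_monomial) (auto simp: mult_ac)
    also have "monomial (c * ?\<nu> x) 0 y w \<cdot> m = monomial c x y w \<cdot> m" by (rule E[symmetric]) (use assms in auto)
    finally show ?thesis .
  qed
  then show "monomial c x y w \<cdot> m \<in> weight_space ?\<nu>" using mc assms by (simp add: weight_space_def)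
qed

text \<open>
  Interpolation: the product over \<open>\<mu> \<in> P\<close> of \<open>(e\<^sup>x - \<mu>(x)) / (\<nu>(x) - \<mu>(x))\<close>, where \<open>x\<close> depends on \<open>\<mu>\<close> and
  distinguishes it from \<open>\<nu>\<close>.
\<close>

lemma separate_weights:
  assumes "finite P" "P \<subseteq> TT" "\<nu> \<in> TT" "\<nu> \<notin> P"
  shows "\<exists>a\<in>carrier HW. (\<forall>m\<in>weight_space \<nu>. a \<cdot> m = m) \<and> (\<forall>\<mu>\<in>P. \<forall>m\<in>weight_space \<mu>. a \<cdot> m = \<zero>)"
  using assms
proof (induction P rule: finite_induct)
  case empty
  then show ?case by (intro bexI[of _ "scal 1"]) (auto simp: weight_space_carrier)
next
  case (insert \<mu> P)
  then obtain a where a: "a \<in> carrier HW" "\<forall>m\<in>weight_space \<nu>. a \<cdot> m = m" "\<forall>\<mu>\<in>P. \<forall>m\<in>weight_space \<mu>. a \<cdot> m = \<zero>"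
    by auto
  have "\<nu> \<noteq> \<mu>" "\<mu> \<in> TT" using insert by auto
  then obtain x where x: "x \<in> X" "\<nu> x \<noteq> \<mu> x" using torus_eqI[of \<nu> \<mu>] insert by blast
  define d where "d = inverse (\<nu> x - \<mu> x)"
  define b where "b = monomial d x 0 id \<oplus>\<^bsub>HW\<^esub> scal (- d * \<mu> x)"
  have bc: "b \<in> carrier HW" using x by (simp add: b_def)
  have b: "b \<cdot> m = scal (d * (\<kappa> x - \<mu> x)) \<cdot> m" if "m \<in> weight_space \<kappa>" for m \<kappa>
  proof -
    have mc: "m \<in> carrier M" using that by (rule weight_space_carrier)
    have "b \<cdot> m = monomial d x 0 id \<cdot> m \<oplus> scal (- d * \<mu> x) \<cdot> m"
      unfolding b_def using mc x by (subst smult_l_distr) auto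
    also have "\<dots> = scal (d * \<kappa> x + (- d * \<mu> x)) \<cdot> m" using weight_space_e[OF that x(1)] scal_add[OF mc, of "d * \<kappa> x" "- d * \<mu> x"] by simp
    finally show ?thesis by (simp add: algebra_simps)
  qed
  have scal_a: "a \<cdot> (b \<cdot> m) = \<zero>" if "m \<in> weight_space \<kappa>" "\<kappa> \<in> insert \<mu> P" for m \<kappa>
  proof (cases "\<kappa> = \<mu>")
    case True then show ?thesis using that b[OF that(1)] a(1) by (simp add: weight_space_carrier)
  next
    case False then show ?thesis using that b[OF that(1)] a(3) weight_space_scal by auto
  qed
  show ?case
  proof (rule bexI[of _ "a \<otimes>\<^bsub>HW\<^esub> b"], intro conjI ballI)
    fix m assume m: "m \<in> weight_space \<nu>"
    have "d * (\<nu> x - \<mu> x) = 1" using x by (simp add: d_def)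
    then show "(a \<otimes>\<^bsub>HW\<^esub> b) \<cdot> m = m" using a bc b[OF m] m by (simp add: smult_assoc weight_space_carrier)
  next
    fix \<kappa> m assume "\<kappa> \<in> insert \<mu> P" "m \<in> weight_space \<kappa>"
    then show "(a \<otimes>\<^bsub>HW\<^esub> b) \<cdot> m = \<zero>" using scal_a a bc by (simp add: smult_assoc weight_space_carrier)
  qed (use a bc in simp)
qed

end

section \<open>Existence of a weight vector\<close>

text \<open>
  Elements of \<open>W\<close> occur both as functions and as indices of monomials. Rewriting an eta-expanded identity or composite
  to a lambda term would hide it from the rules about \<open>W\<close>.
\<close>

declare id_apply [simp del] comp_apply [simp del]

lemma id_zero [simp]: "id 0 = 0"
  by (simp add: id_apply)

definition peval :: "complex poly \<Rightarrow> ('a::cancel_comm_monoid_add \<Rightarrow>\<^sub>0 complex) \<Rightarrow> ('a \<Rightarrow>\<^sub>0 complex)" where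
  "peval p a = poly (map_poly (single 0) p) a"

lemma peval_0 [simp]: "peval 0 a = 0"
  by (simp add: peval_def)

lemma peval_pCons: "peval (pCons c p) a = single 0 c + a * peval p a"
  by (simp add: peval_def map_poly_pCons)

lemma peval_add: "peval (p + q) a = peval p a + peval q a"
proof -
  have "map_poly (single 0) (p + q) = map_poly (single 0) p + map_poly (single (0::'a)) q"
    by (intro poly_eqI) (simp add: coeff_map_poly single_add)
  then show ?thesis by (simp add: peval_def)
qed

lemma peval_smult: "peval (Polynomial.smult c p) a = single 0 c * peval p a"
  by (simp add: peval_def map_poly_smult mult_single)

lemma peval_mult: "peval (p * q) a = peval p a * peval q a"
  by (induction p) (simp_all add: peval_pCons peval_add peval_smult algebra_simps)

lemma peval_monom: "peval (monom c k) a = single 0 c * a ^ k"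
  by (simp add: peval_def map_poly_monom poly_monom)

lemma peval_sum: "peval (\<Sum>i\<in>I. f i) a = (\<Sum>i\<in>I. peval (f i) a)"
  by (induction I rule: infinite_finite_induct) (simp_all add: peval_add)

lemma lead_coeff_mult_monic:
  fixes p q :: "'a::comm_semiring_1 poly"
  assumes "lead_coeff p = 1" "lead_coeff q = 1"
  shows "lead_coeff (p * q) = 1"
proof -
  have c: "coeff (p * q) (degree p + degree q) = 1"
    using coeff_mult_degree_sum[of p q] assms by simp
  then have "degree p + degree q \<le> degree (p * q)" by (intro le_degree) auto
  then have "degree (p * q) = degree p + degree q" using degree_mult_le[of p q] by linarith
  then show ?thesis using c by simp
qed

context torus_data
begin

text \<open>
  Elements of \<open>\<complex>X\<close> are represented by finitely supported functions on the dual space, which form an instance of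
  \<open>comm_ring_1\<close>; this gives access to polynomials over \<open>\<complex>X\<close>. They enter the quantum torus through \<open>lift\<close>.
\<close>

definition lift :: "('h dual \<Rightarrow>\<^sub>0 complex) \<Rightarrow> 'h qtorus_elem" where
  "lift a = (\<Sum>x\<in>keys a. single (x, 0) (lookup a x))"

definition emb :: "('h dual \<Rightarrow>\<^sub>0 complex) \<Rightarrow> ('h \<Rightarrow> 'h) \<Rightarrow> 'h qtorus_elem" where
  "emb a = tga_elem K (lift a) id"

definition twist :: "('h \<Rightarrow> 'h) \<Rightarrow> ('h dual \<Rightarrow>\<^sub>0 complex) \<Rightarrow> ('h dual \<Rightarrow>\<^sub>0 complex)" where
  "twist w a = (\<Sum>x\<in>keys a. single (dual_act w x) (lookup a x))"

definition CX :: "('h dual \<Rightarrow>\<^sub>0 complex) set" where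
  "CX = {a. keys a \<subseteq> X}"

lemma lift_add: "lift (a + b) = lift a + lift b"
  unfolding lift_def by (rule setsum_keys_plus_distrib) (simp_all add: single_add)

lemma lift_single: "lift (single x c) = single (x, 0) c"
  by (cases "c = 0") (simp_all add: lift_def)

lemma lift_0 [simp]: "lift 0 = 0" by (simp add: lift_def)

lemma twist_add: "twist w (a + b) = twist w a + twist w b"
  unfolding twist_def by (rule setsum_keys_plus_distrib) (simp_all add: single_add)

lemma twist_single: "twist w (single x c) = single (dual_act w x) c"
  by (cases "c = 0") (simp_all add: twist_def)

lemma twist_0 [simp]: "twist w 0 = 0" by (simp add: twist_def)

lemma qtorus_act_add: "qtorus_act w (f + g) = qtorus_act w f + qtorus_act w g"
  unfolding qtorus_act_def split_def prod.collapse
  by (rule setsum_keys_plus_distrib) (simp_all add: single_add)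

lemma qtorus_act_lift: "w \<in> W \<Longrightarrow> qtorus_act w (lift a) = lift (twist w a)"
  by (induction a rule: poly_mapping_keys_induct[OF subset_UNIV])
    (simp_all add: lift_add twist_add qtorus_act_add lift_single twist_single qtorus_act_single W_zero)

lemma twist_mult: assumes "w \<in> W" shows "twist w (a * b) = twist w a * twist w b"
proof -
  have 1: "twist w (single x c * b) = twist w (single x c) * twist w b" for x c
    by (induction b rule: poly_mapping_keys_induct[OF subset_UNIV])
      (simp_all add: twist_add distrib_left mult_single twist_single assms)
  show ?thesis
    by (induction a rule: poly_mapping_keys_induct[OF subset_UNIV])
      (simp_all add: twist_add distrib_right 1)
qed

lemma twist_1: "w \<in> W \<Longrightarrow> twist w 1 = 1"
  using twist_single[of w 0 1] by simp

lemma CX_add: "a \<in> CX \<Longrightarrow> b \<in> CX \<Longrightarrow> a + b \<in> CX"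
  using Poly_Mapping.keys_add[of a b] by (auto simp: CX_def)

lemma CX_single [simp]: "x \<in> X \<Longrightarrow> single x c \<in> CX"
  by (auto simp: CX_def)

lemma CX_0 [simp]: "0 \<in> CX" by (simp add: CX_def)

lemma CX_1 [simp]: "1 \<in> CX" using CX_single[of 0 1] by simp

lemma CX_mult: "a \<in> CX \<Longrightarrow> b \<in> CX \<Longrightarrow> a * b \<in> CX"
  using Poly_Mapping.keys_mult[of a b] X_group(2) unfolding CX_def by blast

lemma CX_uminus: "a \<in> CX \<Longrightarrow> - a \<in> CX" by (simp add: CX_def)

lemma CX_power: "a \<in> CX \<Longrightarrow> a ^ k \<in> CX"
  by (induction k) (auto intro: CX_mult)

lemma CX_sum: "(\<And>i. i \<in> I \<Longrightarrow> f i \<in> CX) \<Longrightarrow> sum f I \<in> CX"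
  by (induction I rule: infinite_finite_induct) (auto intro: CX_add)

lemma CX_peval: "a \<in> CX \<Longrightarrow> peval p a \<in> CX"
  by (induction p) (auto simp: peval_pCons intro!: CX_add CX_mult)

lemma lift_closed: "a \<in> CX \<Longrightarrow> lift a \<in> carrier K"
  unfolding lift_def by (intro K_sum_closed K_single_closed) (auto simp: CX_def)

lemma lift_keys: "a \<in> CX \<Longrightarrow> keys (lift a) \<subseteq> X \<times> {0}"
proof -
  assume "a \<in> CX"
  then have "keys a \<subseteq> X" by (simp add: CX_def)
  then show ?thesis
  proof (induction a rule: poly_mapping_keys_induct)
    case (add x c b)
    then show ?case
      using Poly_Mapping.keys_add[of "single (x, 0::'h) c" "lift b"]
      by (auto simp: lift_add lift_single split: if_splits)
  qed simp
qed

lemma emb_closed [simp]: "a \<in> CX \<Longrightarrow> emb a \<in> carrier HW"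
  unfolding emb_def by (intro tga_elem_closed lift_closed) auto

lemma emb_add: "emb (a + b) = emb a \<oplus>\<^bsub>HW\<^esub> emb b"
  unfolding emb_def lift_add by (rule tga_elem_add)

lemma emb_single: "emb (single x c) = monomial c x 0 id"
  by (simp add: emb_def monomial_def lift_single)

lemma emb_0: "emb 0 = \<zero>\<^bsub>HW\<^esub>"
  by (simp add: emb_def tga_elem_0[where G=W])

end

context module_data
begin

lemma emb_mult: assumes "a \<in> CX" "b \<in> CX" shows "emb (a * b) = emb a \<otimes>\<^bsub>HW\<^esub> emb b"
proof -
  have b: "keys b \<subseteq> X" and a: "keys a \<subseteq> X" using assms by (auto simp: CX_def)
  have 1: "emb (single x c * b) = monomial c x 0 id \<otimes>\<^bsub>HW\<^esub> emb b" if x: "x \<in> X" for x c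
    using b
  proof (induction b rule: poly_mapping_keys_induct)
    case zero
    show ?case unfolding mult_zero_right emb_0
      by (rule R.r_null[symmetric, OF monomial_closed_W[OF x Y_group(1) W_id]])
  next
    case (add y d g)
    then have "emb g \<in> carrier HW" by (simp add: CX_def)
    then show ?case using add x
      by (simp add: distrib_left mult_single emb_add emb_single R.r_distr monomial_mult blinfun.zero_right)
  qed
  show ?thesis
    using a
  proof (induction a rule: poly_mapping_keys_induct)
    case zero
    then show ?case using assms by (simp add: emb_0)
  next
    case (add y d g)
    then have "emb g \<in> carrier HW" by (simp add: CX_def)
    then show ?case using add assms 1
      by (simp add: distrib_right emb_add emb_single R.l_distr)
  qed
qed

lemma emb_act_mult: "a \<in> CX \<Longrightarrow> b \<in> CX \<Longrightarrow> m \<in> carrier M \<Longrightarrow> emb (a * b) \<cdot> m = emb a \<cdot> (emb b \<cdot> m)"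
  by (simp add: emb_mult smult_assoc)

lemma emb_act_add: "a \<in> CX \<Longrightarrow> b \<in> CX \<Longrightarrow> m \<in> carrier M \<Longrightarrow> emb (a + b) \<cdot> m = emb a \<cdot> m \<oplus> emb b \<cdot> m"
  by (simp add: emb_add smult_l_distr)

lemma emb_act_commute: "a \<in> CX \<Longrightarrow> b \<in> CX \<Longrightarrow> m \<in> carrier M \<Longrightarrow> emb a \<cdot> (emb b \<cdot> m) = emb b \<cdot> (emb a \<cdot> m)"
  by (simp add: emb_act_mult[symmetric] mult.commute)

lemma emb_act_closed [simp]: "a \<in> CX \<Longrightarrow> m \<in> carrier M \<Longrightarrow> emb a \<cdot> m \<in> carrier M"
  by (simp add: smult_closed)

lemma emb_const: "emb (single 0 c) = scal c"
  by (simp add: emb_single)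

lemma emb_1_act [simp]: "m \<in> carrier M \<Longrightarrow> emb 1 \<cdot> m = m"
  using emb_const[of 1] by simp

lemma emb_0_act [simp]: "m \<in> carrier M \<Longrightarrow> emb 0 \<cdot> m = \<zero>"
  by (simp add: emb_0)

text \<open>
  The eigenvector has the form \<open>b m\<close> with \<open>b\<close> in the group algebra of \<open>X\<close>, so eigenvector relations of \<open>m\<close> for other
  elements of this commutative algebra are not lost. A linear factor of \<open>p\<close> is split off: either the cofactor still
  kills \<open>m\<close>, and the degree has dropped, or it maps \<open>m\<close> to an eigenvector.
\<close>

lemma eigenvector_exists:
  assumes "m \<in> carrier M" "m \<noteq> \<zero>" "a \<in> CX" "p \<noteq> 0" "emb (peval p a) \<cdot> m = \<zero>"
  shows "\<exists>b\<in>CX. \<exists>z. emb b \<cdot> m \<noteq> \<zero> \<and> emb a \<cdot> (emb b \<cdot> m) = scal z \<cdot> (emb b \<cdot> m)"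
  using assms(4,5)
proof (induction "degree p" arbitrary: p rule: less_induct)
  case less
  have "\<not> constant (poly p)"
  proof
    assume "constant (poly p)"
    then have "degree p = 0" unfolding constant_degree .
    then obtain c where c: "p = [:c:]" by (rule degree_eq_zeroE)
    then have "scal c \<cdot> m = \<zero>" using less(3) by (simp add: peval_pCons emb_const)
    then show False using scal_eq_zero[OF assms(1)] c less(2) assms(2) by auto
  qed
  then obtain z where z: "poly p z = 0" using fundamental_theorem_of_algebra by blast
  then obtain q where q: "p = [:- z, 1:] * q" by (metis dvdE poly_eq_0_iff_dvd)
  then have q0: "q \<noteq> 0" using less(2) by auto
  then have deg: "degree q < degree p" unfolding q by (subst degree_mult_eq) auto
  show ?case
  proof (cases "emb (peval q a) \<cdot> m = \<zero>")
    case True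
    show ?thesis by (rule less(1)[OF deg q0 True])
  next
    case False
    let ?b = "peval q a"
    have b: "?b \<in> CX" using assms(3) by (rule CX_peval)
    let ?u = "emb ?b \<cdot> m"
    have u: "?u \<in> carrier M" using b assms by simp
    have e: "peval p a = (single 0 (- z) + a) * ?b" unfolding q peval_mult by (simp add: peval_pCons)
    have "scal (- z) \<cdot> ?u \<oplus> emb a \<cdot> ?u = \<zero>"
      using less(3) unfolding e
      using b assms(1,3) by (simp add: emb_act_mult emb_act_add CX_add emb_const)
    moreover have "scal z \<cdot> ?u \<oplus> scal (- z) \<cdot> ?u = \<zero>"
      using scal_add[OF u, of z "- z"] u by simp
    ultimately have "emb a \<cdot> ?u = scal z \<cdot> ?u"
      using u assms(3) by (metis M.add.inv_comm M.minus_equality M.minus_minus M.minus_unique emb_act_closed monomial_closed_M W_id X_group(1) Y_group(1))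
    then show ?thesis using False b by blast
  qed
qed

lemma common_eigenvector_exists:
  assumes "finite F" "F \<subseteq> CX" "m \<in> carrier M" "m \<noteq> \<zero>"
    and "\<And>a. a \<in> F \<Longrightarrow> \<exists>p. p \<noteq> 0 \<and> emb (peval p a) \<cdot> m = \<zero>"
  shows "\<exists>b\<in>CX. emb b \<cdot> m \<noteq> \<zero> \<and> (\<forall>a\<in>F. \<exists>z. emb a \<cdot> (emb b \<cdot> m) = scal z \<cdot> (emb b \<cdot> m))"
  using assms(1,2,5)
proof (induction F rule: finite_induct)
  case empty
  show ?case by (rule bexI[of _ 1]) (use assms in auto)
next
  case (insert a F)
  then obtain b where b: "b \<in> CX" "emb b \<cdot> m \<noteq> \<zero>"
     "\<forall>a\<in>F. \<exists>z. emb a \<cdot> (emb b \<cdot> m) = scal z \<cdot> (emb b \<cdot> m)"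
    by (meson insert_iff insert_subset)
  obtain p where p: "p \<noteq> 0" "emb (peval p a) \<cdot> m = \<zero>" using insert(5)[of a] by auto
  have a: "a \<in> CX" using insert by auto
  let ?u = "emb b \<cdot> m"
  have u: "?u \<in> carrier M" using b assms by simp
  have "emb (peval p a) \<cdot> ?u = \<zero>"
    using emb_act_commute[OF CX_peval[OF a] b(1) assms(3), of p] p b(1) by simp
  from eigenvector_exists[OF u b(2) a p(1) this]
  obtain c z where c: "c \<in> CX" "emb c \<cdot> ?u \<noteq> \<zero>" "emb a \<cdot> (emb c \<cdot> ?u) = scal z \<cdot> (emb c \<cdot> ?u)" by blast
  have "\<exists>z. emb a' \<cdot> (emb c \<cdot> ?u) = scal z \<cdot> (emb c \<cdot> ?u)" if a': "a' \<in> F" for a'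
  proof -
    obtain z where z: "emb a' \<cdot> ?u = scal z \<cdot> ?u" using b(3) a' by blast
    have "a' \<in> CX" using a' insert by auto
    then have "emb a' \<cdot> (emb c \<cdot> ?u) = emb c \<cdot> (emb a' \<cdot> ?u)"
      using emb_act_commute c(1) u by blast
    also have "\<dots> = emb c \<cdot> (scal z \<cdot> ?u)" by (simp only: z)
    also have "\<dots> = scal z \<cdot> (emb c \<cdot> ?u)"
      using emb_act_commute[of "single 0 z" c ?u] c u by (simp add: emb_const)
    finally show ?thesis by blast
  qed
  then have "\<forall>a'\<in>insert a F. \<exists>z. emb a' \<cdot> (emb c \<cdot> ?u) = scal z \<cdot> (emb c \<cdot> ?u)"
    using c(3) by blast
  then show ?case using c(2) CX_mult[OF c(1) b(1)] unfolding emb_act_mult[OF c(1) b(1) assms(3), symmetric] by blast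
qed

lemma smult_finsum: "finite S \<Longrightarrow> F \<in> carrier HW \<Longrightarrow> f \<in> S \<rightarrow> carrier M \<Longrightarrow>
    F \<cdot> (\<Oplus>s\<in>S. f s) = (\<Oplus>s\<in>S. F \<cdot> f s)"
proof (induction S rule: finite_induct)
  case (insert s S)
  have "(\<lambda>s. F \<cdot> f s) \<in> S \<rightarrow> carrier M" "f \<in> S \<rightarrow> carrier M" using insert by (auto intro: smult_closed)
  then show ?case using insert by (simp add: smult_r_distr smult_closed)
qed simp

end

locale lf_module = module_data \<Delta> X Y n r M
  for \<Delta> :: "'h::euclidean_space set" and X Y n r
    and M :: "(('h \<Rightarrow> 'h) \<Rightarrow> 'h qtorus_elem, 'm) module" (structure) +
  assumes lf: "locally_finite_action (qtorus_scalar X Y n r) (invariant_CX \<Delta> X Y n r) M"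
    and nontrivial: "carrier M \<noteq> {\<zero>}"
begin

lemma qtorus_scalar_eq: "qtorus_scalar X Y n r c = scal c"
  by (simp add: qtorus_scalar_def monomial_def)

text \<open>
  If \<open>S\<close> is finite and spans all images of \<open>m\<close> under invariants, then the vectors \<open>a\<^sup>k m\<close> for \<open>k \<le> card S\<close> satisfy a
  nontrivial linear relation.
\<close>

lemma invariant_algebraic:
  assumes a: "a \<in> CX" and inv: "\<And>w. w \<in> W \<Longrightarrow> twist w a = a" and m: "m \<in> carrier M"
  shows "\<exists>p. p \<noteq> 0 \<and> emb (peval p a) \<cdot> m = \<zero>"
proof -
  let ?A = "invariant_CX \<Delta> X Y n r"
  have pow: "twist w (a ^ k) = a ^ k" if "w \<in> W" for w k
    using that by (induction k) (simp_all add: twist_1 twist_mult inv)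
  have inA: "emb (a ^ k) \<in> ?A" for k
  proof -
    have "\<forall>w\<in>W. qtorus_act w (lift (a ^ k)) = lift (a ^ k)" using pow qtorus_act_lift by simp
    then show ?thesis using lift_keys[OF CX_power[OF a]] unfolding invariant_CX_def emb_def by blast
  qed
  have Acl: "?A \<subseteq> carrier HW"
  proof
    fix F assume "F \<in> ?A"
    then obtain f where f: "F = tga_elem K f id" "keys f \<subseteq> X \<times> {0}" by (auto simp: invariant_CX_def)
    then have "f \<in> carrier K" using Y_group(1) by (auto simp: K_carrier)
    then show "F \<in> carrier HW" unfolding f(1) by (rule tga_elem_closed[OF _ W_id])
  qed
  obtain S where S: "finite S" "S \<subseteq> {b \<cdot> m | b. b \<in> ?A}"
      "{b \<cdot> m | b. b \<in> ?A} \<subseteq> complex_span (qtorus_scalar X Y n r) M S"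
    using lf m unfolding locally_finite_action_def by blast
  have SM: "S \<subseteq> carrier M"
  proof
    fix s assume "s \<in> S"
    then obtain b where "b \<in> ?A" "s = b \<cdot> m" using S(2) by blast
    then show "s \<in> carrier M" using smult_closed[OF subsetD[OF Acl] m] by simp
  qed
  have "\<exists>c. emb (a ^ k) \<cdot> m = (\<Oplus>s\<in>S. scal (c s) \<cdot> s)" for k
  proof -
    have "emb (a ^ k) \<cdot> m \<in> {b \<cdot> m | b. b \<in> ?A}" using inA by blast
    from subsetD[OF S(3) this] show ?thesis unfolding complex_span_def qtorus_scalar_eq by simp
  qed
  then have "\<exists>c. \<forall>k. emb (a ^ k) \<cdot> m = (\<Oplus>s\<in>S. scal (c k s) \<cdot> s)" by (intro choice allI)
  then obtain c where c': "\<forall>k. emb (a ^ k) \<cdot> m = (\<Oplus>s\<in>S. scal (c k s) \<cdot> s)" by (rule exE)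
  note c = c'[rule_format]
  obtain d where d: "\<exists>k\<in>{..card S}. d k \<noteq> 0" "\<forall>s\<in>S. (\<Sum>k\<in>{..card S}. d k * c k s) = 0"
    using homogeneous_system_nontrivial[OF S(1), of "{..card S}" c] by (auto simp del: sum.atMost_Suc)
  have cl: "(\<lambda>s. scal (f s) \<cdot> s) \<in> S \<rightarrow> carrier M" for f using SM by auto
  have comb: "emb (\<Sum>k\<in>I. single 0 (d k) * a ^ k) \<cdot> m = (\<Oplus>s\<in>S. scal (\<Sum>k\<in>I. d k * c k s) \<cdot> s)"
    if "finite I" for I
    using that
  proof (induction I rule: finite_induct)
    case empty
    have "(\<Oplus>s\<in>S. scal 0 \<cdot> s) = (\<Oplus>s\<in>S. \<zero>)" by (rule M.finsum_cong') (use SM in auto)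
    then show ?case using m by simp
  next
    case (insert k I)
    let ?t = "\<Sum>k\<in>I. single 0 (d k) * a ^ k"
    have t: "?t \<in> CX" using a by (intro CX_sum CX_mult CX_power) auto
    have "emb (single 0 (d k) * a ^ k + ?t) \<cdot> m =
        scal (d k) \<cdot> (emb (a ^ k) \<cdot> m) \<oplus> emb ?t \<cdot> m"
      using t a m by (simp add: emb_act_add emb_act_mult CX_mult CX_power emb_const)
    also have "scal (d k) \<cdot> (emb (a ^ k) \<cdot> m) = (\<Oplus>s\<in>S. scal (d k) \<cdot> (scal (c k s) \<cdot> s))"
      unfolding c by (rule smult_finsum) (use S cl in auto)
    also have "\<dots> = (\<Oplus>s\<in>S. scal (d k * c k s) \<cdot> s)"
      by (rule M.finsum_cong') (use SM in auto)
    also have "\<dots> \<oplus> emb ?t \<cdot> m =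
       (\<Oplus>s\<in>S. scal (d k * c k s) \<cdot> s \<oplus> scal (\<Sum>k\<in>I. d k * c k s) \<cdot> s)"
      unfolding insert.IH by (rule M.finsum_addf[symmetric]) (rule cl)+
    also have "\<dots> = (\<Oplus>s\<in>S. scal (\<Sum>k\<in>insert k I. d k * c k s) \<cdot> s)"
      by (rule M.finsum_cong') (use SM insert in \<open>auto simp: scal_add\<close>)
    finally show ?case using insert by simp
  qed
  define p where "p = (\<Sum>k\<le>card S. monom (d k) k)"
  have "emb (peval p a) \<cdot> m = (\<Oplus>s\<in>S. scal (\<Sum>k\<le>card S. d k * c k s) \<cdot> s)"
    unfolding p_def peval_sum peval_monom by (rule comb) simp
  also have "\<dots> = (\<Oplus>s\<in>S. \<zero>)" by (rule M.finsum_cong') (use SM d in auto)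
  finally have "emb (peval p a) \<cdot> m = \<zero>" by simp
  moreover have "p \<noteq> 0"
  proof -
    obtain k where k: "k \<le> card S" "d k \<noteq> 0" using d by auto
    have "coeff p k = d k" using k by (simp add: p_def coeff_sum)
    then show ?thesis using k by auto
  qed
  ultimately show ?thesis by blast
qed

definition orbit_poly :: "'h dual \<Rightarrow> ('h dual \<Rightarrow>\<^sub>0 complex) poly" where
  "orbit_poly x = (\<Prod>w\<in>W. [:- single (dual_act w x) 1, 1:])"

text \<open>
  All factors are monic, so degrees add up although the coefficient ring is only a commutative ring.
\<close>

lemma orbit_poly_monic: "lead_coeff (orbit_poly x) = 1"
proof -
  have "finite A \<Longrightarrow> lead_coeff (\<Prod>w\<in>A. [:- single (dual_act w x) (1::complex), 1:]) = 1" for A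
  proof (induction A rule: finite_induct)
    case empty
    show ?case unfolding prod.empty by simp
  next
    case (insert w A)
    show ?case unfolding prod.insert[OF insert.hyps]
      by (rule lead_coeff_mult_monic[OF _ insert.IH]) simp
  qed
  then show ?thesis unfolding orbit_poly_def by simp
qed

lemma orbit_poly_root: "poly (orbit_poly x) (single x 1) = 0"
proof -
  have "(\<Prod>w\<in>W. poly [:- single (dual_act w x) 1, 1:] (single x (1::complex))) = 0"
    by (subst prod.remove[of _ id]) auto
  then show ?thesis unfolding orbit_poly_def poly_prod .
qed

lemma orbit_poly_coeff_CX: assumes "x \<in> X" shows "coeff (orbit_poly x) i \<in> CX"
proof -
  have "finite A \<Longrightarrow> A \<subseteq> W \<Longrightarrow> \<forall>i. coeff (\<Prod>w\<in>A. [:- single (dual_act w x) (1::complex), 1:]) i \<in> CX" for A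
  proof (induction A rule: finite_induct)
    case empty
    then show ?case by (simp add: coeff_1)
  next
    case (insert w A)
    have "\<forall>i. coeff [:- single (dual_act w x) (1::complex), 1:] i \<in> CX"
      using insert assms by (auto simp: coeff_pCons split: nat.splits intro!: CX_uminus)
    then show ?case using insert by (auto simp: coeff_mult simp del: mult_pCons_left intro!: CX_sum CX_mult)
  qed
  then show ?thesis unfolding orbit_poly_def by simp
qed

text \<open>
  Applying \<open>u\<close> to the coefficients permutes the linear factors.
\<close>

lemma orbit_poly_coeff_invariant: 
  assumes u: "u \<in> W" shows "twist u (coeff (orbit_poly x) i) = coeff (orbit_poly x) i"
proof -
  have tm: "map_poly (twist u) (p * q) = map_poly (twist u) p * map_poly (twist u) q" for p q
  proof (rule poly_eqI)
    fix i
    have "twist u (\<Sum>j\<in>J. coeff p j * coeff q (i - j)) = (\<Sum>j\<in>J. twist u (coeff p j) * twist u (coeff q (i - j)))" for J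
      by (induction J rule: infinite_finite_induct) (simp_all add: twist_add twist_mult u)
    then show "coeff (map_poly (twist u) (p * q)) i = coeff (map_poly (twist u) p * map_poly (twist u) q) i"
      by (simp add: coeff_map_poly coeff_mult)
  qed
  have "finite A \<Longrightarrow> A \<subseteq> W \<Longrightarrow> map_poly (twist u) (\<Prod>w\<in>A. [:- single (dual_act w x) 1, 1:]) =
      (\<Prod>w\<in>A. [:- single (dual_act (u \<circ> w) x) 1, 1:])" for A
  proof (induction A rule: finite_induct)
    case empty
    then show ?case by (simp add: twist_1 u)
  next
    case (insert w A)
    have "twist u (- single (dual_act w x) 1) = - single (dual_act (u \<circ> w) x) 1"
      using twist_single[of u "dual_act w x" "-1"] insert u by (simp add: dual_act_comp single_uminus)
    then have "map_poly (twist u) [:- single (dual_act w x) 1, 1:] = [:- single (dual_act (u \<circ> w) x) 1, 1:]"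
      by (simp add: map_poly_pCons twist_1 u)
    moreover have "map_poly (twist u) (\<Prod>w\<in>A. [:- single (dual_act w x) 1, 1:]) =
      (\<Prod>w\<in>A. [:- single (dual_act (u \<circ> w) x) 1, 1:])" using insert by blast
    ultimately show ?case by (simp only: prod.insert[OF insert.hyps] tm)
  qed
  then have "map_poly (twist u) (orbit_poly x) = (\<Prod>w\<in>W. [:- single (dual_act (u \<circ> w) x) 1, 1:])"
    unfolding orbit_poly_def by simp
  also have "\<dots> = orbit_poly x" unfolding orbit_poly_def
    by (rule prod.reindex_bij_witness[of _ "\<lambda>w. winv u \<circ> w" "\<lambda>w. u \<circ> w"]) (auto simp: u o_assoc)
  finally have "coeff (map_poly (twist u) (orbit_poly x)) i = coeff (orbit_poly x) i" by simp
  then show ?thesis by (simp add: coeff_map_poly)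
qed

text \<open>
  Replacing the coefficients of the orbit polynomial by their eigenvalues on \<open>m\<close> yields a complex polynomial in \<open>e\<^sup>x\<close>
  that kills \<open>m\<close>. It is nonzero because the leading coefficient is one.
\<close>

lemma monomial_algebraic:
  assumes x: "x \<in> X" and m: "m \<in> carrier M" "m \<noteq> \<zero>"
    and eig: "\<And>i. i \<le> degree (orbit_poly x) \<Longrightarrow> \<exists>z. emb (coeff (orbit_poly x) i) \<cdot> m = scal z \<cdot> m"
  shows "\<exists>p. p \<noteq> 0 \<and> emb (peval p (single x 1)) \<cdot> m = \<zero>"
proof -
  let ?P = "orbit_poly x" and ?e = "single x (1::complex)"
  let ?N = "degree ?P"
  obtain \<theta> where \<theta>: "\<And>i. i \<le> ?N \<Longrightarrow> emb (coeff ?P i) \<cdot> m = scal (\<theta> i) \<cdot> m" using eig by metis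
  define p where "p = (\<Sum>i\<le>?N. monom (\<theta> i) i)"
  have e: "?e ^ i \<in> CX" for i using x by (intro CX_power) simp
  have "\<theta> ?N \<noteq> 0"
  proof
    assume "\<theta> ?N = 0"
    then have "emb 1 \<cdot> m = \<zero>" using \<theta>[of ?N] orbit_poly_monic[of x] m by simp
    then show False using m by simp
  qed
  moreover have "coeff p ?N = \<theta> ?N" by (simp add: p_def coeff_sum)
  ultimately have "p \<noteq> 0" by auto
  have "emb (\<Sum>i\<in>I. single 0 (\<theta> i) * ?e ^ i) \<cdot> m = emb (\<Sum>i\<in>I. coeff ?P i * ?e ^ i) \<cdot> m"
    if "finite I" "I \<subseteq> {..?N}" for I
    using that
  proof (induction I rule: finite_induct)
    case (insert i I)
    have s: "(\<Sum>i\<in>I. single 0 (\<theta> i) * ?e ^ i) \<in> CX" "(\<Sum>i\<in>I. coeff ?P i * ?e ^ i) \<in> CX"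
      using e orbit_poly_coeff_CX[OF x] by (auto intro!: CX_sum CX_mult)
    have "emb (single 0 (\<theta> i) * ?e ^ i) \<cdot> m = emb (?e ^ i) \<cdot> (emb (single 0 (\<theta> i)) \<cdot> m)"
      using e m by (subst mult.commute, subst emb_act_mult) auto
    also have "\<dots> = emb (?e ^ i) \<cdot> (emb (coeff ?P i) \<cdot> m)" using \<theta>[of i] insert by (simp add: emb_const)
    also have "\<dots> = emb (coeff ?P i * ?e ^ i) \<cdot> m"
      using e m orbit_poly_coeff_CX[OF x] by (subst mult.commute, subst emb_act_mult) auto
    finally show ?case using insert s e m orbit_poly_coeff_CX[OF x] by (simp add: emb_act_add CX_mult)
  qed simp
  from this[of "{..?N}"] have "emb (peval p ?e) \<cdot> m = emb (poly ?P ?e) \<cdot> m"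
    by (simp add: p_def peval_sum peval_monom poly_altdef)
  also have "\<dots> = \<zero>" using m by (simp add: orbit_poly_root)
  finally show ?thesis using \<open>p \<noteq> 0\<close> by blast
qed

text \<open>
  The set of \<open>x\<close> for which \<open>v\<close> is an eigenvector of \<open>e\<^sup>x\<close> is a subgroup of \<open>X\<close>, so it suffices to reach a basis.
\<close>

theorem weight_vector_exists: "\<exists>\<mu>\<in>TT. \<exists>v\<in>weight_space \<mu>. v \<noteq> \<zero>"
proof -
  obtain B where B: "finite B" "B \<subseteq> X" "X = {\<Sum>b\<in>B. of_int (c b) *\<^sub>R b | c :: _ \<Rightarrow> int. True}"
    by (rule lattice_basis[OF lattice_X])
  obtain m where m: "m \<in> carrier M" "m \<noteq> \<zero>" using nontrivial M.zero_closed by blast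
  \<comment> \<open>the coefficients of all orbit polynomials of the basis\<close>
  let ?F = "\<Union>b\<in>B. (\<lambda>i. coeff (orbit_poly b) i) ` {..degree (orbit_poly b)}"
  have FCX: "?F \<subseteq> CX" using B(2) orbit_poly_coeff_CX by blast
  have "\<exists>b\<in>CX. emb b \<cdot> m \<noteq> \<zero> \<and> (\<forall>a\<in>?F. \<exists>z. emb a \<cdot> (emb b \<cdot> m) = scal z \<cdot> (emb b \<cdot> m))"
  proof (rule common_eigenvector_exists[OF _ FCX m])
    fix a assume "a \<in> ?F"
    then show "\<exists>p. p \<noteq> 0 \<and> emb (peval p a) \<cdot> m = \<zero>"
      using FCX m orbit_poly_coeff_invariant by (intro invariant_algebraic) auto
  qed (use B in auto)
  then obtain b where b: "b \<in> CX" "emb b \<cdot> m \<noteq> \<zero>"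
    "\<forall>a\<in>?F. \<exists>z. emb a \<cdot> (emb b \<cdot> m) = scal z \<cdot> (emb b \<cdot> m)" by blast
  define u where "u = emb b \<cdot> m"
  have u: "u \<in> carrier M" "u \<noteq> \<zero>" using b m by (auto simp: u_def)
  let ?E = "(\<lambda>x. single x (1::complex)) ` B"
  have ECX: "?E \<subseteq> CX" using B(2) by auto
  have "\<exists>b\<in>CX. emb b \<cdot> u \<noteq> \<zero> \<and> (\<forall>a\<in>?E. \<exists>z. emb a \<cdot> (emb b \<cdot> u) = scal z \<cdot> (emb b \<cdot> u))"
  proof (rule common_eigenvector_exists[OF _ ECX u])
    fix a assume "a \<in> ?E"
    then obtain x where x: "x \<in> B" "a = single x 1" by auto
    have "\<exists>z. emb (coeff (orbit_poly x) i) \<cdot> u = scal z \<cdot> u" if "i \<le> degree (orbit_poly x)" for i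
      using b(3) x that unfolding u_def by blast
    then show "\<exists>p. p \<noteq> 0 \<and> emb (peval p a) \<cdot> u = \<zero>"
      unfolding x(2) using x(1) B(2) u by (intro monomial_algebraic) auto
  qed (use B in auto)
  then obtain d where d: "d \<in> CX" "emb d \<cdot> u \<noteq> \<zero>"
    "\<forall>a\<in>?E. \<exists>z. emb a \<cdot> (emb d \<cdot> u) = scal z \<cdot> (emb d \<cdot> u)" by blast
  define v where "v = emb d \<cdot> u"
  have v: "v \<in> carrier M" "v \<noteq> \<zero>" using d u by (auto simp: v_def)
  let ?e = "\<lambda>x. monomial 1 x 0 id"
  have sc: "scal z \<cdot> v = scal z' \<cdot> v \<Longrightarrow> z = z'" for z z'
  proof -
    assume "scal z \<cdot> v = scal z' \<cdot> v"
    then have "scal (z - z') \<cdot> v = scal z' \<cdot> v \<oplus> scal (- z') \<cdot> v"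
      using scal_add[OF v(1), of z "- z'"] by simp
    also have "\<dots> = \<zero>" using scal_add[OF v(1), of z' "- z'"] v by simp
    finally show ?thesis using scal_eq_zero[OF v(1), of "z - z'"] v(2) by auto
  qed
  have ee: "?e x \<cdot> (?e y \<cdot> v) = ?e (x + y) \<cdot> v" if "x \<in> X" "y \<in> X" for x y
    using that v by (subst monomial_smult_monomial) (auto simp: blinfun.zero_right)
  have es: "?e x \<cdot> (scal z \<cdot> v) = scal z \<cdot> (?e x \<cdot> v)" if "x \<in> X" for x z
    using monomial_scal[of id x 0 v 1 z] scal_monomial[of id x 0 v z 1] that v by simp
  have "\<exists>z. ?e x \<cdot> v = scal z \<cdot> v" if "x \<in> X" for x
  proof (rule lattice_induct[OF lattice_X that B])
    show "\<exists>z. ?e b \<cdot> v = scal z \<cdot> v" if "b \<in> B" for b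
      using d(3) that unfolding v_def emb_single[symmetric] by blast
    show "\<exists>z. ?e 0 \<cdot> v = scal z \<cdot> v" by blast
    show "\<exists>z. ?e (x + y) \<cdot> v = scal z \<cdot> v"
      if xy: "x \<in> X" "y \<in> X" and ex: "\<exists>z. ?e x \<cdot> v = scal z \<cdot> v" and ey: "\<exists>z. ?e y \<cdot> v = scal z \<cdot> v" for x y
    proof -
      obtain z z' where z: "?e x \<cdot> v = scal z \<cdot> v" and z': "?e y \<cdot> v = scal z' \<cdot> v" using ex ey by blast
      have "?e (x + y) \<cdot> v = ?e x \<cdot> (scal z' \<cdot> v)" using ee[OF xy] z' by simp
      also have "\<dots> = scal z' \<cdot> (scal z \<cdot> v)" using es[OF xy(1)] z by simp
      also have "\<dots> = scal (z' * z) \<cdot> v" using v by (intro scal_scal) simp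
      finally show ?thesis by blast
    qed
    show "\<exists>z. ?e (- x) \<cdot> v = scal z \<cdot> v" if x: "x \<in> X" and ex: "\<exists>z. ?e x \<cdot> v = scal z \<cdot> v" for x
    proof -
      obtain z where z: "?e x \<cdot> v = scal z \<cdot> v" using ex by blast
      have mx: "- x \<in> X" using x by (rule X_group(3))
      have vv: "v = scal z \<cdot> (?e (- x) \<cdot> v)"
        using ee[OF mx x] z es[OF mx, of z] v by simp
      have "z \<noteq> 0"
      proof
        assume "z = 0"
        then have "v = \<zero>" using vv v mx by simp
        then show False using v by simp
      qed
      have "?e (- x) \<cdot> v = scal (inverse z) \<cdot> (scal z \<cdot> (?e (- x) \<cdot> v))"
        using v mx \<open>z \<noteq> 0\<close> by (subst scal_scal) auto
      also have "\<dots> = scal (inverse z) \<cdot> v" using vv by simp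
      finally show ?thesis by blast
    qed
  qed
  then obtain \<kappa> where \<kappa>: "\<And>x. x \<in> X \<Longrightarrow> ?e x \<cdot> v = scal (\<kappa> x) \<cdot> v" by metis
  have mult: "\<kappa> (x + y) = \<kappa> x * \<kappa> y" if "x \<in> X" "y \<in> X" for x y
  proof (rule sc)
    have "scal (\<kappa> (x + y)) \<cdot> v = ?e x \<cdot> (scal (\<kappa> y) \<cdot> v)"
      using ee[OF that] \<kappa>[of "x + y"] \<kappa>[of y] that by simp
    also have "\<dots> = scal (\<kappa> y) \<cdot> (scal (\<kappa> x) \<cdot> v)" using es[OF that(1)] \<kappa>[of x] that by simp
    also have "\<dots> = scal (\<kappa> x * \<kappa> y) \<cdot> v" using v by (simp add: mult.commute)
    finally show "scal (\<kappa> (x + y)) \<cdot> v = scal (\<kappa> x * \<kappa> y) \<cdot> v" .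
  qed
  have "\<kappa> 0 = 1" using \<kappa>[of 0] by (intro sc) simp
  have nz: "\<kappa> x \<noteq> 0" if "x \<in> X" for x
    using mult[OF that X_group(3)[OF that]] \<open>\<kappa> 0 = 1\<close> by auto
  have "restrict \<kappa> X \<in> TT" by (rule torusI) (auto simp: mult nz)
  moreover have "v \<in> weight_space (restrict \<kappa> X)" using \<kappa> v by (simp add: weight_space_def)
  ultimately show ?thesis using v by blast
qed

end

section \<open>The weight space as a module over the isotropy group\<close>

text \<open>
  Used to see that a group algebra is a ring: it embeds in the algebra that acts on \<open>M\<close>.
\<close>

lemma ring_pullback:
  assumes S: "ring S" and inj: "inj_on f (carrier R)" and f: "\<And>a. a \<in> carrier R \<Longrightarrow> f a \<in> carrier S"
    and add_closed: "\<And>a b. a \<in> carrier R \<Longrightarrow> b \<in> carrier R \<Longrightarrow> a \<oplus>\<^bsub>R\<^esub> b \<in> carrier R"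
    and mult_closed: "\<And>a b. a \<in> carrier R \<Longrightarrow> b \<in> carrier R \<Longrightarrow> a \<otimes>\<^bsub>R\<^esub> b \<in> carrier R"
    and zero_closed: "\<zero>\<^bsub>R\<^esub> \<in> carrier R" and one_closed: "\<one>\<^bsub>R\<^esub> \<in> carrier R"
    and neg: "\<And>a. a \<in> carrier R \<Longrightarrow> \<exists>b\<in>carrier R. b \<oplus>\<^bsub>R\<^esub> a = \<zero>\<^bsub>R\<^esub>"
    and add: "\<And>a b. a \<in> carrier R \<Longrightarrow> b \<in> carrier R \<Longrightarrow> f (a \<oplus>\<^bsub>R\<^esub> b) = f a \<oplus>\<^bsub>S\<^esub> f b"
    and mult: "\<And>a b. a \<in> carrier R \<Longrightarrow> b \<in> carrier R \<Longrightarrow> f (a \<otimes>\<^bsub>R\<^esub> b) = f a \<otimes>\<^bsub>S\<^esub> f b"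
    and zero: "f \<zero>\<^bsub>R\<^esub> = \<zero>\<^bsub>S\<^esub>" and one: "f \<one>\<^bsub>R\<^esub> = \<one>\<^bsub>S\<^esub>"
  shows "ring R"
proof -
  interpret S: ring S by fact
  note closed = add_closed mult_closed zero_closed one_closed
  note hom = add mult zero one
  have eqI: "a = b" if "a \<in> carrier R" "b \<in> carrier R" "f a = f b" for a b
    using inj that by (meson inj_onD)
  show ?thesis
  proof (rule ringI)
    show "abelian_group R"
    proof (rule abelian_groupI)
      show "\<And>x y z. \<lbrakk>x \<in> carrier R; y \<in> carrier R; z \<in> carrier R\<rbrakk> \<Longrightarrow> x \<oplus>\<^bsub>R\<^esub> y \<oplus>\<^bsub>R\<^esub> z = x \<oplus>\<^bsub>R\<^esub> (y \<oplus>\<^bsub>R\<^esub> z)"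
        by (rule eqI) (simp_all add: closed hom f S.a_assoc)
      show "\<And>x y. \<lbrakk>x \<in> carrier R; y \<in> carrier R\<rbrakk> \<Longrightarrow> x \<oplus>\<^bsub>R\<^esub> y = y \<oplus>\<^bsub>R\<^esub> x"
        by (rule eqI) (simp_all add: closed hom f S.a_comm)
      show "\<And>x. x \<in> carrier R \<Longrightarrow> \<zero>\<^bsub>R\<^esub> \<oplus>\<^bsub>R\<^esub> x = x"
        by (rule eqI) (simp_all add: closed hom f)
    qed (use closed neg in auto)
    show "Group.monoid R"
    proof (rule monoidI)
      show "\<And>x y z. \<lbrakk>x \<in> carrier R; y \<in> carrier R; z \<in> carrier R\<rbrakk> \<Longrightarrow> x \<otimes>\<^bsub>R\<^esub> y \<otimes>\<^bsub>R\<^esub> z = x \<otimes>\<^bsub>R\<^esub> (y \<otimes>\<^bsub>R\<^esub> z)"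
        by (rule eqI) (simp_all add: closed hom f S.m_assoc)
      show "\<And>x. x \<in> carrier R \<Longrightarrow> \<one>\<^bsub>R\<^esub> \<otimes>\<^bsub>R\<^esub> x = x"
        by (rule eqI) (simp_all add: closed hom f)
      show "\<And>x. x \<in> carrier R \<Longrightarrow> x \<otimes>\<^bsub>R\<^esub> \<one>\<^bsub>R\<^esub> = x"
        by (rule eqI) (simp_all add: closed hom f)
    qed (use closed in auto)
    show "\<And>x y z. \<lbrakk>x \<in> carrier R; y \<in> carrier R; z \<in> carrier R\<rbrakk> \<Longrightarrow> (x \<oplus>\<^bsub>R\<^esub> y) \<otimes>\<^bsub>R\<^esub> z = x \<otimes>\<^bsub>R\<^esub> z \<oplus>\<^bsub>R\<^esub> y \<otimes>\<^bsub>R\<^esub> z"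
      by (rule eqI) (simp_all add: closed hom f S.l_distr)
    show "\<And>x y z. \<lbrakk>x \<in> carrier R; y \<in> carrier R; z \<in> carrier R\<rbrakk> \<Longrightarrow> z \<otimes>\<^bsub>R\<^esub> (x \<oplus>\<^bsub>R\<^esub> y) = z \<otimes>\<^bsub>R\<^esub> x \<oplus>\<^bsub>R\<^esub> z \<otimes>\<^bsub>R\<^esub> y"
      by (rule eqI) (simp_all add: closed hom f S.r_distr)
  qed
qed

lemma complex_ring_simps [simp]: "carrier complex_ring = UNIV" "\<zero>\<^bsub>complex_ring\<^esub> = 0"
  "\<one>\<^bsub>complex_ring\<^esub> = 1" "(\<oplus>\<^bsub>complex_ring\<^esub>) = (+)" "(\<otimes>\<^bsub>complex_ring\<^esub>) = (*)"
  by (simp_all add: complex_ring_def)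

lemma complex_ring_finsum: assumes "finite I" shows "finsum complex_ring f I = sum f I"
proof -
  interpret C: abelian_monoid complex_ring
    by (rule abelian_monoidI) (auto simp: add_ac)
  show ?thesis using assms by (induction I rule: finite_induct) auto
qed

lemma group_algebra_simps:
  "carrier (group_algebra G) = {F. \<forall>w. w \<notin> G \<longrightarrow> F w = 0}"
  "\<zero>\<^bsub>group_algebra G\<^esub> = (\<lambda>_. 0)" "(\<oplus>\<^bsub>group_algebra G\<^esub>) = (\<lambda>F F' u. F u + F' u)"
  "\<one>\<^bsub>group_algebra G\<^esub> = tga_elem complex_ring 1 id"
  "finite G \<Longrightarrow> (F \<otimes>\<^bsub>group_algebra G\<^esub> F') u = (\<Sum>w\<in>G. F w * F' (winv w \<circ> u))"
  by (simp_all add: group_algebra_def twisted_group_algebra_def complex_ring_finsum tga_elem_def fun_eq_iff)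

context torus_data
begin

text \<open>
  The unique \<open>y\<close> with \<open>\<nu> = l q\<^sup>y\<close>, for \<open>\<nu>\<close> in the class of \<open>l\<close>.
\<close>

definition rel_shift :: "'h torus_elem \<Rightarrow> 'h torus_elem \<Rightarrow> 'h" where
  "rel_shift l \<nu> = (THE y. y \<in> Y \<and> \<nu> = shift l y)"

lemma rel_shift_eq: "l \<in> TT \<Longrightarrow> y \<in> Y \<Longrightarrow> rel_shift l (shift l y) = y"
  unfolding rel_shift_def by (rule the_equality) (use shift_inj in auto)

lemma class_subset: "l \<in> TT \<Longrightarrow> \<nu> \<in> torus_class X Y n r l \<Longrightarrow> \<nu> \<in> TT"
  by (auto simp: torus_class_eq)

lemma rel_shift_closed: "l \<in> TT \<Longrightarrow> \<nu> \<in> torus_class X Y n r l \<Longrightarrow> rel_shift l \<nu> \<in> Y"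
  by (auto simp: torus_class_eq rel_shift_eq)

lemma shift_rel_shift: "l \<in> TT \<Longrightarrow> \<nu> \<in> torus_class X Y n r l \<Longrightarrow> shift l (rel_shift l \<nu>) = \<nu>"
  by (auto simp: torus_class_eq rel_shift_eq)

lemma class_self: "l \<in> TT \<Longrightarrow> l \<in> torus_class X Y n r l"
  unfolding torus_class_eq by (rule image_eqI[of _ _ 0]) auto

lemma class_shift: "l \<in> TT \<Longrightarrow> \<nu> \<in> torus_class X Y n r l \<Longrightarrow> y \<in> Y \<Longrightarrow> shift \<nu> y \<in> torus_class X Y n r l"
  by (auto simp: torus_class_eq shift_shift)

text \<open>
  An element of \<open>W\<close> maps classes onto classes because it stabilises \<open>Y\<close>, so one common point is enough.
\<close>

lemma isotropyI:
  assumes l: "l \<in> TT" and w: "w \<in> W" and \<mu>: "\<mu> \<in> torus_class X Y n r l"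
    and w\<mu>: "torus_act X w \<mu> \<in> torus_class X Y n r l"
  shows "w \<in> isotropy_group \<Delta> X Y n r l"
proof -
  obtain y where y: "y \<in> Y" "\<mu> = shift l y" using \<mu> l by (auto simp: torus_class_eq)
  obtain z where z: "z \<in> Y" "torus_act X w \<mu> = shift l z" using w\<mu> l by (auto simp: torus_class_eq)
  have sub: "u + - v \<in> Y" if "u \<in> Y" "v \<in> Y" for u v using that by (intro Y_group)
  have \<mu>T: "\<mu> \<in> TT" using y l by simp
  have a: "torus_act X w (shift l y') = shift l (z + w (y' + - y))" if "y' \<in> Y" for y'
  proof -
    have "shift l y' = shift \<mu> (y' + - y)" unfolding y(2) using l y(1) that sub
      by (subst shift_shift) auto
    then show ?thesis using \<mu>T w that y(1) sub[OF that y(1)] z l by (simp add: torus_act_shift shift_shift)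
  qed
  have "torus_act X w ` shift l ` Y = shift l ` Y"
  proof (intro subset_antisym subsetI)
    fix \<nu> assume "\<nu> \<in> torus_act X w ` shift l ` Y"
    then obtain y' where "y' \<in> Y" "\<nu> = torus_act X w (shift l y')" by auto
    then show "\<nu> \<in> shift l ` Y" using a z(1) w sub y(1) by auto
  next
    fix \<nu> assume "\<nu> \<in> shift l ` Y"
    then obtain y' where y': "y' \<in> Y" "\<nu> = shift l y'" by auto
    \<comment> \<open>chosen so that \<open>z + w (?y - y) = y'\<close>\<close>
    let ?y = "winv w (y' + - z) + y"
    have yY: "?y \<in> Y" using w y' z y sub by simp
    have "w (?y + - y) = y' + - z" using W_winv_apply(2)[OF w] by simp
    then have "torus_act X w (shift l ?y) = \<nu>" using a[OF yY] y' by simp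
    then show "\<nu> \<in> torus_act X w ` shift l ` Y" using yY by blast
  qed
  then show ?thesis using w l by (simp add: isotropy_group_def torus_class_eq)
qed

lemma isotropy_act: "w \<in> isotropy_group \<Delta> X Y n r l \<Longrightarrow> \<mu> \<in> torus_class X Y n r l \<Longrightarrow>
   torus_act X w \<mu> \<in> torus_class X Y n r l"
  unfolding isotropy_group_def by blast

lemma isotropy_subset: "isotropy_group \<Delta> X Y n r l \<subseteq> W"
  unfolding isotropy_group_def by blast

end

locale weight_module = module_data \<Delta> X Y n r M
  for \<Delta> :: "'h::euclidean_space set" and X Y n r
    and M :: "(('h \<Rightarrow> 'h) \<Rightarrow> 'h qtorus_elem, 'm) module" (structure) +
  fixes l :: "'h torus_elem"
  assumes simple: "simple_module (qtorus_tga X Y n r (weyl_group \<Delta>)) M"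
    and l [simp]: "l \<in> carrier (torus X)"
    and weight_space_l: "weight_space l \<noteq> {\<zero>}"
begin

abbreviation C where "C \<equiv> torus_class X Y n r l"
abbreviation G where "G \<equiv> isotropy_group \<Delta> X Y n r l"
abbreviation offset where "offset \<equiv> rel_shift l"
abbreviation CG where "CG \<equiv> group_algebra G"

lemma G_W [simp]: "w \<in> G \<Longrightarrow> w \<in> W" using isotropy_subset by blast

lemma G_finite [simp]: "finite G" using finite_subset[OF isotropy_subset W_finite] .

lemmas C_T [simp] = class_subset[OF l]
lemmas offset_Y [simp] = rel_shift_closed[OF l]
lemmas shift_offset [simp] = shift_rel_shift[OF l]
lemmas offset_shift [simp] = rel_shift_eq[OF l]
lemmas l_C [simp] = class_self[OF l]
lemmas C_shift [simp] = class_shift[OF l]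
lemmas isotropy_memI = isotropyI[OF l]
lemmas G_C [simp] = isotropy_act

lemma G_id [simp]: "id \<in> G" by (rule isotropy_memI[of _ l]) auto

lemma G_comp [simp]: "w \<in> G \<Longrightarrow> u \<in> G \<Longrightarrow> w \<circ> u \<in> G"
  by (rule isotropy_memI[of _ l]) (auto simp: torus_act_comp)

lemma G_inv [simp]: "w \<in> G \<Longrightarrow> winv w \<in> G"
  by (rule isotropy_memI[of _ "torus_act X w l"]) auto

text \<open>
  The defect \<open>y\<close> in \<open>w l = l q\<^sup>y\<close>; \<open>cocycle_comp\<close> is the cocycle identity.
\<close>

abbreviation cocycle where "cocycle w \<equiv> offset (torus_act X w l)"

lemma offset_act: assumes "w \<in> G" "\<mu> \<in> C" shows "offset (torus_act X w \<mu>) = cocycle w + w (offset \<mu>)"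
proof -
  have "torus_act X w \<mu> = torus_act X w (shift l (offset \<mu>))" using assms by simp
  also have "\<dots> = shift (torus_act X w l) (w (offset \<mu>))" using assms by (subst torus_act_shift) auto
  also have "\<dots> = shift (shift l (cocycle w)) (w (offset \<mu>))" using assms by simp
  also have "\<dots> = shift l (cocycle w + w (offset \<mu>))" by (rule shift_shift) (use assms in auto)
  finally show ?thesis using assms by simp
qed

lemma cocycle_comp: "w \<in> G \<Longrightarrow> u \<in> G \<Longrightarrow> cocycle (w \<circ> u) = cocycle w + w (cocycle u)"
  using offset_act[of w "torus_act X u l"] by (simp add: torus_act_comp)

lemma offset_l [simp]: "offset l = 0"
  using offset_shift[of 0] by simp

text \<open>
  The embedding \<open>w \<mapsto> e\<^sup>-\<^sup>y w\<close> of the group algebra of \<open>G\<close>, where \<open>y\<close> is the value of the cocycle at \<open>w\<close>. The image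
  preserves the weight space of \<open>l\<close>.
\<close>

definition untwist :: "(('h \<Rightarrow> 'h) \<Rightarrow> complex) \<Rightarrow> ('h \<Rightarrow> 'h) \<Rightarrow> 'h qtorus_elem" where
  "untwist F = (\<lambda>u. if u \<in> G then single (0, - cocycle u) (F u) else 0)"

lemma untwist_apply_closed: "untwist F u \<in> carrier K"
  by (cases "u \<in> G") (simp_all add: untwist_def K_single_closed)

lemma untwist_closed [simp]: "untwist F \<in> carrier HW"
  using untwist_apply_closed isotropy_subset by (auto simp: HG_simps untwist_def)

lemma untwist_zero: "untwist \<zero>\<^bsub>CG\<^esub> = \<zero>\<^bsub>HW\<^esub>"
  by (rule ext) (simp add: untwist_def group_algebra_simps HG_simps)

lemma untwist_add: "untwist (F \<oplus>\<^bsub>CG\<^esub> F') = untwist F \<oplus>\<^bsub>HW\<^esub> untwist F'"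
  by (auto simp: untwist_def group_algebra_simps HG_simps single_add)

lemma untwist_elem: "w \<in> G \<Longrightarrow> untwist (tga_elem complex_ring c w) = monomial c 0 (- cocycle w) w"
  by (rule ext) (simp add: untwist_def tga_elem_def monomial_def)

lemma untwist_one: "untwist \<one>\<^bsub>CG\<^esub> = \<one>\<^bsub>HW\<^esub>"
  by (simp add: group_algebra_simps(4) untwist_elem one_eq_monomial)

text \<open>
  The exponents agree by the cocycle identity, and no power of \<open>q\<close> appears because only elements of \<open>Y\<close> are multiplied.
\<close>

lemma untwist_mult:
  assumes F': "F' \<in> carrier CG"
  shows "untwist (F \<otimes>\<^bsub>CG\<^esub> F') = untwist F \<otimes>\<^bsub>HW\<^esub> untwist F'"
proof
  fix u
  have "(untwist F \<otimes>\<^bsub>HW\<^esub> untwist F') u = (\<Sum>w\<in>W. untwist F w \<otimes>\<^bsub>K\<^esub> qtorus_act w (untwist F' (winv w \<circ> u)))"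
    by (rule HG_mult_apply) (simp_all add: untwist_apply_closed)
  also have "\<dots> = (\<Sum>w\<in>G. untwist F w \<otimes>\<^bsub>K\<^esub> qtorus_act w (untwist F' (winv w \<circ> u)))"
    by (rule sum.mono_neutral_right) (auto simp: untwist_def)
  also have "\<dots> = untwist (F \<otimes>\<^bsub>CG\<^esub> F') u"
  proof (cases "u \<in> G")
    case True
    have "untwist F w \<otimes>\<^bsub>K\<^esub> qtorus_act w (untwist F' (winv w \<circ> u)) = single (0, - cocycle u) (F w * F' (winv w \<circ> u))"
      if "w \<in> G" for w
    proof -
      have g: "winv w \<circ> u \<in> G" using that True by simp
      have "w \<circ> (winv w \<circ> u) = u" using that by (simp add: o_assoc)
      then have "cocycle u = cocycle w + w (cocycle (winv w \<circ> u))" using cocycle_comp[OF that g] by simp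
      then have "- cocycle u = - cocycle w + w (- cocycle (winv w \<circ> u))" using that by (simp add: W_minus)
      then show ?thesis using that g
        by (simp add: untwist_def qtorus_act_single K_mult_single blinfun.zero_left)
    qed
    then have "(\<Sum>w\<in>G. untwist F w \<otimes>\<^bsub>K\<^esub> qtorus_act w (untwist F' (winv w \<circ> u))) =
       (\<Sum>w\<in>G. single (0, - cocycle u) (F w * F' (winv w \<circ> u)))" by simp
    also have "\<dots> = single (0, - cocycle u) (\<Sum>w\<in>G. F w * F' (winv w \<circ> u))"
      by (rule poly_mapping_eqI) (simp add: lookup_sum lookup_single when_def)
    finally show ?thesis using True by (simp add: untwist_def group_algebra_simps)
  next
    case False
    have "winv w \<circ> u \<notin> G" if w: "w \<in> G" for w
    proof
      assume "winv w \<circ> u \<in> G"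
      then have "w \<circ> (winv w \<circ> u) \<in> G" using w by (rule_tac G_comp)
      moreover have "w \<circ> (winv w \<circ> u) = u" using w by (simp add: o_assoc)
      ultimately show False using False by simp
    qed
    then show ?thesis using False by (auto simp: untwist_def intro: sum.neutral)
  qed
  finally show "untwist (F \<otimes>\<^bsub>CG\<^esub> F') u = (untwist F \<otimes>\<^bsub>HW\<^esub> untwist F') u" by simp
qed

lemma untwist_inj: "inj_on untwist (carrier CG)"
proof (rule inj_onI)
  fix F F' assume F: "F \<in> carrier CG" "F' \<in> carrier CG" and eq: "untwist F = untwist F'"
  show "F = F'"
  proof
    fix u
    show "F u = F' u"
    proof (cases "u \<in> G")
      case True
      have "lookup (untwist F u) (0, - cocycle u) = lookup (untwist F' u) (0, - cocycle u)" using eq by simp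
      then show ?thesis using True by (simp add: untwist_def)
    next
      case False
      then show ?thesis using F by (simp add: group_algebra_simps)
    qed
  qed
qed

lemma CG_mult_closed: 
  assumes "F \<in> carrier CG" "F' \<in> carrier CG" shows "F \<otimes>\<^bsub>CG\<^esub> F' \<in> carrier CG"
proof -
  have "(F \<otimes>\<^bsub>CG\<^esub> F') u = 0" if u: "u \<notin> G" for u
  proof -
    have "winv w \<circ> u \<notin> G" if w: "w \<in> G" for w
    proof
      assume "winv w \<circ> u \<in> G"
      then have "w \<circ> (winv w \<circ> u) \<in> G" using w by (rule_tac G_comp)
      moreover have "w \<circ> (winv w \<circ> u) = u" using w by (simp add: o_assoc)
      ultimately show False using u by simp
    qed
    then show ?thesis using assms by (auto simp: group_algebra_simps intro: sum.neutral)
  qed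
  then show ?thesis by (simp add: group_algebra_simps(1))
qed

lemma tga_CG [simp]: "w \<in> G \<Longrightarrow> tga_elem complex_ring c w \<in> carrier CG"
  by (auto simp: group_algebra_simps tga_elem_def)

lemma ring_CG: "ring CG"
proof (rule ring_pullback[OF R.ring_axioms untwist_inj])
  fix F assume "F \<in> carrier CG"
  then show "\<exists>F'\<in>carrier CG. F' \<oplus>\<^bsub>CG\<^esub> F = \<zero>\<^bsub>CG\<^esub>"
    by (intro bexI[of _ "\<lambda>u. - F u"]) (auto simp: group_algebra_simps)
qed (simp_all only: untwist_closed untwist_zero untwist_add untwist_one untwist_mult CG_mult_closed,
    simp_all add: group_algebra_simps tga_elem_def)

lemma CG_induct [consumes 1, case_names zero add]:
  assumes F: "F \<in> carrier CG" and zero: "P \<zero>\<^bsub>CG\<^esub>"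
    and add: "\<And>c w F. w \<in> G \<Longrightarrow> F \<in> carrier CG \<Longrightarrow> P F \<Longrightarrow> P (tga_elem complex_ring c w \<oplus>\<^bsub>CG\<^esub> F)"
  shows "P F"
proof -
  have "finite A \<Longrightarrow> A \<subseteq> G \<Longrightarrow> P (\<lambda>u. if u \<in> A then F u else 0)" for A
  proof (induction A rule: finite_induct)
    case empty
    then show ?case using zero by (simp add: group_algebra_simps)
  next
    case (insert w A)
    have eq: "(\<lambda>u. if u \<in> insert w A then F u else 0) = tga_elem complex_ring (F w) w \<oplus>\<^bsub>CG\<^esub> (\<lambda>u. if u \<in> A then F u else 0)"
      using insert by (auto simp: group_algebra_simps tga_elem_def)
    show ?case unfolding eq using insert by (intro add) (auto simp: group_algebra_simps)
  qed
  from this[OF G_finite subset_refl] have "P (\<lambda>u. if u \<in> G then F u else 0)" .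
  moreover have "(\<lambda>u. if u \<in> G then F u else 0) = F" using F by (auto simp: group_algebra_simps)
  ultimately show ?thesis by simp
qed

lemma twisted_weight_space:
  assumes "w \<in> G" "m \<in> weight_space l" shows "monomial c 0 (- cocycle w) w \<cdot> m \<in> weight_space l"
proof -
  have "shift (torus_act X w l) (- cocycle w) = shift (shift l (cocycle w)) (- cocycle w)" using assms by simp
  also have "\<dots> = l" using assms by (subst shift_shift) auto
  finally show ?thesis using monomial_weight_space(1)[OF assms(2) l, of w 0 "- cocycle w" c] assms by simp
qed

lemma untwist_weight_space: "F \<in> carrier CG \<Longrightarrow> m \<in> weight_space l \<Longrightarrow> untwist F \<cdot> m \<in> weight_space l"
proof (induction F rule: CG_induct)
  case zero
  then show ?case by (simp add: untwist_zero weight_space_carrier)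
next
  case (add c w F)
  have "untwist (tga_elem complex_ring c w \<oplus>\<^bsub>CG\<^esub> F) \<cdot> m = monomial c 0 (- cocycle w) w \<cdot> m \<oplus> untwist F \<cdot> m"
    using add weight_space_carrier by (simp add: untwist_add untwist_elem smult_l_distr)
  then show ?case using add twisted_weight_space weight_space_add by simp
qed

text \<open>
  The \<open>\<H>[W]\<close>-submodule generated by \<open>N\<close>, presented by sums of monomials applied to elements of \<open>N\<close>: for \<open>N\<close> inside
  a weight space every summand is a weight vector.
\<close>

inductive_set generated :: "'m set \<Rightarrow> 'm set" for N where
  generated_zero: "\<zero> \<in> generated N"
| generated_step: "x \<in> X \<Longrightarrow> y \<in> Y \<Longrightarrow> w \<in> W \<Longrightarrow> m \<in> N \<Longrightarrow> d \<in> generated N \<Longrightarrow> monomial c x y w \<cdot> m \<oplus> d \<in> generated N"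

lemma generated_carrier: "d \<in> generated N \<Longrightarrow> N \<subseteq> carrier M \<Longrightarrow> d \<in> carrier M"
  by (induction rule: generated.induct) auto

lemma generated_add: "d \<in> generated N \<Longrightarrow> N \<subseteq> carrier M \<Longrightarrow> d' \<in> generated N \<Longrightarrow> d \<oplus> d' \<in> generated N"
proof (induction rule: generated.induct)
  case generated_zero
  then show ?case using generated_carrier by simp
next
  case (generated_step x y w m d c)
  have "(monomial c x y w \<cdot> m \<oplus> d) \<oplus> d' = monomial c x y w \<cdot> m \<oplus> (d \<oplus> d')"
    using generated_step generated_carrier by (intro M.a_assoc) auto
  then show ?case using generated_step by (auto intro: generated.generated_step)
qed

lemma generated_monomial: "d \<in> generated N \<Longrightarrow> N \<subseteq> carrier M \<Longrightarrow> x \<in> X \<Longrightarrow> y \<in> Y \<Longrightarrow> w \<in> W \<Longrightarrow> monomial c x y w \<cdot> d \<in> generated N"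
proof (induction rule: generated.induct)
  case generated_zero
  then show ?case by (simp add: generated.generated_zero)
next
  case (generated_step x' y' w' m d c')
  have m: "m \<in> carrier M" and d: "d \<in> carrier M" using generated_step generated_carrier by auto
  have "monomial c x y w \<cdot> (monomial c' x' y' w' \<cdot> m \<oplus> d) = monomial c x y w \<cdot> (monomial c' x' y' w' \<cdot> m) \<oplus> monomial c x y w \<cdot> d"
    using generated_step m d by (intro smult_r_distr) auto
  also have "\<dots> \<in> generated N"
    using generated_step m by (subst monomial_smult_monomial) (auto intro!: generated.generated_step)
  finally show ?case .
qed

lemma generated_smult: 
  assumes "d \<in> generated N" "N \<subseteq> carrier M" "F \<in> carrier HW" shows "F \<cdot> d \<in> generated N"
  using subset_refl assms(3)
proof (induction F rule: HG_induct)
  case zero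
  then show ?case using assms generated_carrier by (simp add: generated.generated_zero)
next
  case (add c x y w F)
  have "(monomial c x y w \<oplus>\<^bsub>HW\<^esub> F) \<cdot> d = monomial c x y w \<cdot> d \<oplus> F \<cdot> d"
    using add assms generated_carrier by (intro smult_l_distr) auto
  then show ?case using generated_add[OF generated_monomial assms(2)] add assms by simp
qed

lemma generated_submodule: assumes "N \<subseteq> carrier M" shows "submodule (generated N) HW M"
proof (rule submodule.intro)
  show "submodule_axioms (generated N) HW M"
    by (rule submodule_axioms.intro) (use generated_smult assms in auto)
  have inv: "\<ominus> d \<in> generated N" if d: "d \<in> generated N" for d
  proof -
    have "scal (-1) \<cdot> d \<in> generated N" using generated_monomial[OF d assms] by simp
    then show ?thesis using scal_minus[of d] generated_carrier[OF d assms] by simp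
  qed
  show "subgroup (generated N) (add_monoid M)"
  proof (rule group.subgroupI[OF M.a_group])
    show "generated N \<subseteq> carrier (add_monoid M)" using generated_carrier assms by auto
    show "generated N \<noteq> {}" using generated.generated_zero[of N] by (metis empty_iff)
    show "\<And>a. a \<in> generated N \<Longrightarrow> inv\<^bsub>add_monoid M\<^esub> a \<in> generated N" using inv by (simp add: a_inv_def)
    show "\<And>a b. a \<in> generated N \<Longrightarrow> b \<in> generated N \<Longrightarrow> a \<otimes>\<^bsub>add_monoid M\<^esub> b \<in> generated N" using generated_add assms by simp
  qed
qed

text \<open>
  The submodule generated by a nonzero \<open>N\<close> is all of \<open>M\<close>. So an element of the weight space of \<open>l\<close> is a sum of
  weight vectors obtained from \<open>N\<close> by monomials, and an element of the algebra that acts as one on weight \<open>l\<close> and as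
  zero on the other weights of the sum selects the summands of weight \<open>l\<close>. These monomials have \<open>w\<close> in \<open>G\<close> and
  \<open>y = - cocycle w\<close>, up to a scalar, so they preserve \<open>N\<close>.
\<close>

theorem weight_space_simple:
  assumes N: "N \<subseteq> weight_space l" and zero: "\<zero> \<in> N"
    and add: "\<And>m m'. m \<in> N \<Longrightarrow> m' \<in> N \<Longrightarrow> m \<oplus> m' \<in> N"
    and twisted: "\<And>w m c. w \<in> G \<Longrightarrow> m \<in> N \<Longrightarrow> monomial c 0 (- cocycle w) w \<cdot> m \<in> N"
  shows "N = {\<zero>} \<or> N = weight_space l"
proof (cases "N = {\<zero>}")
  case False
  have NM: "N \<subseteq> carrier M" using N weight_space_carrier by auto
  have Ngen: "m \<in> generated N" if "m \<in> N" for m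
    using generated.generated_step[of 0 0 id m N "\<zero>" 1] that NM generated.generated_zero by auto
  then have "generated N \<noteq> {\<zero>}" using False zero by blast
  then have all: "generated N = carrier M"
    using simple generated_submodule[OF NM] unfolding simple_module_def by blast
  \<comment> \<open>\<open>a\<close> acts as a projection to weight \<open>l\<close> on sums of vectors of weights in \<open>P\<close> and \<open>l\<close>\<close>
  define separates where "separates P a \<longleftrightarrow> a \<in> carrier HW \<and> (\<forall>m\<in>weight_space l. a \<cdot> m = m) \<and>
       (\<forall>\<mu>\<in>P. \<forall>m\<in>weight_space \<mu>. a \<cdot> m = \<zero>)" for P a
  have proj: "\<exists>P. finite P \<and> P \<subseteq> TT \<and> l \<notin> P \<and> (\<forall>a. separates P a \<longrightarrow> a \<cdot> d \<in> N)" if "d \<in> generated N" for d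
    using that
  proof (induction rule: generated.induct)
    case generated_zero
    show ?case by (rule exI[of _ "{}"]) (use zero in \<open>auto simp: separates_def\<close>)
  next
    case (generated_step x y w m d c)
    from generated_step.IH obtain P where P: "finite P" "P \<subseteq> TT" "l \<notin> P"
      "\<forall>a. separates P a \<longrightarrow> a \<cdot> d \<in> N" by (elim exE conjE)
    let ?\<nu> = "shift (torus_act X w l) y" and ?m = "monomial c x y w \<cdot> m"
    have m: "m \<in> weight_space l" using generated_step N by auto
    have \<nu>T: "?\<nu> \<in> TT" using generated_step by simp
    have mw: "?m \<in> weight_space ?\<nu>" by (rule monomial_weight_space(1)[OF m l]) (use generated_step in auto)
    have atom: "?m \<in> N" if eq: "?\<nu> = l"
    proof -
      have "torus_act X w l = shift l (- y)"
      proof -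
        have "shift ?\<nu> (- y) = torus_act X w l" using generated_step by (subst shift_shift) auto
        then show ?thesis using eq by simp
      qed
      then have "w \<in> G" "cocycle w = - y" using generated_step by (auto intro!: isotropy_memI[of _ l])
      then have "monomial (c * ?\<nu> x) 0 y w \<cdot> m \<in> N" using twisted[of w m "c * ?\<nu> x"] generated_step by simp
      then show ?thesis using monomial_weight_space(2)[OF m l, of w x y c] generated_step by simp
    qed
    show ?case
    proof (rule exI[of _ "P \<union> ({?\<nu>} - {l})"], intro conjI allI impI)
      fix a assume "separates (P \<union> ({?\<nu>} - {l})) a"
      then have a: "a \<in> carrier HW" "\<forall>m\<in>weight_space l. a \<cdot> m = m"
        "\<forall>\<mu>\<in>P \<union> ({?\<nu>} - {l}). \<forall>m\<in>weight_space \<mu>. a \<cdot> m = \<zero>" by (auto simp: separates_def)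
      have "a \<cdot> (?m \<oplus> d) = a \<cdot> ?m \<oplus> a \<cdot> d"
        by (rule smult_r_distr) (use a generated_step generated_carrier[OF _ NM] m weight_space_carrier in auto)
      moreover have "a \<cdot> d \<in> N" using P(4) a by (auto simp: separates_def)
      moreover have "a \<cdot> ?m \<in> N"
      proof (cases "?\<nu> = l")
        case True
        then show ?thesis using atom a(2) mw by simp
      next
        case False
        then have "a \<cdot> ?m = \<zero>" using a(3) mw by blast
        then show ?thesis using zero by simp
      qed
      ultimately show "a \<cdot> (?m \<oplus> d) \<in> N" using add by simp
    qed (use P \<nu>T in auto)
  qed
  have "m \<in> N" if m: "m \<in> weight_space l" for m
  proof -
    have "m \<in> generated N" using all m weight_space_carrier by simp
    from proj[OF this] obtain P where P: "finite P" "P \<subseteq> TT" "l \<notin> P"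
      "\<forall>a. separates P a \<longrightarrow> a \<cdot> m \<in> N" by (elim exE conjE)
    obtain a where a: "a \<in> carrier HW" "\<forall>m\<in>weight_space l. a \<cdot> m = m" "\<forall>\<mu>\<in>P. \<forall>m\<in>weight_space \<mu>. a \<cdot> m = \<zero>"
      using separate_weights[OF P(1,2) l P(3)] by blast
    have "a \<cdot> m \<in> N" using P(4) a by (simp add: separates_def)
    then show ?thesis using a(2) m by simp
  qed
  then show ?thesis using N by blast
qed simp

text \<open>
  By simplicity the weight space is the image of the group algebra under \<open>F \<mapsto> F v\<close>, and an element of the group algebra
  is a list of \<open>card G\<close> complex numbers. Any injection of sets will do, since module structures can be transported
  along bijections.
\<close>

lemma weight_space_injects: "\<exists>e :: 'm \<Rightarrow> nat \<Rightarrow> complex. inj_on e (weight_space l)"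
proof -
  obtain v where v: "v \<in> weight_space l" "v \<noteq> \<zero>" using weight_space_l weight_space_zero by blast
  have vM: "v \<in> carrier M" using v by (simp add: weight_space_carrier)
  interpret CG: ring CG by (rule ring_CG)
  let ?N = "(\<lambda>F. untwist F \<cdot> v) ` carrier CG"
  have "?N = {\<zero>} \<or> ?N = weight_space l"
  proof (rule weight_space_simple)
    show "?N \<subseteq> weight_space l" using untwist_weight_space v by auto
    show "\<zero> \<in> ?N" by (rule image_eqI[of _ _ "\<zero>\<^bsub>CG\<^esub>"]) (simp_all add: untwist_zero vM)
    show "m \<oplus> m' \<in> ?N" if m: "m \<in> ?N" "m' \<in> ?N" for m m'
    proof -
      obtain F F' where F: "F \<in> carrier CG" "F' \<in> carrier CG" "m = untwist F \<cdot> v" "m' = untwist F' \<cdot> v" using m by blast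
      then have "m \<oplus> m' = untwist (F \<oplus>\<^bsub>CG\<^esub> F') \<cdot> v" using vM by (simp add: untwist_add smult_l_distr)
      then show ?thesis using F by (intro image_eqI[of _ _ "F \<oplus>\<^bsub>CG\<^esub> F'"]) auto
    qed
    show "monomial c 0 (- cocycle w) w \<cdot> m \<in> ?N" if m: "m \<in> ?N" and w: "w \<in> G" for w m c
    proof -
      obtain F where F: "F \<in> carrier CG" "m = untwist F \<cdot> v" using m by blast
      let ?E = "tga_elem complex_ring c w"
      have "monomial c 0 (- cocycle w) w \<cdot> m = untwist (?E \<otimes>\<^bsub>CG\<^esub> F) \<cdot> v"
        unfolding untwist_elem[OF w, symmetric] F(2) untwist_mult[OF F(1)]
        by (rule smult_assoc[symmetric]) (simp_all add: vM)
      then show ?thesis using F w by (intro image_eqI[of _ _ "?E \<otimes>\<^bsub>CG\<^esub> F"]) auto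
    qed
  qed
  moreover have "v \<in> ?N" by (rule image_eqI[of _ _ "\<one>\<^bsub>CG\<^esub>"]) (simp_all add: untwist_one vM smult_one)
  ultimately have N: "weight_space l = ?N" using v by blast
  obtain g where g: "bij_betw g {0..<card G} G" using ex_bij_betw_nat_finite[OF G_finite] by blast
  \<comment> \<open>lists the values of \<open>F\<close> along an enumeration of \<open>G\<close>, continued by zero\<close>
  define code where "code F = (\<lambda>j. if j < card G then F (g j) else (0::complex))" for F :: "('h \<Rightarrow> 'h) \<Rightarrow> complex"
  have code_inj: "inj_on code (carrier CG)"
  proof (rule inj_onI)
    fix F F' assume F: "F \<in> carrier CG" "F' \<in> carrier CG" and eq: "code F = code F'"
    show "F = F'"
    proof
      fix u
      show "F u = F' u"
      proof (cases "u \<in> G")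
        case True
        then have "u \<in> g ` {0..<card G}" using g by (simp add: bij_betw_def)
        then obtain j where "j < card G" "g j = u" by auto
        then show ?thesis using fun_cong[OF eq, of j] by (simp add: code_def)
      next
        case False
        then show ?thesis using F by (simp add: group_algebra_simps)
      qed
    qed
  qed
  have "inj_on (inv_into (carrier CG) (\<lambda>F. untwist F \<cdot> v)) (weight_space l)"
    unfolding N by (rule inj_on_inv_into) simp
  moreover have "inj_on code (inv_into (carrier CG) (\<lambda>F. untwist F \<cdot> v) ` weight_space l)"
    using code_inj by (rule inj_on_subset) (auto simp: N intro: inv_into_into)
  ultimately show ?thesis by (meson comp_inj_on)
qed

theorem weight_space_coordinates:
  "\<exists>(\<xi> :: (('h \<Rightarrow> 'h) \<Rightarrow> complex, nat \<Rightarrow> complex) module) i.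
     \<xi> \<in> simple_group_modules G \<and> bij_betw i (carrier \<xi>) (weight_space l) \<and>
     (\<forall>s\<in>carrier \<xi>. \<forall>t\<in>carrier \<xi>. i (s \<oplus>\<^bsub>\<xi>\<^esub> t) = i s \<oplus> i t) \<and>
     (\<forall>F\<in>carrier CG. \<forall>t\<in>carrier \<xi>. i (F \<odot>\<^bsub>\<xi>\<^esub> t) = untwist F \<cdot> i t)"
proof -
  obtain e :: "'m \<Rightarrow> nat \<Rightarrow> complex" where e: "inj_on e (weight_space l)" using weight_space_injects by blast
  define i where "i = inv_into (weight_space l) e"
  define \<xi> :: "(('h \<Rightarrow> 'h) \<Rightarrow> complex, nat \<Rightarrow> complex) module" where
    "\<xi> = \<lparr>carrier = e ` weight_space l, monoid.mult = undefined, one = undefined, ring.zero = e \<zero>,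
       add = (\<lambda>s t. e (i s \<oplus> i t)), smult = (\<lambda>F t. e (untwist F \<cdot> i t))\<rparr>"
  have ie [simp]: "i (e m) = m" if "m \<in> weight_space l" for m
    unfolding i_def using e that by (rule inv_into_f_f)
  have iw [simp]: "i t \<in> weight_space l" if "t \<in> carrier \<xi>" for t
    unfolding i_def using that by (intro inv_into_into) (simp add: \<xi>_def)
  have ei [simp]: "e (i t) = t" if "t \<in> carrier \<xi>" for t
    unfolding i_def using that by (intro f_inv_into_f) (simp add: \<xi>_def)
  have iM [simp]: "i t \<in> carrier M" if "t \<in> carrier \<xi>" for t by (rule weight_space_carrier[OF iw[OF that]])
  have ops: "s \<oplus>\<^bsub>\<xi>\<^esub> t = e (i s \<oplus> i t)" "F \<odot>\<^bsub>\<xi>\<^esub> t = e (untwist F \<cdot> i t)" "\<zero>\<^bsub>\<xi>\<^esub> = e \<zero>" for s t F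
    by (simp_all add: \<xi>_def)
  have ecl: "e m \<in> carrier \<xi>" if "m \<in> weight_space l" for m using that by (simp add: \<xi>_def)
  have eqI: "s = t" if "s \<in> carrier \<xi>" "t \<in> carrier \<xi>" "i s = i t" for s t
    by (rule trans[OF ei[OF that(1), symmetric] trans[OF arg_cong[OF that(3), of e] ei[OF that(2)]]])
  have sum_w: "i s \<oplus> i t \<in> weight_space l" if "s \<in> carrier \<xi>" "t \<in> carrier \<xi>" for s t
    by (rule weight_space_add[OF iw[OF that(1)] iw[OF that(2)]])
  have untwist_w: "untwist F \<cdot> i t \<in> weight_space l" if "F \<in> carrier CG" "t \<in> carrier \<xi>" for F t
    by (rule untwist_weight_space[OF that(1) iw[OF that(2)]])
  have add: "i (s \<oplus>\<^bsub>\<xi>\<^esub> t) = i s \<oplus> i t" if "s \<in> carrier \<xi>" "t \<in> carrier \<xi>" for s t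
    unfolding ops by (rule ie[OF sum_w[OF that]])
  have smul: "i (F \<odot>\<^bsub>\<xi>\<^esub> t) = untwist F \<cdot> i t" if "F \<in> carrier CG" "t \<in> carrier \<xi>" for F t
    unfolding ops by (rule ie[OF untwist_w[OF that]])
  have add_cl: "s \<oplus>\<^bsub>\<xi>\<^esub> t \<in> carrier \<xi>" if "s \<in> carrier \<xi>" "t \<in> carrier \<xi>" for s t
    unfolding ops by (rule ecl[OF sum_w[OF that]])
  have smul_cl: "F \<odot>\<^bsub>\<xi>\<^esub> t \<in> carrier \<xi>" if "F \<in> carrier CG" "t \<in> carrier \<xi>" for F t
    unfolding ops by (rule ecl[OF untwist_w[OF that]])
  have zero_cl: "\<zero>\<^bsub>\<xi>\<^esub> \<in> carrier \<xi>" and zero: "i \<zero>\<^bsub>\<xi>\<^esub> = \<zero>"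
    unfolding ops by (rule ecl[OF weight_space_zero], rule ie[OF weight_space_zero])
  have neg: "\<exists>s\<in>carrier \<xi>. s \<oplus>\<^bsub>\<xi>\<^esub> t = \<zero>\<^bsub>\<xi>\<^esub>" if t: "t \<in> carrier \<xi>" for t
  proof (rule bexI)
    have w: "\<ominus> i t \<in> weight_space l" using weight_space_scal[OF iw[OF t], of "-1"] scal_minus t by simp
    then show "e (\<ominus> i t) \<in> carrier \<xi>" by (rule ecl)
    then show "e (\<ominus> i t) \<oplus>\<^bsub>\<xi>\<^esub> t = \<zero>\<^bsub>\<xi>\<^esub>"
      using t w by (intro eqI) (simp_all add: add_cl zero_cl add zero M.l_neg)
  qed
  interpret CG: ring CG by (rule ring_CG)
  have mod: "left_module CG \<xi>"
  proof (intro left_module.intro ring_CG left_module_axioms.intro)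
    show "abelian_group \<xi>"
    proof (rule abelian_groupI)
      show "\<And>x y z. \<lbrakk>x \<in> carrier \<xi>; y \<in> carrier \<xi>; z \<in> carrier \<xi>\<rbrakk> \<Longrightarrow> x \<oplus>\<^bsub>\<xi>\<^esub> y \<oplus>\<^bsub>\<xi>\<^esub> z = x \<oplus>\<^bsub>\<xi>\<^esub> (y \<oplus>\<^bsub>\<xi>\<^esub> z)"
        by (rule eqI) (simp_all add: add add_cl M.a_assoc)
      show "\<And>x y. \<lbrakk>x \<in> carrier \<xi>; y \<in> carrier \<xi>\<rbrakk> \<Longrightarrow> x \<oplus>\<^bsub>\<xi>\<^esub> y = y \<oplus>\<^bsub>\<xi>\<^esub> x"
        by (rule eqI) (simp_all add: add add_cl M.a_comm)
      show "\<And>x. x \<in> carrier \<xi> \<Longrightarrow> \<zero>\<^bsub>\<xi>\<^esub> \<oplus>\<^bsub>\<xi>\<^esub> x = x"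
        by (rule eqI) (simp_all add: add add_cl zero zero_cl)
    qed (use add_cl zero_cl neg in auto)
    fix a b m m'
    show "\<lbrakk>a \<in> carrier CG; m \<in> carrier \<xi>\<rbrakk> \<Longrightarrow> a \<odot>\<^bsub>\<xi>\<^esub> m \<in> carrier \<xi>" by (rule smul_cl)
    show "\<lbrakk>a \<in> carrier CG; b \<in> carrier CG; m \<in> carrier \<xi>\<rbrakk> \<Longrightarrow> (a \<oplus>\<^bsub>CG\<^esub> b) \<odot>\<^bsub>\<xi>\<^esub> m = a \<odot>\<^bsub>\<xi>\<^esub> m \<oplus>\<^bsub>\<xi>\<^esub> b \<odot>\<^bsub>\<xi>\<^esub> m"
      by (rule eqI) (simp_all add: smul smul_cl add add_cl untwist_add smult_l_distr)
    show "\<lbrakk>a \<in> carrier CG; m \<in> carrier \<xi>; m' \<in> carrier \<xi>\<rbrakk> \<Longrightarrow> a \<odot>\<^bsub>\<xi>\<^esub> (m \<oplus>\<^bsub>\<xi>\<^esub> m') = a \<odot>\<^bsub>\<xi>\<^esub> m \<oplus>\<^bsub>\<xi>\<^esub> a \<odot>\<^bsub>\<xi>\<^esub> m'"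
      by (rule eqI) (simp_all add: smul smul_cl add add_cl smult_r_distr)
    show "\<lbrakk>a \<in> carrier CG; b \<in> carrier CG; m \<in> carrier \<xi>\<rbrakk> \<Longrightarrow> (a \<otimes>\<^bsub>CG\<^esub> b) \<odot>\<^bsub>\<xi>\<^esub> m = a \<odot>\<^bsub>\<xi>\<^esub> (b \<odot>\<^bsub>\<xi>\<^esub> m)"
      by (rule eqI) (simp_all add: smul smul_cl untwist_mult smult_assoc)
    show "m \<in> carrier \<xi> \<Longrightarrow> \<one>\<^bsub>CG\<^esub> \<odot>\<^bsub>\<xi>\<^esub> m = m"
      by (rule eqI) (simp_all add: smul smul_cl untwist_one smult_one)
  qed
  have bij: "bij_betw i (carrier \<xi>) (weight_space l)"
    by (rule bij_betwI[of _ _ _ e]) (auto intro: ecl)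
  have "simple_module CG \<xi>"
    unfolding simple_module_def
  proof (intro conjI allI impI mod)
    obtain v where v: "v \<in> weight_space l" "v \<noteq> \<zero>" using weight_space_l weight_space_zero by blast
    show "carrier \<xi> \<noteq> {\<zero>\<^bsub>\<xi>\<^esub>}"
    proof
      assume "carrier \<xi> = {\<zero>\<^bsub>\<xi>\<^esub>}"
      then have "e v = \<zero>\<^bsub>\<xi>\<^esub>" using ecl[OF v(1)] by simp
      then show False using ie[OF v(1)] zero v(2) by simp
    qed
    fix N assume "submodule N CG \<xi>"
    then interpret N: submodule N CG \<xi> .
    have sub: "N \<subseteq> carrier \<xi>" using N.subset by simp
    have "i ` N = {\<zero>} \<or> i ` N = weight_space l"
    proof (rule weight_space_simple)
      show "i ` N \<subseteq> weight_space l" using sub by auto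
      show "\<zero> \<in> i ` N" using N.one_closed zero by (metis image_eqI monoid.simps(2))
      show "m \<oplus> m' \<in> i ` N" if mm: "m \<in> i ` N" "m' \<in> i ` N" for m m'
      proof -
        obtain s t where st: "s \<in> N" "t \<in> N" "m = i s" "m' = i t" using mm by blast
        have "i (s \<oplus>\<^bsub>\<xi>\<^esub> t) = m \<oplus> m'"
          unfolding st(3,4) by (rule add[OF subsetD[OF sub st(1)] subsetD[OF sub st(2)]])
        moreover have "s \<oplus>\<^bsub>\<xi>\<^esub> t \<in> N" using N.m_closed[of s t] st by simp
        ultimately show ?thesis by (metis image_eqI)
      qed
      show "monomial c 0 (- cocycle w) w \<cdot> m \<in> i ` N" if mm: "m \<in> i ` N" and w: "w \<in> G" for w m c
      proof -
        obtain s where s: "s \<in> N" "m = i s" using mm by blast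
        let ?E = "tga_elem complex_ring c w"
        have "i (?E \<odot>\<^bsub>\<xi>\<^esub> s) = monomial c 0 (- cocycle w) w \<cdot> m"
          unfolding s(2) untwist_elem[OF w, symmetric] by (rule smul[OF tga_CG[OF w] subsetD[OF sub s(1)]])
        moreover have "?E \<odot>\<^bsub>\<xi>\<^esub> s \<in> N" by (rule N.smult_closed[OF tga_CG[OF w] s(1)])
        ultimately show ?thesis by (metis image_eqI)
      qed
    qed
    then show "N = {\<zero>\<^bsub>\<xi>\<^esub>} \<or> N = carrier \<xi>"
    proof
      assume iN: "i ` N = {\<zero>}"
      have "s = \<zero>\<^bsub>\<xi>\<^esub>" if "s \<in> N" for s
        by (rule eqI) (use that iN sub zero zero_cl in auto)
      moreover have "\<zero>\<^bsub>\<xi>\<^esub> \<in> N" using N.one_closed by simp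
      ultimately show ?thesis by blast
    next
      assume iN: "i ` N = weight_space l"
      have "t \<in> N" if t: "t \<in> carrier \<xi>" for t
      proof -
        obtain s where "s \<in> N" "i t = i s" using iN iw[OF t] by blast
        then have "t = s" using t sub by (intro eqI) auto
        then show ?thesis using \<open>s \<in> N\<close> by simp
      qed
      then show ?thesis using sub by blast
    qed
  qed
  then have "\<xi> \<in> simple_group_modules G" by (simp add: simple_group_modules_def)
  then show ?thesis using bij add smul by blast
qed

end

text \<open>
  For maps out of a tensor product the natural direction of an isomorphism is from the tensor product to \<open>M\<close>; this
  turns it around.
\<close>

lemma module_isomorphic_from_inverse:
  assumes f: "bij_betw f (carrier Z) (carrier M)"
    and add_closed: "\<And>z z'. z \<in> carrier Z \<Longrightarrow> z' \<in> carrier Z \<Longrightarrow> z \<oplus>\<^bsub>Z\<^esub> z' \<in> carrier Z"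
    and smult_closed: "\<And>a z. a \<in> carrier R \<Longrightarrow> z \<in> carrier Z \<Longrightarrow> a \<odot>\<^bsub>Z\<^esub> z \<in> carrier Z"
    and add: "\<And>z z'. z \<in> carrier Z \<Longrightarrow> z' \<in> carrier Z \<Longrightarrow> f (z \<oplus>\<^bsub>Z\<^esub> z') = f z \<oplus>\<^bsub>M\<^esub> f z'"
    and smult: "\<And>a z. a \<in> carrier R \<Longrightarrow> z \<in> carrier Z \<Longrightarrow> f (a \<odot>\<^bsub>Z\<^esub> z) = a \<odot>\<^bsub>M\<^esub> f z"
  shows "module_isomorphic R M Z"
proof -
  let ?g = "inv_into (carrier Z) f"
  have g: "bij_betw ?g (carrier M) (carrier Z)" by (rule bij_betw_inv_into[OF f])
  have gcl: "?g m \<in> carrier Z" and fg: "f (?g m) = m" if "m \<in> carrier M" for m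
    using bij_betwE[OF g] that f by (auto simp: bij_betw_def f_inv_into_f)
  have gf: "?g (f z) = z" if "z \<in> carrier Z" for z
    using f that by (auto simp: bij_betw_def)
  have 1: "?g (m \<oplus>\<^bsub>M\<^esub> m') = ?g m \<oplus>\<^bsub>Z\<^esub> ?g m'" if m: "m \<in> carrier M" "m' \<in> carrier M" for m m'
  proof -
    have "f (?g m \<oplus>\<^bsub>Z\<^esub> ?g m') = m \<oplus>\<^bsub>M\<^esub> m'" using add[OF gcl[OF m(1)] gcl[OF m(2)]] fg m by simp
    then show ?thesis using gf[OF add_closed[OF gcl[OF m(1)] gcl[OF m(2)]]] by simp
  qed
  have 2: "?g (a \<odot>\<^bsub>M\<^esub> m) = a \<odot>\<^bsub>Z\<^esub> ?g m" if a: "a \<in> carrier R" and m: "m \<in> carrier M" for a m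
  proof -
    have "f (a \<odot>\<^bsub>Z\<^esub> ?g m) = a \<odot>\<^bsub>M\<^esub> m" using smult[OF a gcl[OF m]] fg m by simp
    then show ?thesis using gf[OF smult_closed[OF a gcl[OF m]]] by simp
  qed
  show ?thesis unfolding module_isomorphic_def using g 1 2 by blast
qed

section \<open>The module V and its map to M\<close>

text \<open>
  The module \<open>\<xi>\<close> is a copy of the weight space of \<open>l\<close>, identified with it by \<open>i\<close>; its carrier type is arbitrary.
\<close>

locale induced_module = weight_module \<Delta> X Y n r M l
  for \<Delta> :: "'h::euclidean_space set" and X Y n r
    and M :: "(('h \<Rightarrow> 'h) \<Rightarrow> 'h qtorus_elem, 'm) module" (structure) and l +
  fixes \<xi> :: "(('h \<Rightarrow> 'h) \<Rightarrow> complex, 'c) module" and i :: "'c \<Rightarrow> 'm"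
  assumes left_module_xi: "left_module (group_algebra (isotropy_group \<Delta> X Y n r l)) \<xi>"
    and i_bij: "bij_betw i (carrier \<xi>) (weight_space l)"
    and i_add: "s \<in> carrier \<xi> \<Longrightarrow> t \<in> carrier \<xi> \<Longrightarrow> i (s \<oplus>\<^bsub>\<xi>\<^esub> t) = i s \<oplus> i t"
    and i_smult: "F \<in> carrier (group_algebra (isotropy_group \<Delta> X Y n r l)) \<Longrightarrow> t \<in> carrier \<xi> \<Longrightarrow>
      i (F \<odot>\<^bsub>\<xi>\<^esub> t) = untwist F \<odot> i t"
begin

interpretation xi: left_module CG \<xi> by (rule left_module_xi)

lemma i_weight_space [simp]: "t \<in> carrier \<xi> \<Longrightarrow> i t \<in> weight_space l"
  using bij_betwE[OF i_bij] by blast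

lemma i_closed [simp]: "t \<in> carrier \<xi> \<Longrightarrow> i t \<in> carrier M"
  using i_weight_space weight_space_carrier by blast

lemma i_inj: "s \<in> carrier \<xi> \<Longrightarrow> t \<in> carrier \<xi> \<Longrightarrow> i s = i t \<Longrightarrow> s = t"
  using i_bij by (meson bij_betw_def inj_onD)

lemma i_zero: "i \<zero>\<^bsub>\<xi>\<^esub> = \<zero>"
  using i_add[of "\<zero>\<^bsub>\<xi>\<^esub>" "\<zero>\<^bsub>\<xi>\<^esub>"] M.add.l_cancel_one'[of "i \<zero>\<^bsub>\<xi>\<^esub>" "i \<zero>\<^bsub>\<xi>\<^esub>"] by simp

text \<open>
  The action of \<open>c w\<close> on \<open>\<xi>\<close>, with \<open>w = id\<close> for scalars.
\<close>

definition xi_act :: "complex \<Rightarrow> ('h \<Rightarrow> 'h) \<Rightarrow> 'c \<Rightarrow> 'c" where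
  "xi_act c w t = tga_elem complex_ring c w \<odot>\<^bsub>\<xi>\<^esub> t"

lemma xi_act_closed [simp]: "w \<in> G \<Longrightarrow> t \<in> carrier \<xi> \<Longrightarrow> xi_act c w t \<in> carrier \<xi>"
  unfolding xi_act_def by (rule xi.smult_closed) auto

lemma i_xi_act: "w \<in> G \<Longrightarrow> t \<in> carrier \<xi> \<Longrightarrow> i (xi_act c w t) = monomial c 0 (- cocycle w) w \<cdot> i t"
  unfolding xi_act_def by (simp add: i_smult untwist_elem)

lemma i_xi_act_id: "t \<in> carrier \<xi> \<Longrightarrow> i (xi_act c id t) = scal c \<cdot> i t"
  by (simp add: i_xi_act)

lemma xi_act_add: "w \<in> G \<Longrightarrow> s \<in> carrier \<xi> \<Longrightarrow> t \<in> carrier \<xi> \<Longrightarrow> xi_act c w (s \<oplus>\<^bsub>\<xi>\<^esub> t) = xi_act c w s \<oplus>\<^bsub>\<xi>\<^esub> xi_act c w t"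
  unfolding xi_act_def by (rule xi.smult_r_distr) auto

lemma xi_act_commute: "w \<in> G \<Longrightarrow> t \<in> carrier \<xi> \<Longrightarrow> xi_act 1 w (xi_act c id t) = xi_act c id (xi_act 1 w t)"
proof (rule i_inj)
  assume w: "w \<in> G" and t: "t \<in> carrier \<xi>"
  have "i (xi_act 1 w (xi_act c id t)) = monomial 1 0 (- cocycle w) w \<cdot> (scal c \<cdot> i t)"
    using w t i_xi_act i_xi_act_id by simp
  also have "\<dots> = monomial (c * 1) 0 (- cocycle w) w \<cdot> i t" by (rule monomial_scal) (use w t in auto)
  also have "\<dots> = scal c \<cdot> (monomial 1 0 (- cocycle w) w \<cdot> i t)" by (rule scal_monomial[symmetric]) (use w t in auto)
  also have "\<dots> = i (xi_act c id (xi_act 1 w t))" using w t i_xi_act i_xi_act_id by simp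
  finally show "i (xi_act 1 w (xi_act c id t)) = i (xi_act c id (xi_act 1 w t))" .
qed simp_all

abbreviation Mlam where "Mlam \<equiv> Mlambda \<Delta> X Y n r l"

lemma Mlam_simps: "carrier Mlam = {v. keys v \<subseteq> C}" "\<zero>\<^bsub>Mlam\<^esub> = 0" "(\<oplus>\<^bsub>Mlam\<^esub>) = (+)"
  by (simp_all add: Mlambda_def)

lemma Mlam_add_closed: "v \<in> carrier Mlam \<Longrightarrow> v' \<in> carrier Mlam \<Longrightarrow> v + v' \<in> carrier Mlam"
  using Poly_Mapping.keys_add[of v v'] by (auto simp: Mlam_simps)

lemma Mlam_single: "\<mu> \<in> C \<Longrightarrow> single \<mu> d \<in> carrier Mlam"
  by (simp add: Mlam_simps)

lemma Mlam_abelian: "abelian_group Mlam"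
proof (rule abelian_groupI)
  fix x assume "x \<in> carrier Mlam"
  then show "\<exists>y\<in>carrier Mlam. y \<oplus>\<^bsub>Mlam\<^esub> x = \<zero>\<^bsub>Mlam\<^esub>"
    by (intro bexI[of _ "- x"]) (auto simp: Mlam_simps)
qed (use Mlam_add_closed in \<open>auto simp: Mlam_simps add_ac\<close>)

lemma Mlam_induct [consumes 1, case_names zero add]:
  assumes "v \<in> carrier Mlam" and "P 0"
    and "\<And>\<mu> d v. \<mu> \<in> C \<Longrightarrow> v \<in> carrier Mlam \<Longrightarrow> P v \<Longrightarrow> P (single \<mu> d + v)"
  shows "P v"
proof -
  have "keys v \<subseteq> C" using assms(1) by (simp add: Mlam_simps)
  then show ?thesis by (induction v rule: poly_mapping_keys_induct) (use assms(2,3) in \<open>auto simp: Mlam_simps\<close>)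
qed

text \<open>
  The right action of the scalars that enters the first tensor product.
\<close>

abbreviation rho :: "('h torus_elem \<Rightarrow>\<^sub>0 complex) \<Rightarrow> complex \<Rightarrow> ('h torus_elem \<Rightarrow>\<^sub>0 complex)" where
  "rho v c \<equiv> Poly_Mapping.map (\<lambda>z. z * c) v"

lemma rho_add: "rho (v + v') c = rho v c + rho v' c"
  by (rule poly_mapping_eqI) (simp add: map.rep_eq lookup_add when_def distrib_right[symmetric])

lemma rho_single: "rho (single \<mu> d) c = single \<mu> (d * c)"
  by (rule poly_mapping_eqI) (simp add: map.rep_eq lookup_single when_def)

lemma rho_0 [simp]: "rho 0 c = 0"
  by (rule poly_mapping_eqI) (simp add: map.rep_eq)

lemma rho_closed: "v \<in> carrier Mlam \<Longrightarrow> rho v c \<in> carrier Mlam"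
proof (induction v rule: Mlam_induct)
  case (add \<mu> d v)
  then show ?case by (simp add: rho_add rho_single Mlam_add_closed Mlam_single)
qed (simp add: Mlam_simps)

lemma torus_act_add_left: "Mlambda_torus_act X n r (f + g) v = Mlambda_torus_act X n r f v + Mlambda_torus_act X n r g v"
  unfolding Mlambda_torus_act_def split_def prod.collapse Let_def
  by (rule setsum_keys_plus_distrib) (simp_all add: sum.distrib[symmetric] single_add[symmetric] algebra_simps)

lemma torus_act_add_right: "Mlambda_torus_act X n r f (v + v') = Mlambda_torus_act X n r f v + Mlambda_torus_act X n r f v'"
proof -
  have "(\<Sum>\<mu>\<in>keys (v + v'). single (\<mu> \<otimes>\<^bsub>torus X\<^esub> qchar X n r y) (c * lookup (v + v') \<mu> * (\<mu> \<otimes>\<^bsub>torus X\<^esub> qchar X n r y) x)) =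
    (\<Sum>\<mu>\<in>keys v. single (\<mu> \<otimes>\<^bsub>torus X\<^esub> qchar X n r y) (c * lookup v \<mu> * (\<mu> \<otimes>\<^bsub>torus X\<^esub> qchar X n r y) x)) +
    (\<Sum>\<mu>\<in>keys v'. single (\<mu> \<otimes>\<^bsub>torus X\<^esub> qchar X n r y) (c * lookup v' \<mu> * (\<mu> \<otimes>\<^bsub>torus X\<^esub> qchar X n r y) x))" for c x y
    by (rule setsum_keys_plus_distrib) (simp_all add: single_add[symmetric] algebra_simps)
  then show ?thesis unfolding Mlambda_torus_act_def split_def Let_def by (simp add: sum.distrib)
qed

lemma torus_act_single:
  "\<mu> \<in> TT \<Longrightarrow> y \<in> Y \<Longrightarrow> Mlambda_torus_act X n r (single (x, y) c) (single \<mu> d) =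
     single (shift \<mu> y) (c * d * shift \<mu> y x)"
  by (cases "c = 0"; cases "d = 0") (simp_all add: Mlambda_torus_act_def shift_eq Let_def)

lemma torus_act_0 [simp]: "Mlambda_torus_act X n r 0 v = 0" "Mlambda_torus_act X n r f 0 = 0"
  by (simp_all add: Mlambda_torus_act_def)

lemma weyl_act_add: "Mlambda_weyl_act X w (v + v') = Mlambda_weyl_act X w v + Mlambda_weyl_act X w v'"
  unfolding Mlambda_weyl_act_def by (rule setsum_keys_plus_distrib) (simp_all add: single_add)

lemma weyl_act_single: "Mlambda_weyl_act X w (single \<mu> d) = single (torus_act X w \<mu>) d"
  by (cases "d = 0") (simp_all add: Mlambda_weyl_act_def)

lemma weyl_act_0 [simp]: "Mlambda_weyl_act X w 0 = 0"
  by (simp add: Mlambda_weyl_act_def)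

text \<open>
  The action of \<open>k \<otimes> w\<close>, written without the sum over \<open>G\<close> in the definition of the module structure.
\<close>

definition Mlam_act :: "'h qtorus_elem \<Rightarrow> ('h \<Rightarrow> 'h) \<Rightarrow> ('h torus_elem \<Rightarrow>\<^sub>0 complex) \<Rightarrow> ('h torus_elem \<Rightarrow>\<^sub>0 complex)" where
  "Mlam_act k w v = Mlambda_torus_act X n r k (Mlambda_weyl_act X w v)"

lemma Mlam_act_eq: assumes "w \<in> G" shows "tga_elem K k w \<odot>\<^bsub>Mlam\<^esub> v = Mlam_act k w v"
proof -
  have "tga_elem K k w \<odot>\<^bsub>Mlam\<^esub> v = (\<Sum>u\<in>G. if u = w then Mlam_act k w v else 0)"
    unfolding Mlambda_def module.simps by (rule sum.cong) (auto simp: tga_elem_def Mlam_act_def)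
  then show ?thesis using assms by simp
qed

lemma Mlam_act_0 [simp]: "Mlam_act 0 w v = 0" "Mlam_act k w 0 = 0" by (simp_all add: Mlam_act_def)

lemma Mlam_act_add_left: "Mlam_act (k + k') w v = Mlam_act k w v + Mlam_act k' w v"
  by (simp add: Mlam_act_def torus_act_add_left)

lemma Mlam_act_add_right: "Mlam_act k w (v + v') = Mlam_act k w v + Mlam_act k w v'"
  by (simp add: Mlam_act_def torus_act_add_right weyl_act_add)

lemma Mlam_act_single: "\<mu> \<in> TT \<Longrightarrow> w \<in> W \<Longrightarrow> y \<in> Y \<Longrightarrow> Mlam_act (single (x, y) c) w (single \<mu> d) =
    single (shift (torus_act X w \<mu>) y) (c * d * shift (torus_act X w \<mu>) y x)"
  by (simp add: Mlam_act_def weyl_act_single torus_act_single)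

lemma K_induct [consumes 1, case_names zero add]:
  assumes "k \<in> carrier K" and "P 0"
    and "\<And>x y c k. x \<in> X \<Longrightarrow> y \<in> Y \<Longrightarrow> k \<in> carrier K \<Longrightarrow> P k \<Longrightarrow> P (single (x, y) c + k)"
  shows "P k"
proof -
  have "keys k \<subseteq> X \<times> Y" using assms(1) by (simp add: K_carrier)
  then show ?thesis by (induction k rule: poly_mapping_keys_induct) (use assms(2,3) in \<open>auto simp: K_carrier\<close>)
qed

lemma Mlam_act_closed:
  assumes "k \<in> carrier K" "w \<in> G" "v \<in> carrier Mlam" shows "Mlam_act k w v \<in> carrier Mlam"
  using assms(3)
proof (induction v rule: Mlam_induct)
  case (add \<mu> d v)
  have "Mlam_act k w (single \<mu> d) \<in> carrier Mlam"
    using assms(1)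
    by (induction k rule: K_induct)
      (use add assms in \<open>auto simp: Mlam_act_add_left Mlam_act_single intro!: Mlam_add_closed Mlam_single\<close>, simp_all add: Mlam_simps)
  then show ?case using add by (simp add: Mlam_act_add_right Mlam_add_closed)
qed (simp add: Mlam_simps)

lemma Mlam_act_rho:
  assumes "k \<in> carrier K" "w \<in> G" "v \<in> carrier Mlam" shows "Mlam_act k w (rho v c) = rho (Mlam_act k w v) c"
  using assms(3)
proof (induction v rule: Mlam_induct)
  case (add \<mu> d v)
  have "Mlam_act k w (rho (single \<mu> d) c) = rho (Mlam_act k w (single \<mu> d)) c"
    using assms(1)
    by (induction k rule: K_induct)
      (use add assms in \<open>auto simp: Mlam_act_add_left Mlam_act_single rho_single rho_add mult_ac\<close>)
  then show ?case using add by (simp add: Mlam_act_add_right rho_add)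
qed simp

interpretation V: tensor_data UNIV Mlam rho \<xi> "\<lambda>c. xi_act c id"
proof (intro tensor_data.intro tensor_data_axioms.intro Mlam_abelian xi.M.abelian_group_axioms)
qed (simp_all add: rho_closed)

definition gV :: "(('h \<Rightarrow> 'h) \<Rightarrow> 'h qtorus_elem) \<Rightarrow> ('h torus_elem \<Rightarrow>\<^sub>0 complex) \<times> 'c \<Rightarrow> (('h torus_elem \<Rightarrow>\<^sub>0 complex) \<times> 'c \<Rightarrow>\<^sub>0 int)" where
  "gV F = (\<lambda>(v, t). \<Sum>w\<in>G. frag_of (Mlam_act (F w) w v, xi_act 1 w t))"

abbreviation VV where "VV \<equiv> V_module \<Delta> X Y n r l \<xi>"

lemma V_eq: "VV = tensor_module UNIV Mlam rho \<xi> (\<lambda>c. xi_act c id) gV"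
proof -
  have "(\<lambda>F (v, t). \<Sum>w\<in>G. frag_of (tga_elem K (F w) w \<odot>\<^bsub>Mlam\<^esub> v, tga_elem complex_ring 1 w \<odot>\<^bsub>\<xi>\<^esub> t)) = gV"
    unfolding gV_def by (intro ext) (auto simp: Mlam_act_eq xi_act_def intro!: sum.cong)
  moreover have "(\<lambda>c. xi_act c id) = (\<lambda>c t. tga_elem complex_ring c id \<odot>\<^bsub>\<xi>\<^esub> t)"
    by (intro ext) (simp add: xi_act_def)
  ultimately show ?thesis unfolding V_module_def by simp
qed

lemmas V_abelian = V.abelian_group_tensor[where g = gV, folded V_eq]
lemmas V_tens_closed = V.tens_closed[where g = gV, folded V_eq]
lemmas V_tens_add_left = V.tens_add_left[where g = gV, folded V_eq, unfolded Mlam_simps(3)]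
lemmas V_tens_add_right = V.tens_add_right[where g = gV, folded V_eq]
lemmas V_tens_zero_left = V.tens_zero_left[where g = gV, folded V_eq, unfolded Mlam_simps(2)]
lemmas V_induct = V.tensor_induct[where g = gV, folded V_eq, consumes 1, case_names tens add]

lemma V_gV_closed:
  assumes F: "F \<in> carrier (HG G)" and "v \<in> carrier Mlam" "t \<in> carrier \<xi>" "A \<subseteq> G"
  shows "(\<Sum>w\<in>A. frag_of (Mlam_act (F w) w v, xi_act 1 w t)) \<in> carrier V.formal_sums"
  using assms Mlam_act_closed[OF HG_apply_closed[OF F]]
  by (intro sum_closed_free_Abelian_group) auto

text \<open>
  Each of the three kinds of relations is mapped to a sum, over \<open>w\<close> in \<open>G\<close>, of relations of the same kind.
\<close>

lemma V_smult_basic: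
  assumes F: "F \<in> carrier (HG G)"
  shows "c \<in> carrier V.formal_sums \<Longrightarrow> F \<odot>\<^bsub>VV\<^esub> V.coset c = V.coset (frag_extend (gV F) c)"
    and "c \<in> carrier V.formal_sums \<Longrightarrow> frag_extend (gV F) c \<in> carrier V.formal_sums"
proof -
  have k: "F w \<in> carrier K" for w using HG_apply_closed[OF F] .
  have a: "gV F (v, t) \<in> carrier V.formal_sums" if "v \<in> carrier Mlam" "t \<in> carrier \<xi>" for v t
    using V_gV_closed[OF F that subset_refl] by (simp add: gV_def)
  have b: "gV F (v \<oplus>\<^bsub>Mlam\<^esub> v', t) - gV F (v, t) - gV F (v', t) \<in> V.relations"
    if "v \<in> carrier Mlam" "v' \<in> carrier Mlam" "t \<in> carrier \<xi>" for v v' t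
  proof -
    have "gV F (v \<oplus>\<^bsub>Mlam\<^esub> v', t) - gV F (v, t) - gV F (v', t) =
      (\<Sum>w\<in>G. frag_of (Mlam_act (F w) w v \<oplus>\<^bsub>Mlam\<^esub> Mlam_act (F w) w v', xi_act 1 w t) - frag_of (Mlam_act (F w) w v, xi_act 1 w t) - frag_of (Mlam_act (F w) w v', xi_act 1 w t))"
      by (simp add: gV_def Mlam_simps(3) Mlam_act_add_right sum_subtractf)
    also have "\<dots> \<in> V.relations"
      using that k Mlam_act_closed by (intro V.relations_sum V.rel_add_left) auto
    finally show ?thesis .
  qed
  have c: "gV F (v, t \<oplus>\<^bsub>\<xi>\<^esub> t') - gV F (v, t) - gV F (v, t') \<in> V.relations"
    if "v \<in> carrier Mlam" "t \<in> carrier \<xi>" "t' \<in> carrier \<xi>" for v t t'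
  proof -
    have "gV F (v, t \<oplus>\<^bsub>\<xi>\<^esub> t') - gV F (v, t) - gV F (v, t') =
      (\<Sum>w\<in>G. frag_of (Mlam_act (F w) w v, xi_act 1 w t \<oplus>\<^bsub>\<xi>\<^esub> xi_act 1 w t') - frag_of (Mlam_act (F w) w v, xi_act 1 w t) - frag_of (Mlam_act (F w) w v, xi_act 1 w t'))"
      using that by (simp add: gV_def xi_act_add sum_subtractf)
    also have "\<dots> \<in> V.relations"
      using that k Mlam_act_closed by (intro V.relations_sum V.rel_add_right) auto
    finally show ?thesis .
  qed
  have d: "gV F (rho v z, t) - gV F (v, xi_act z id t) \<in> V.relations"
    if "v \<in> carrier Mlam" "t \<in> carrier \<xi>" for v t z
  proof -
    have "gV F (rho v z, t) - gV F (v, xi_act z id t) =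
      (\<Sum>w\<in>G. frag_of (rho (Mlam_act (F w) w v) z, xi_act 1 w t) - frag_of (Mlam_act (F w) w v, xi_act z id (xi_act 1 w t)))"
      using that k by (simp add: gV_def xi_act_commute Mlam_act_rho sum_subtractf)
    also have "\<dots> \<in> V.relations"
      using that k Mlam_act_closed by (intro V.relations_sum V.rel_balanced) auto
    finally show ?thesis .
  qed
  show "c \<in> carrier V.formal_sums \<Longrightarrow> F \<odot>\<^bsub>VV\<^esub> V.coset c = V.coset (frag_extend (gV F) c)"
    unfolding V_eq by (rule V.smult_coset(1)[where g = gV and s = F, OF a b c d])
  show "c \<in> carrier V.formal_sums \<Longrightarrow> frag_extend (gV F) c \<in> carrier V.formal_sums"
    by (rule V.smult_coset(2)[where g = gV and s = F, OF a b c d])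
qed

lemmas V_smult_additive = V.smult_additive[where g = gV, folded V_eq, OF V_smult_basic(1) V_smult_basic(2)]

lemma V_smult_closed: "F \<in> carrier (HG G) \<Longrightarrow> z \<in> carrier VV \<Longrightarrow> F \<odot>\<^bsub>VV\<^esub> z \<in> carrier VV"
  by (rule V_smult_additive(1))

lemma V_smult_add: "F \<in> carrier (HG G) \<Longrightarrow> z \<in> carrier VV \<Longrightarrow> z' \<in> carrier VV \<Longrightarrow>
    F \<odot>\<^bsub>VV\<^esub> (z \<oplus>\<^bsub>VV\<^esub> z') = F \<odot>\<^bsub>VV\<^esub> z \<oplus>\<^bsub>VV\<^esub> F \<odot>\<^bsub>VV\<^esub> z'"
  by (rule V_smult_additive(2))

lemma V_smult_tens: "F \<in> carrier (HG G) \<Longrightarrow> v \<in> carrier Mlam \<Longrightarrow> t \<in> carrier \<xi> \<Longrightarrow>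
    F \<odot>\<^bsub>VV\<^esub> V.tens v t = V.coset (\<Sum>w\<in>G. frag_of (Mlam_act (F w) w v, xi_act 1 w t))"
  using V_smult_additive(3)[of F v t] by (simp add: gV_def)

text \<open>
  Sums over \<open>G\<close> are treated by induction over subsets of \<open>G\<close>, here and in \<open>phi_smult\<close>.
\<close>

lemma V_coset_insert:
  assumes F: "F \<in> carrier (HG G)" and v: "v \<in> carrier Mlam" and t: "t \<in> carrier \<xi>" and A: "finite A" "w \<notin> A" "insert w A \<subseteq> G"
  shows "V.coset (\<Sum>w\<in>insert w A. frag_of (Mlam_act (F w) w v, xi_act 1 w t)) =
    V.tens (Mlam_act (F w) w v) (xi_act 1 w t) \<oplus>\<^bsub>VV\<^esub> V.coset (\<Sum>w\<in>A. frag_of (Mlam_act (F w) w v, xi_act 1 w t))"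
proof -
  have 1: "(\<Sum>w\<in>A. frag_of (Mlam_act (F w) w v, xi_act 1 w t)) \<in> carrier V.formal_sums"
    by (rule V_gV_closed[OF F v t]) (use A in auto)
  have 2: "frag_of (Mlam_act (F w) w v, xi_act 1 w t) \<in> carrier V.formal_sums"
    using Mlam_act_closed[OF HG_apply_closed[OF F] _ v, of w] A t by auto
  show ?thesis unfolding V.tens_def V_eq
    by (subst V.coset_add[OF 2 1, symmetric]) (use A in simp)
qed

text \<open>
  The other summands contain the factor zero; they are not zero as formal sums but become so in the quotient.
\<close>

lemma V_smult_tga:
  assumes k: "k \<in> carrier K" and g: "g \<in> G" and v: "v \<in> carrier Mlam" and t: "t \<in> carrier \<xi>"
  shows "tga_elem K k g \<odot>\<^bsub>VV\<^esub> V.tens v t = V.tens (Mlam_act k g v) (xi_act 1 g t)"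
proof -
  interpret VV: abelian_group VV by (rule V_abelian)
  let ?F = "tga_elem K k g"
  have F: "?F \<in> carrier (HG G)" by (rule tga_elem_closed[OF k g])
  have "V.coset (\<Sum>w\<in>A. frag_of (Mlam_act (?F w) w v, xi_act 1 w t)) = (if g \<in> A then V.tens (Mlam_act k g v) (xi_act 1 g t) else \<zero>\<^bsub>VV\<^esub>)"
    if "finite A" "A \<subseteq> G" for A
    using that
  proof (induction A rule: finite_induct)
    case empty
    show ?case using V.coset_0[where g = gV, folded V_eq] by simp
  next
    case (insert w A)
    have cl: "V.tens (Mlam_act k g v) (xi_act 1 g t) \<in> carrier VV"
      using Mlam_act_closed[OF k g v] g t by (intro V_tens_closed) auto
    have w: "w \<in> G" using insert by auto
    show ?case
    proof (cases "w = g")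
      case True
      then have rest: "V.coset (\<Sum>w\<in>A. frag_of (Mlam_act (?F w) w v, xi_act 1 w t)) = \<zero>\<^bsub>VV\<^esub>" using insert by simp
      have "?F w = k" using True by (simp add: tga_elem_apply)
      then show ?thesis unfolding V_coset_insert[OF F v t insert(1,2,4)] rest using True cl by simp
    next
      case False
      have "V.tens (Mlam_act (?F w) w v) (xi_act 1 w t) = \<zero>\<^bsub>VV\<^esub>"
        using False w t by (simp add: tga_elem_apply V_tens_zero_left)
      then show ?thesis unfolding V_coset_insert[OF F v t insert(1,2,4)] using insert False cl by simp
    qed
  qed
  from this[OF G_finite subset_refl] show ?thesis unfolding V_smult_tens[OF F v t] using g by simp
qed

text \<open>
  The linear extension of \<open>v\<^sub>\<mu> \<mapsto> e\<^sup>y\<close> for \<open>\<mu> = l q\<^sup>y\<close>. Since \<open>v\<^sub>\<mu> = e\<^sup>y v\<^sub>l\<close>, the element \<open>v \<otimes> t\<close> should go to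
  \<open>translation v\<close> applied to the vector corresponding to \<open>t\<close>.
\<close>

definition translation :: "('h torus_elem \<Rightarrow>\<^sub>0 complex) \<Rightarrow> ('h \<Rightarrow> 'h) \<Rightarrow> 'h qtorus_elem" where
  "translation v = tga_elem K (\<Sum>\<mu>\<in>keys v. single (0, offset \<mu>) (lookup v \<mu>)) id"

lemma translation_add: "translation (v + v') = translation v \<oplus>\<^bsub>HW\<^esub> translation v'"
proof -
  have "(\<Sum>\<mu>\<in>keys (v + v'). single (0::'h dual, offset \<mu>) (lookup (v + v') \<mu>)) =
    (\<Sum>\<mu>\<in>keys v. single (0, offset \<mu>) (lookup v \<mu>)) +
    (\<Sum>\<mu>\<in>keys v'. single (0, offset \<mu>) (lookup v' \<mu>))"
    by (rule setsum_keys_plus_distrib) (simp_all add: single_add)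
  then show ?thesis unfolding translation_def by (simp only: tga_elem_add)
qed

lemma translation_single: "translation (single \<mu> d) = monomial d 0 (offset \<mu>) id"
  by (cases "d = 0") (simp_all add: translation_def monomial_def)

lemma translation_0: "translation 0 = \<zero>\<^bsub>HW\<^esub>"
  by (simp add: translation_def tga_elem_0[where G = W])

lemma translation_closed [simp]: "v \<in> carrier Mlam \<Longrightarrow> translation v \<in> carrier HW"
  unfolding translation_def Mlam_simps
  by (intro tga_elem_closed K_sum_closed K_single_closed X_group offset_Y) auto

lemma translation_rho: "v \<in> carrier Mlam \<Longrightarrow> m \<in> carrier M \<Longrightarrow> translation (rho v c) \<cdot> m = translation v \<cdot> (scal c \<cdot> m)"
proof (induction v rule: Mlam_induct)
  case zero
  then show ?case by (simp add: translation_0)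
next
  case (add \<mu> d v)
  have "translation (rho (single \<mu> d + v) c) \<cdot> m = monomial (d * c) 0 (offset \<mu>) id \<cdot> m \<oplus> translation (rho v c) \<cdot> m"
    using add by (simp add: rho_add rho_single translation_add translation_single smult_l_distr rho_closed)
  also have "monomial (d * c) 0 (offset \<mu>) id \<cdot> m = monomial d 0 (offset \<mu>) id \<cdot> (scal c \<cdot> m)"
    using add by (subst monomial_scal) (auto simp: mult.commute)
  also have "\<dots> \<oplus> translation (rho v c) \<cdot> m = translation (single \<mu> d + v) \<cdot> (scal c \<cdot> m)"
    using add by (simp add: translation_add translation_single smult_l_distr)
  finally show ?case .
qed

text \<open>
  Compatibility with the action on pure tensors. For monomials both sides have the form
  \<open>e\<^sup>y\<^sup>' w\<close> applied to a vector of weight \<open>l\<close>, with the same exponent \<open>y'\<close>: moving \<open>w\<close> past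
  \<open>e\<^sup>y\<close> and untwisting the action on \<open>\<xi>\<close> cancel the cocycle, and \<open>e\<^sup>x\<close> becomes a scalar on the resulting weight
  vector.
\<close>

lemma translation_Mlam_act:
  assumes k: "k \<in> carrier K" and w: "w \<in> G" and v: "v \<in> carrier Mlam" and t: "t \<in> carrier \<xi>"
  shows "translation (Mlam_act k w v) \<cdot> i (xi_act 1 w t) = tga_elem K k w \<cdot> (translation v \<cdot> i t)"
proof -
  have it: "i t \<in> weight_space l" "i t \<in> carrier M" using t by auto
  have it': "i (xi_act 1 w t) \<in> carrier M" using t w by simp
  have wW: "w \<in> W" using w by simp
  have tga: "tga_elem K k w \<in> carrier HW" if "k \<in> carrier K" for k
    by (rule tga_elem_closed[OF that wW])
  have single: "translation (Mlam_act (single (x, y) c) w (single \<mu> d)) \<cdot> i (xi_act 1 w t) =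
      monomial c x y w \<cdot> (monomial d 0 (offset \<mu>) id \<cdot> i t)" if x: "x \<in> X" and y: "y \<in> Y" and \<mu>: "\<mu> \<in> C" for x y c \<mu> d
  proof -
    let ?\<nu> = "shift (torus_act X w \<mu>) y"
    have \<nu>: "?\<nu> \<in> C" using w \<mu> y by simp
    have yY: "y + w (offset \<mu>) \<in> Y" by (rule Y_group(2)[OF y W_Y_closed[OF wW offset_Y[OF \<mu>]]])
    have "torus_act X w \<mu> = shift l (cocycle w + w (offset \<mu>))"
      using shift_offset[OF G_C[OF w \<mu>]] unfolding offset_act[OF w \<mu>] by simp
    then have "?\<nu> = shift (shift l (cocycle w + w (offset \<mu>))) y" by (rule arg_cong)
    also have "\<dots> = shift l (cocycle w + w (offset \<mu>) + y)" using w \<mu> y by (subst shift_shift) auto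
    finally have offset\<nu>: "offset ?\<nu> = cocycle w + w (offset \<mu>) + y" using w \<mu> y offset_shift[of "cocycle w + w (offset \<mu>) + y"] by simp
    have \<nu>': "shift (torus_act X w l) (y + w (offset \<mu>)) = ?\<nu>"
    proof -
      have "torus_act X w \<mu> = torus_act X w (shift l (offset \<mu>))" using \<mu> by simp
      also have "\<dots> = shift (torus_act X w l) (w (offset \<mu>))" using wW \<mu> by (subst torus_act_shift) auto
      finally show ?thesis using wW \<mu> y by (simp add: shift_shift add.commute)
    qed
    have "translation (Mlam_act (single (x, y) c) w (single \<mu> d)) \<cdot> i (xi_act 1 w t) =
        monomial (c * d * ?\<nu> x) 0 (offset ?\<nu>) id \<cdot> (monomial 1 0 (- cocycle w) w \<cdot> i t)"
      using \<mu> wW w y t by (simp add: Mlam_act_single translation_single i_xi_act)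
    also have "\<dots> = monomial (c * d * ?\<nu> x) 0 (offset ?\<nu> + - cocycle w) w \<cdot> i t"
      using w wW \<nu> it by (subst monomial_smult_monomial) (auto simp: blinfun.zero_left id_apply)
    also have "offset ?\<nu> + - cocycle w = y + w (offset \<mu>)" unfolding offset\<nu> by simp
    also have "monomial (c * d * ?\<nu> x) 0 (y + w (offset \<mu>)) w \<cdot> i t = monomial (c * d) x (y + w (offset \<mu>)) w \<cdot> i t"
      using monomial_weight_space(2)[OF it(1) l wW x yY, of "c * d"] unfolding \<nu>' by simp
    also have "\<dots> = monomial c x y w \<cdot> (monomial d 0 (offset \<mu>) id \<cdot> i t)"
      using x y \<mu> wW it by (subst monomial_smult_monomial) (auto simp: blinfun.zero_left)
    finally show ?thesis .
  qed
  show ?thesis using v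
  proof (induction v rule: Mlam_induct)
    case zero
    then show ?case using k it it' tga by (simp add: translation_0)
  next
    case (add \<mu> d v)
    have s: "translation (Mlam_act k w (single \<mu> d)) \<cdot> i (xi_act 1 w t) = tga_elem K k w \<cdot> (monomial d 0 (offset \<mu>) id \<cdot> i t)"
      using k
    proof (induction k rule: K_induct)
      case zero
      then show ?case using it it' add by (simp add: translation_0 tga_elem_0[where G = W])
    next
      case (add x y c k)
      have h: "Mlam_act k' w (single \<mu> d) \<in> carrier Mlam" if "k' \<in> carrier K" for k'
        by (rule Mlam_act_closed[OF that w Mlam_single]) fact
      have "translation (Mlam_act (single (x, y) c + k) w (single \<mu> d)) \<cdot> i (xi_act 1 w t) =
        translation (Mlam_act (single (x, y) c) w (single \<mu> d)) \<cdot> i (xi_act 1 w t) \<oplus>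
        translation (Mlam_act k w (single \<mu> d)) \<cdot> i (xi_act 1 w t)"
        unfolding Mlam_act_add_left translation_add
        by (rule smult_l_distr) (use h add K_single_closed it' in auto)
      also have "\<dots> = monomial c x y w \<cdot> (monomial d 0 (offset \<mu>) id \<cdot> i t) \<oplus> tga_elem K k w \<cdot> (monomial d 0 (offset \<mu>) id \<cdot> i t)"
        unfolding single[OF add(1,2) \<open>\<mu> \<in> C\<close>] add.IH by (rule refl)
      also have "\<dots> = tga_elem K (single (x, y) c + k) w \<cdot> (monomial d 0 (offset \<mu>) id \<cdot> i t)"
        unfolding monomial_def[of c x y w] tga_elem_add[where G = W]
        by (rule smult_l_distr[symmetric]) (use tga add K_single_closed \<open>\<mu> \<in> C\<close> it in auto)
      finally show ?case .
    qed
    have h: "Mlam_act k w v \<in> carrier Mlam" "Mlam_act k w (single \<mu> d) \<in> carrier Mlam"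
      using Mlam_act_closed[OF k w] add Mlam_single by auto
    have "translation (Mlam_act k w (single \<mu> d + v)) \<cdot> i (xi_act 1 w t) =
      translation (Mlam_act k w (single \<mu> d)) \<cdot> i (xi_act 1 w t) \<oplus> translation (Mlam_act k w v) \<cdot> i (xi_act 1 w t)"
      unfolding Mlam_act_add_right translation_add by (rule smult_l_distr) (use h it' in auto)
    also have "\<dots> = tga_elem K k w \<cdot> (monomial d 0 (offset \<mu>) id \<cdot> i t) \<oplus> tga_elem K k w \<cdot> (translation v \<cdot> i t)"
      unfolding s add.IH by (rule refl)
    also have "\<dots> = tga_elem K k w \<cdot> (monomial d 0 (offset \<mu>) id \<cdot> i t \<oplus> translation v \<cdot> i t)"
      by (rule smult_r_distr[symmetric]) (use tga[OF k] add it smult_closed in auto)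
    also have "monomial d 0 (offset \<mu>) id \<cdot> i t \<oplus> translation v \<cdot> i t = translation (single \<mu> d + v) \<cdot> i t"
      unfolding translation_add translation_single by (rule smult_l_distr[symmetric]) (use add it in auto)
    finally show ?case .
  qed
qed

lemma phi_exists: "\<exists>\<phi>. \<phi> \<in> hom (add_monoid VV) (add_monoid M) \<and>
    (\<forall>v\<in>carrier Mlam. \<forall>t\<in>carrier \<xi>. \<phi> (V.tens v t) = translation v \<cdot> i t)"
  unfolding V_eq
proof (rule V.tensor_universal)
  show "abelian_group M" by (rule M.abelian_group_axioms)
qed (simp_all add: Mlam_simps(3) translation_add smult_l_distr smult_r_distr i_add smult_closed translation_rho i_xi_act_id)

definition phi where "phi = (SOME \<phi>. \<phi> \<in> hom (add_monoid VV) (add_monoid M) \<and>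
    (\<forall>v\<in>carrier Mlam. \<forall>t\<in>carrier \<xi>. \<phi> (V.tens v t) = translation v \<cdot> i t))"

lemma phi_hom: "phi \<in> hom (add_monoid VV) (add_monoid M)"
  and phi_tens: "v \<in> carrier Mlam \<Longrightarrow> t \<in> carrier \<xi> \<Longrightarrow> phi (V.tens v t) = translation v \<cdot> i t"
  using someI_ex[OF phi_exists] unfolding phi_def by blast+

lemma phi_closed [simp]: "z \<in> carrier VV \<Longrightarrow> phi z \<in> carrier M"
  using hom_in_carrier[OF phi_hom, of z] by simp

lemma phi_add: "z \<in> carrier VV \<Longrightarrow> z' \<in> carrier VV \<Longrightarrow> phi (z \<oplus>\<^bsub>VV\<^esub> z') = phi z \<oplus> phi z'"
  using hom_mult[OF phi_hom, of z z'] by simp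

lemma phi_zero: "phi \<zero>\<^bsub>VV\<^esub> = \<zero>"
proof -
  interpret VV: abelian_group VV by (rule V_abelian)
  show ?thesis using phi_add[of "\<zero>\<^bsub>VV\<^esub>" "\<zero>\<^bsub>VV\<^esub>"] M.add.l_cancel_one'[of "phi \<zero>\<^bsub>VV\<^esub>" "phi \<zero>\<^bsub>VV\<^esub>"] by simp
qed

lemma phi_smult:
  assumes F: "F \<in> carrier (HG G)" and z: "z \<in> carrier VV"
  shows "phi (F \<odot>\<^bsub>VV\<^esub> z) = F \<cdot> phi z"
  using z
proof (induction z rule: V_induct)
  case (tens v t)
  interpret VV: abelian_group VV by (rule V_abelian)
  have m: "translation v \<cdot> i t \<in> carrier M" using tens by (simp add: smult_closed)
  \<comment> \<open>the truncation of \<open>F\<close> to \<open>A\<close>, so that the claim can be proved summand by summand\<close>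
  define FA where "FA A = (\<lambda>u. if u \<in> A then F u else 0)" for A
  have FA: "FA A \<in> carrier HW" if "A \<subseteq> G" for A
    using HG_apply_closed[OF F] that isotropy_subset by (auto simp: HG_simps FA_def)
  have "phi (V.coset (\<Sum>w\<in>A. frag_of (Mlam_act (F w) w v, xi_act 1 w t))) = FA A \<cdot> (translation v \<cdot> i t) \<and>
     V.coset (\<Sum>w\<in>A. frag_of (Mlam_act (F w) w v, xi_act 1 w t)) \<in> carrier VV"
    if "finite A" "A \<subseteq> G" for A
    using that
  proof (induction A rule: finite_induct)
    case empty
    have "FA {} = \<zero>\<^bsub>HW\<^esub>" by (simp add: FA_def HG_simps)
    then show ?case using V.coset_0[where g = gV, folded V_eq] m by (simp add: phi_zero)
  next
    case (insert w A)
    have w: "w \<in> G" using insert by auto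
    have k: "F w \<in> carrier K" by (rule HG_apply_closed[OF F])
    have FAi: "FA (insert w A) = tga_elem K (F w) w \<oplus>\<^bsub>HW\<^esub> FA A"
      by (rule ext) (use insert in \<open>simp add: FA_def HG_simps tga_elem_apply\<close>)
    have th: "Mlam_act (F w) w v \<in> carrier Mlam" using Mlam_act_closed[OF k w] tens by simp
    have tc: "V.tens (Mlam_act (F w) w v) (xi_act 1 w t) \<in> carrier VV"
      using th w tens by (intro V_tens_closed) auto
    have ins: "V.coset (\<Sum>w\<in>insert w A. frag_of (Mlam_act (F w) w v, xi_act 1 w t)) =
      V.tens (Mlam_act (F w) w v) (xi_act 1 w t) \<oplus>\<^bsub>VV\<^esub> V.coset (\<Sum>w\<in>A. frag_of (Mlam_act (F w) w v, xi_act 1 w t))"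
      using V_coset_insert[OF F _ _ insert(1,2,4)] tens by simp
    have "phi (V.coset (\<Sum>w\<in>insert w A. frag_of (Mlam_act (F w) w v, xi_act 1 w t))) =
      phi (V.tens (Mlam_act (F w) w v) (xi_act 1 w t)) \<oplus> FA A \<cdot> (translation v \<cdot> i t)"
      unfolding ins using insert tc by (subst phi_add) auto
    also have "phi (V.tens (Mlam_act (F w) w v) (xi_act 1 w t)) = tga_elem K (F w) w \<cdot> (translation v \<cdot> i t)"
      using th w tens k by (simp add: phi_tens translation_Mlam_act)
    also have "\<dots> \<oplus> FA A \<cdot> (translation v \<cdot> i t) = FA (insert w A) \<cdot> (translation v \<cdot> i t)"
      unfolding FAi by (rule smult_l_distr[symmetric]) (use tga_elem_closed[OF k, of w W] w FA insert m in auto)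
    finally show ?case unfolding ins using insert tc by auto
  qed
  from this[OF G_finite subset_refl]
  have "phi (F \<odot>\<^bsub>VV\<^esub> V.tens v t) = FA G \<cdot> (translation v \<cdot> i t)"
    using V_smult_tens[OF F tens] by simp
  moreover have "FA G = F" using F by (auto simp: FA_def HG_simps fun_eq_iff)
  ultimately show ?case using tens by (simp add: phi_tens)
next
  case (add z z')
  then show ?case using F HG_mono[OF isotropy_subset F] by (simp add: V_smult_add V_smult_closed phi_add smult_r_distr)
qed

section \<open>The induced module and its map to M\<close>

abbreviation ZZ where "ZZ \<equiv> Z_module \<Delta> X Y n r l \<xi>"

definition gZ :: "(('h \<Rightarrow> 'h) \<Rightarrow> 'h qtorus_elem) \<Rightarrow> (('h \<Rightarrow> 'h) \<Rightarrow> 'h qtorus_elem) \<times> (('h torus_elem \<Rightarrow>\<^sub>0 complex) \<times> 'c \<Rightarrow>\<^sub>0 int) set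
    \<Rightarrow> ((('h \<Rightarrow> 'h) \<Rightarrow> 'h qtorus_elem) \<times> (('h torus_elem \<Rightarrow>\<^sub>0 complex) \<times> 'c \<Rightarrow>\<^sub>0 int) set \<Rightarrow>\<^sub>0 int)" where
  "gZ F = (\<lambda>(b, v). frag_of (F \<otimes>\<^bsub>HW\<^esub> b, v))"

interpretation Z: tensor_data "carrier (HG G)" HW "(\<otimes>\<^bsub>HW\<^esub>)" VV "(\<odot>\<^bsub>VV\<^esub>)"
proof (intro tensor_data.intro tensor_data_axioms.intro V_abelian R.abelian_group_axioms)
qed (simp_all add: V_smult_closed HG_mono[OF isotropy_subset])

lemma Z_eq: "ZZ = tensor_module (carrier (HG G)) HW (\<otimes>\<^bsub>HW\<^esub>) VV (\<odot>\<^bsub>VV\<^esub>) gZ"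
  unfolding Z_module_def Let_def gZ_def by (rule refl)

lemmas Z_abelian = Z.abelian_group_tensor[where g = gZ, folded Z_eq]
lemmas Z_tens_closed = Z.tens_closed[where g = gZ, folded Z_eq]
lemmas Z_tens_add_left = Z.tens_add_left[where g = gZ, folded Z_eq]
lemmas Z_tens_add_right = Z.tens_add_right[where g = gZ, folded Z_eq]
lemmas Z_tens_zero_left = Z.tens_zero_left[where g = gZ, folded Z_eq]
lemmas Z_tens_zero_right = Z.tens_zero_right[where g = gZ, folded Z_eq]
lemmas Z_induct = Z.tensor_induct[where g = gZ, folded Z_eq, consumes 1, case_names tens add]

lemma Z_balanced: "F \<in> carrier HW \<Longrightarrow> z \<in> carrier VV \<Longrightarrow> s \<in> carrier (HG G) \<Longrightarrow>
    Z.tens (F \<otimes>\<^bsub>HW\<^esub> s) z = Z.tens F (s \<odot>\<^bsub>VV\<^esub> z)"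
  by (rule Z.tens_balanced)

lemma Z_smult_basic:
  assumes F: "F \<in> carrier HW"
  shows "c \<in> carrier Z.formal_sums \<Longrightarrow> F \<odot>\<^bsub>ZZ\<^esub> Z.coset c = Z.coset (frag_extend (gZ F) c)"
    and "c \<in> carrier Z.formal_sums \<Longrightarrow> frag_extend (gZ F) c \<in> carrier Z.formal_sums"
proof -
  have a: "gZ F (b, v) \<in> carrier Z.formal_sums" if "b \<in> carrier HW" "v \<in> carrier VV" for b v
    using that F by (simp add: gZ_def)
  have b: "gZ F (b \<oplus>\<^bsub>HW\<^esub> b', v) - gZ F (b, v) - gZ F (b', v) \<in> Z.relations"
    if "b \<in> carrier HW" "b' \<in> carrier HW" "v \<in> carrier VV" for b b' v
    using Z.rel_add_left[of "F \<otimes>\<^bsub>HW\<^esub> b" "F \<otimes>\<^bsub>HW\<^esub> b'" v] that F by (simp add: gZ_def R.r_distr)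
  have c: "gZ F (b, v \<oplus>\<^bsub>VV\<^esub> v') - gZ F (b, v) - gZ F (b, v') \<in> Z.relations"
    if "b \<in> carrier HW" "v \<in> carrier VV" "v' \<in> carrier VV" for b v v'
    using Z.rel_add_right[of "F \<otimes>\<^bsub>HW\<^esub> b" v v'] that F by (simp add: gZ_def)
  have d: "gZ F (b \<otimes>\<^bsub>HW\<^esub> s, v) - gZ F (b, s \<odot>\<^bsub>VV\<^esub> v) \<in> Z.relations"
    if "b \<in> carrier HW" "v \<in> carrier VV" "s \<in> carrier (HG G)" for b v s
    using Z.rel_balanced[of "F \<otimes>\<^bsub>HW\<^esub> b" v s] that F HG_mono[OF isotropy_subset that(3)]
    by (simp add: gZ_def R.m_assoc)
  show "c \<in> carrier Z.formal_sums \<Longrightarrow> F \<odot>\<^bsub>ZZ\<^esub> Z.coset c = Z.coset (frag_extend (gZ F) c)"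
    unfolding Z_eq by (rule Z.smult_coset(1)[where g = gZ and s = F, OF a b c d])
  show "c \<in> carrier Z.formal_sums \<Longrightarrow> frag_extend (gZ F) c \<in> carrier Z.formal_sums"
    by (rule Z.smult_coset(2)[where g = gZ and s = F, OF a b c d])
qed

lemmas Z_smult_additive = Z.smult_additive[where g = gZ, folded Z_eq, OF Z_smult_basic(1) Z_smult_basic(2)]

lemma Z_smult_closed: "F \<in> carrier HW \<Longrightarrow> z \<in> carrier ZZ \<Longrightarrow> F \<odot>\<^bsub>ZZ\<^esub> z \<in> carrier ZZ"
  by (rule Z_smult_additive(1))

lemma Z_smult_add: "F \<in> carrier HW \<Longrightarrow> z \<in> carrier ZZ \<Longrightarrow> z' \<in> carrier ZZ \<Longrightarrow>
    F \<odot>\<^bsub>ZZ\<^esub> (z \<oplus>\<^bsub>ZZ\<^esub> z') = F \<odot>\<^bsub>ZZ\<^esub> z \<oplus>\<^bsub>ZZ\<^esub> F \<odot>\<^bsub>ZZ\<^esub> z'"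
  by (rule Z_smult_additive(2))

lemma Z_smult_tens: "F \<in> carrier HW \<Longrightarrow> b \<in> carrier HW \<Longrightarrow> z \<in> carrier VV \<Longrightarrow>
    F \<odot>\<^bsub>ZZ\<^esub> Z.tens b z = Z.tens (F \<otimes>\<^bsub>HW\<^esub> b) z"
  using Z_smult_additive(3)[of F b z] by (simp add: gZ_def Z.tens_def)

lemma psi_exists: "\<exists>\<psi>. \<psi> \<in> hom (add_monoid ZZ) (add_monoid M) \<and>
    (\<forall>F\<in>carrier HW. \<forall>z\<in>carrier VV. \<psi> (Z.tens F z) = F \<cdot> phi z)"
  unfolding Z_eq
proof (rule Z.tensor_universal)
  show "abelian_group M" by (rule M.abelian_group_axioms)
qed (simp_all add: smult_l_distr smult_r_distr smult_closed phi_add phi_smult smult_assoc HG_mono[OF isotropy_subset])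

definition psi where "psi = (SOME \<psi>. \<psi> \<in> hom (add_monoid ZZ) (add_monoid M) \<and>
    (\<forall>F\<in>carrier HW. \<forall>z\<in>carrier VV. \<psi> (Z.tens F z) = F \<cdot> phi z))"

lemma psi_hom: "psi \<in> hom (add_monoid ZZ) (add_monoid M)"
  and psi_tens: "F \<in> carrier HW \<Longrightarrow> z \<in> carrier VV \<Longrightarrow> psi (Z.tens F z) = F \<cdot> phi z"
  using someI_ex[OF psi_exists] unfolding psi_def by blast+

lemma psi_closed [simp]: "z \<in> carrier ZZ \<Longrightarrow> psi z \<in> carrier M"
  using hom_in_carrier[OF psi_hom, of z] by simp

lemma psi_add: "z \<in> carrier ZZ \<Longrightarrow> z' \<in> carrier ZZ \<Longrightarrow> psi (z \<oplus>\<^bsub>ZZ\<^esub> z') = psi z \<oplus> psi z'"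
  using hom_mult[OF psi_hom, of z z'] by simp

interpretation ZZ: abelian_group ZZ by (rule Z_abelian)
interpretation VV: abelian_group VV by (rule V_abelian)

lemma psi_zero: "psi \<zero>\<^bsub>ZZ\<^esub> = \<zero>"
  using psi_add[of "\<zero>\<^bsub>ZZ\<^esub>" "\<zero>\<^bsub>ZZ\<^esub>"] M.add.l_cancel_one'[of "psi \<zero>\<^bsub>ZZ\<^esub>" "psi \<zero>\<^bsub>ZZ\<^esub>"] by simp

lemma psi_minus: assumes z: "z \<in> carrier ZZ" shows "psi (\<ominus>\<^bsub>ZZ\<^esub> z) = \<ominus> psi z"
proof -
  have "psi (\<ominus>\<^bsub>ZZ\<^esub> z) \<oplus> psi z = \<zero>"
    using psi_add[of "\<ominus>\<^bsub>ZZ\<^esub> z" z] z by (simp add: ZZ.l_neg psi_zero)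
  then show ?thesis using z by (intro M.minus_equality[symmetric]) auto
qed

lemma psi_smult:
  assumes F: "F \<in> carrier HW" and z: "z \<in> carrier ZZ"
  shows "psi (F \<odot>\<^bsub>ZZ\<^esub> z) = F \<cdot> psi z"
  using z
proof (induction z rule: Z_induct)
  case (tens b v)
  then show ?case using F by (simp add: Z_smult_tens psi_tens smult_assoc)
next
  case (add z z')
  then show ?case using F by (simp add: Z_smult_add Z_smult_closed psi_add smult_r_distr)
qed

text \<open>
  The image is a submodule, and it contains the weight space of \<open>l\<close>: the tensor \<open>1 \<otimes> (v\<^sub>l \<otimes> t)\<close> is sent to the vector
  corresponding to \<open>t\<close>.
\<close>

lemma psi_surj: "psi ` carrier ZZ = carrier M"
proof -
  let ?I = "psi ` carrier ZZ"
  have "submodule ?I HW M"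
  proof (rule submodule.intro)
    show "submodule_axioms ?I HW M"
    proof (rule submodule_axioms.intro)
      fix F m assume F: "F \<in> carrier HW" and m: "m \<in> ?I"
      then obtain z where z: "z \<in> carrier ZZ" "m = psi z" by blast
      show "F \<cdot> m \<in> ?I" unfolding z(2) psi_smult[OF F z(1), symmetric] by (rule imageI[OF Z_smult_closed[OF F z(1)]])
    qed
    show "subgroup ?I (add_monoid M)"
    proof (rule group.subgroupI[OF M.a_group])
      show "?I \<subseteq> carrier (add_monoid M)" by auto
      show "?I \<noteq> {}" using ZZ.zero_closed by blast
      show "inv\<^bsub>add_monoid M\<^esub> m \<in> ?I" if m: "m \<in> ?I" for m
      proof -
        obtain z where z: "z \<in> carrier ZZ" "m = psi z" using m by blast
        have "inv\<^bsub>add_monoid M\<^esub> m = psi (\<ominus>\<^bsub>ZZ\<^esub> z)" unfolding z(2) psi_minus[OF z(1)] by (simp add: a_inv_def)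
        then show ?thesis using z by simp
      qed
      show "m \<otimes>\<^bsub>add_monoid M\<^esub> m' \<in> ?I" if m: "m \<in> ?I" and m': "m' \<in> ?I" for m m'
      proof -
        obtain z where z: "z \<in> carrier ZZ" "m = psi z" using m by blast
        obtain z' where z': "z' \<in> carrier ZZ" "m' = psi z'" using m' by blast
        have "m \<otimes>\<^bsub>add_monoid M\<^esub> m' = psi (z \<oplus>\<^bsub>ZZ\<^esub> z')" unfolding z(2) z'(2) psi_add[OF z(1) z'(1)] by simp
        then show ?thesis using ZZ.a_closed[OF z(1) z'(1)] by simp
      qed
    qed
  qed
  moreover have "?I \<noteq> {\<zero>}"
  proof
    assume I: "?I = {\<zero>}"
    obtain v where v: "v \<in> weight_space l" "v \<noteq> \<zero>" using weight_space_l weight_space_zero by blast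
    have "v \<in> i ` carrier \<xi>" using v i_bij by (simp add: bij_betw_def)
    then obtain t where t: "t \<in> carrier \<xi>" "i t = v" by blast
    let ?z = "V.tens (single l 1) t"
    have s: "single l 1 \<in> carrier Mlam" by (rule Mlam_single) simp
    have z: "?z \<in> carrier VV" by (rule V_tens_closed[OF s t(1)])
    have "psi (Z.tens \<one>\<^bsub>HW\<^esub> ?z) = \<one>\<^bsub>HW\<^esub> \<cdot> phi ?z" by (rule psi_tens) (use z in auto)
    also have "\<dots> = phi ?z" by (rule smult_one) (use z in simp)
    also have "\<dots> = v" using s t i_closed[OF t(1)] by (simp add: phi_tens translation_single)
    finally have "v \<in> ?I" by (rule image_eqI[OF sym Z_tens_closed[OF R.one_closed z]])
    then show False using I v by simp
  qed
  ultimately show ?thesis using simple unfolding simple_module_def by blast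
qed

section \<open>Normal forms in the induced module\<close>

text \<open>
  The set of weights of the induced module.
\<close>

definition orbit :: "'h torus_elem set" where
  "orbit = {torus_act X w \<mu> | w \<mu>. w \<in> W \<and> \<mu> \<in> C}"

text \<open>
  A representative of the coset of \<open>G\<close> in \<open>W\<close> that carries the class of \<open>l\<close> to the class of \<open>\<nu>\<close>.
\<close>

definition rep :: "'h torus_elem \<Rightarrow> 'h \<Rightarrow> 'h" where
  "rep \<nu> = (SOME w. w \<in> W \<and> torus_act X (winv w) \<nu> \<in> C)"

lemma rep: assumes "\<nu> \<in> orbit" shows "rep \<nu> \<in> W" "torus_act X (winv (rep \<nu>)) \<nu> \<in> C"
proof -
  obtain w \<mu> where w: "w \<in> W" "\<mu> \<in> C" "\<nu> = torus_act X w \<mu>" using assms by (auto simp: orbit_def)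
  then have "w \<in> W \<and> torus_act X (winv w) \<nu> \<in> C" by simp
  then have "rep \<nu> \<in> W \<and> torus_act X (winv (rep \<nu>)) \<nu> \<in> C" unfolding rep_def
    by (rule someI[where P = "\<lambda>w. w \<in> W \<and> torus_act X (winv w) \<nu> \<in> C"])
  then show "rep \<nu> \<in> W" "torus_act X (winv (rep \<nu>)) \<nu> \<in> C" by blast+
qed

lemma orbit_TT [simp]: "\<nu> \<in> orbit \<Longrightarrow> \<nu> \<in> TT"
  by (auto simp: orbit_def)

text \<open>
  The tensor \<open>w \<otimes> (v\<^sub>\<mu> \<otimes> t)\<close>.
\<close>

definition elem :: "('h \<Rightarrow> 'h) \<Rightarrow> 'h torus_elem \<Rightarrow> 'c \<Rightarrow> _" where
  "elem w \<mu> t = Z.tens (monomial 1 0 0 w) (V.tens (single \<mu> 1) t)"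

lemma elem_closed [simp]: "w \<in> W \<Longrightarrow> \<mu> \<in> C \<Longrightarrow> t \<in> carrier \<xi> \<Longrightarrow> elem w \<mu> t \<in> carrier ZZ"
  unfolding elem_def by (intro Z_tens_closed V_tens_closed Mlam_single) auto

lemma elem_add: "w \<in> W \<Longrightarrow> \<mu> \<in> C \<Longrightarrow> s \<in> carrier \<xi> \<Longrightarrow> t \<in> carrier \<xi> \<Longrightarrow>
   elem w \<mu> (s \<oplus>\<^bsub>\<xi>\<^esub> t) = elem w \<mu> s \<oplus>\<^bsub>ZZ\<^esub> elem w \<mu> t"
  unfolding elem_def
  by (subst V_tens_add_right, (simp_all add: Mlam_single)[3], rule Z_tens_add_right) (auto intro!: V_tens_closed Mlam_single)

lemma elem_zero: "w \<in> W \<Longrightarrow> \<mu> \<in> C \<Longrightarrow> elem w \<mu> \<zero>\<^bsub>\<xi>\<^esub> = \<zero>\<^bsub>ZZ\<^esub>"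
  using elem_add[of w \<mu> "\<zero>\<^bsub>\<xi>\<^esub>" "\<zero>\<^bsub>\<xi>\<^esub>"] ZZ.add.l_cancel_one'[of "elem w \<mu> \<zero>\<^bsub>\<xi>\<^esub>" "elem w \<mu> \<zero>\<^bsub>\<xi>\<^esub>"] by simp

text \<open>
  An element of the isotropy group can be moved across the outer tensor sign.
\<close>

lemma elem_change:
  assumes w: "w \<in> W" and g: "g \<in> G" and \<mu>: "\<mu> \<in> C" and t: "t \<in> carrier \<xi>"
  shows "elem (w \<circ> g) \<mu> t = elem w (torus_act X g \<mu>) (xi_act 1 g t)"
proof -
  have s: "single \<mu> 1 \<in> carrier Mlam" by (rule Mlam_single[OF \<mu>])
  have k: "single (0, 0) 1 \<in> carrier K" by (rule K_single_closed) auto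
  have "monomial 1 0 0 (w \<circ> g) = monomial 1 0 0 w \<otimes>\<^bsub>HW\<^esub> monomial 1 0 0 g"
    using w g by (subst monomial_mult) (auto simp: W_zero blinfun.zero_left)
  then have "elem (w \<circ> g) \<mu> t = Z.tens (monomial 1 0 0 w) (monomial 1 0 0 g \<odot>\<^bsub>VV\<^esub> V.tens (single \<mu> 1) t)"
    unfolding elem_def using w g by (simp only:) (rule Z_balanced[OF _ V_tens_closed[OF s t] monomial_closed], auto)
  also have "monomial 1 0 0 g \<odot>\<^bsub>VV\<^esub> V.tens (single \<mu> 1) t = V.tens (single (torus_act X g \<mu>) 1) (xi_act 1 g t)"
  proof -
    have "Mlam_act (single (0, 0) 1) g (single \<mu> 1) = single (torus_act X g \<mu>) 1"
      using g \<mu> by (subst Mlam_act_single) auto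
    then show ?thesis using V_smult_tga[OF k g s t] unfolding monomial_def by simp
  qed
  finally show ?thesis unfolding elem_def .
qed

lemma psi_elem:
  assumes w: "w \<in> W" and \<mu>: "\<mu> \<in> C" and t: "t \<in> carrier \<xi>"
  shows "psi (elem w \<mu> t) = monomial 1 0 (w (offset \<mu>)) w \<cdot> i t"
proof -
  have s: "single \<mu> 1 \<in> carrier Mlam" by (rule Mlam_single[OF \<mu>])
  have "psi (elem w \<mu> t) = monomial 1 0 0 w \<cdot> (monomial 1 0 (offset \<mu>) id \<cdot> i t)"
    unfolding elem_def using w s t V_tens_closed[OF s t] by (simp add: psi_tens phi_tens translation_single)
  also have "\<dots> = monomial 1 0 (w (offset \<mu>)) w \<cdot> i t"
    using w \<mu> t by (subst monomial_smult_monomial) (auto simp: blinfun.zero_left)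
  finally show ?thesis .
qed

lemma psi_elem_weight_space:
  assumes w: "w \<in> W" and \<mu>: "\<mu> \<in> C" and t: "t \<in> carrier \<xi>"
  shows "psi (elem w \<mu> t) \<in> weight_space (torus_act X w \<mu>)"
proof -
  have "torus_act X w \<mu> = torus_act X w (shift l (offset \<mu>))" using \<mu> by simp
  also have "\<dots> = shift (torus_act X w l) (w (offset \<mu>))" using w \<mu> by (subst torus_act_shift) auto
  finally show ?thesis
    unfolding psi_elem[OF assms] using monomial_weight_space(1)[OF i_weight_space[OF t] l w X_group(1) W_Y_closed[OF w offset_Y[OF \<mu>]], of 1] by simp
qed

lemma psi_elem_eq_zero:
  assumes w: "w \<in> W" and \<mu>: "\<mu> \<in> C" and t: "t \<in> carrier \<xi>" and 0: "psi (elem w \<mu> t) = \<zero>"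
  shows "t = \<zero>\<^bsub>\<xi>\<^esub>"
proof -
  have y: "- offset \<mu> \<in> Y" "w (offset \<mu>) \<in> Y" using \<mu> w by auto
  have "monomial 1 0 (- offset \<mu>) (winv w) \<cdot> (monomial 1 0 (w (offset \<mu>)) w \<cdot> i t) = scal 1 \<cdot> i t"
    using w y t by (subst monomial_smult_monomial) (auto simp: blinfun.zero_left W_winv_apply)
  also have "\<dots> = i t" using t by simp
  finally have "i t = monomial 1 0 (- offset \<mu>) (winv w) \<cdot> \<zero>" using 0 unfolding psi_elem[OF w \<mu> t] by simp
  also have "\<dots> = \<zero>" using w y by simp
  finally show ?thesis using t i_zero by (intro i_inj) auto
qed

text \<open>
  The general element of weight \<open>\<nu>\<close>, normalised by the choice of coset representative.
\<close>

definition component :: "'h torus_elem \<Rightarrow> 'c \<Rightarrow> _" where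
  "component \<nu> t = elem (rep \<nu>) (torus_act X (winv (rep \<nu>)) \<nu>) t"

lemma component_closed [simp]: "\<nu> \<in> orbit \<Longrightarrow> t \<in> carrier \<xi> \<Longrightarrow> component \<nu> t \<in> carrier ZZ"
  unfolding component_def by (intro elem_closed rep)

lemma elem_component:
  assumes w: "w \<in> W" and \<mu>: "\<mu> \<in> C" and t: "t \<in> carrier \<xi>"
  shows "\<exists>s\<in>carrier \<xi>. elem w \<mu> t = component (torus_act X w \<mu>) s"
proof -
  let ?\<nu> = "torus_act X w \<mu>"
  have \<nu>: "?\<nu> \<in> orbit" using w \<mu> by (auto simp: orbit_def)
  note r = rep[OF \<nu>]
  let ?g = "winv (rep ?\<nu>) \<circ> w"
  have a: "torus_act X ?g \<mu> = torus_act X (winv (rep ?\<nu>)) ?\<nu>" using r w \<mu> by (subst torus_act_comp) auto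
  have g: "?g \<in> G" by (rule isotropy_memI[OF _ \<mu>]) (use r w a in auto)
  have "w = rep ?\<nu> \<circ> ?g" using r by (simp add: o_assoc)
  then have "elem w \<mu> t = elem (rep ?\<nu>) (torus_act X ?g \<mu>) (xi_act 1 ?g t)" using elem_change[OF r(1) g \<mu> t] by simp
  then show ?thesis unfolding component_def a using g t by (intro bexI[of _ "xi_act 1 ?g t"]) auto
qed

text \<open>
  Sums of components with pairwise different weights; \<open>P\<close> collects the weights.
\<close>

inductive normal_form where
  normal_form_zero: "normal_form {} \<zero>\<^bsub>ZZ\<^esub>"
| normal_form_step: "normal_form P z \<Longrightarrow> \<nu> \<in> orbit \<Longrightarrow> \<nu> \<notin> P \<Longrightarrow> t \<in> carrier \<xi> \<Longrightarrow> normal_form (insert \<nu> P) (component \<nu> t \<oplus>\<^bsub>ZZ\<^esub> z)"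

lemma normal_form_facts: "normal_form P z \<Longrightarrow> z \<in> carrier ZZ \<and> finite P \<and> P \<subseteq> orbit"
  by (induction rule: normal_form.induct) auto

text \<open>
  A component of a weight that already occurs is merged with the present one by additivity in \<open>t\<close>.
\<close>

lemma normal_form_insert: "normal_form P z \<Longrightarrow> \<nu> \<in> orbit \<Longrightarrow> t \<in> carrier \<xi> \<Longrightarrow> normal_form (insert \<nu> P) (component \<nu> t \<oplus>\<^bsub>ZZ\<^esub> z)"
proof (induction arbitrary: t rule: normal_form.induct)
  case normal_form_zero
  then show ?case using normal_form.normal_form_step[OF normal_form.normal_form_zero] by simp
next
  case (normal_form_step P z \<nu>' t')
  have z: "z \<in> carrier ZZ" using normal_form_facts normal_form_step by blast
  show ?case
  proof (cases "\<nu> = \<nu>'")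
    case True
    have "component \<nu> t \<oplus>\<^bsub>ZZ\<^esub> (component \<nu>' t' \<oplus>\<^bsub>ZZ\<^esub> z) = (component \<nu> t \<oplus>\<^bsub>ZZ\<^esub> component \<nu> t') \<oplus>\<^bsub>ZZ\<^esub> z"
      unfolding True using normal_form_step z by (intro ZZ.a_assoc[symmetric]) auto
    also have "component \<nu> t \<oplus>\<^bsub>ZZ\<^esub> component \<nu> t' = component \<nu> (t \<oplus>\<^bsub>\<xi>\<^esub> t')"
      unfolding component_def using normal_form_step rep True by (intro elem_add[symmetric]) auto
    finally show ?thesis using normal_form.normal_form_step[OF normal_form_step.hyps(1) normal_form_step.hyps(2,3), of "t \<oplus>\<^bsub>\<xi>\<^esub> t'"] normal_form_step True by simp
  next
    case False
    have "component \<nu> t \<oplus>\<^bsub>ZZ\<^esub> (component \<nu>' t' \<oplus>\<^bsub>ZZ\<^esub> z) = component \<nu>' t' \<oplus>\<^bsub>ZZ\<^esub> (component \<nu> t \<oplus>\<^bsub>ZZ\<^esub> z)"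
      using normal_form_step z by (intro ZZ.a_lcomm) auto
    moreover have "normal_form (insert \<nu>' (insert \<nu> P)) (component \<nu>' t' \<oplus>\<^bsub>ZZ\<^esub> (component \<nu> t \<oplus>\<^bsub>ZZ\<^esub> z))"
      by (rule normal_form.normal_form_step) (use normal_form_step False in auto)
    ultimately show ?thesis by (simp add: insert_commute)
  qed
qed

lemma normal_form_add: "normal_form P z \<Longrightarrow> normal_form P' z' \<Longrightarrow> \<exists>Q. normal_form Q (z \<oplus>\<^bsub>ZZ\<^esub> z')"
proof (induction rule: normal_form.induct)
  case normal_form_zero
  then show ?case using normal_form_facts[of P' z'] by auto
next
  case (normal_form_step P z \<nu> t)
  then obtain Q where Q: "normal_form Q (z \<oplus>\<^bsub>ZZ\<^esub> z')" by blast
  have "(component \<nu> t \<oplus>\<^bsub>ZZ\<^esub> z) \<oplus>\<^bsub>ZZ\<^esub> z' = component \<nu> t \<oplus>\<^bsub>ZZ\<^esub> (z \<oplus>\<^bsub>ZZ\<^esub> z')"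
    using normal_form_step normal_form_facts[of P z] normal_form_facts[of P' z'] by (intro ZZ.a_assoc) auto
  then show ?case using normal_form_insert[OF Q normal_form_step.hyps(2) normal_form_step.hyps(4)] by auto
qed

lemma normal_form_elem: assumes "w \<in> W" "\<mu> \<in> C" "t \<in> carrier \<xi>" shows "\<exists>Q. normal_form Q (elem w \<mu> t)"
proof -
  obtain s where s: "s \<in> carrier \<xi>" "elem w \<mu> t = component (torus_act X w \<mu>) s" using elem_component[OF assms] by blast
  have \<nu>: "torus_act X w \<mu> \<in> orbit" using assms by (auto simp: orbit_def)
  have "component (torus_act X w \<mu>) s \<oplus>\<^bsub>ZZ\<^esub> \<zero>\<^bsub>ZZ\<^esub> = elem w \<mu> t" using s \<nu> by simp
  then show ?thesis using normal_form_insert[OF normal_form.normal_form_zero \<nu> s(1)] by auto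
qed

text \<open>
  In a tensor \<open>F \<otimes> v\<close> with \<open>F\<close> a monomial, the group element can be written on the left, as
  \<open>c e\<^sup>x e\<^sup>y w = w (c e\<^sup>x\<^sup>' e\<^sup>y\<^sup>')\<close>, and the rest belongs to the algebra over which the tensor product is formed.
\<close>

lemma normal_form_exists: assumes "z \<in> carrier ZZ" shows "\<exists>P. normal_form P z"
  using assms
proof (induction z rule: Z_induct)
  case (add z z')
  then show ?case using normal_form_add by blast
next
  case (tens F v)
  have w_case: "\<exists>P. normal_form P (Z.tens (monomial 1 0 0 w) v)" if w: "w \<in> W" and v: "v \<in> carrier VV" for w v
    using v
  proof (induction v rule: V_induct)
    case (add v v')
    then obtain P P' where "normal_form P (Z.tens (monomial 1 0 0 w) v)" "normal_form P' (Z.tens (monomial 1 0 0 w) v')" by blast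
    moreover have "Z.tens (monomial 1 0 0 w) (v \<oplus>\<^bsub>VV\<^esub> v') = Z.tens (monomial 1 0 0 w) v \<oplus>\<^bsub>ZZ\<^esub> Z.tens (monomial 1 0 0 w) v'"
      by (rule Z_tens_add_right) (use w add in auto)
    ultimately show ?case using normal_form_add by metis
  next
    case (tens u t)
    from tens(1) show ?case
    proof (induction u rule: Mlam_induct)
      case zero
      have "Z.tens (monomial 1 0 0 w) (V.tens 0 t) = \<zero>\<^bsub>ZZ\<^esub>"
        using tens w by (simp add: V_tens_zero_left Z_tens_zero_right)
      then show ?case using normal_form.normal_form_zero by metis
    next
      case (add \<mu> d u)
      have s: "single \<mu> d \<in> carrier Mlam" "single \<mu> 1 \<in> carrier Mlam" using Mlam_single[OF add(1)] by auto
      have "V.tens (single \<mu> d) t = V.tens (single \<mu> 1) (xi_act d id t)"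
        using V.tens_balanced[OF s(2) tens(2), of d] by (simp add: rho_single)
      then have "Z.tens (monomial 1 0 0 w) (V.tens (single \<mu> d) t) = elem w \<mu> (xi_act d id t)"
        by (simp add: elem_def)
      then obtain P where P: "normal_form P (Z.tens (monomial 1 0 0 w) (V.tens (single \<mu> d) t))"
        using normal_form_elem[OF w add(1), of "xi_act d id t"] tens(2) by auto
      obtain P' where P': "normal_form P' (Z.tens (monomial 1 0 0 w) (V.tens u t))" using add.IH by blast
      have "Z.tens (monomial 1 0 0 w) (V.tens (single \<mu> d + u) t) =
        Z.tens (monomial 1 0 0 w) (V.tens (single \<mu> d) t) \<oplus>\<^bsub>ZZ\<^esub> Z.tens (monomial 1 0 0 w) (V.tens u t)"
        unfolding V_tens_add_left[OF s(1) add(2) tens(2)]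
        by (rule Z_tens_add_right) (use w s add tens V_tens_closed in auto)
      then show ?case using normal_form_add[OF P P'] by simp
    qed
  qed
  show ?case
    using subset_refl tens(1)
  proof (induction F rule: HG_induct)
    case zero
    have "Z.tens \<zero>\<^bsub>HW\<^esub> v = \<zero>\<^bsub>ZZ\<^esub>" by (rule Z_tens_zero_left[OF tens(2)])
    then show ?case using normal_form.normal_form_zero by metis
  next
    case (add c x y w F)
    \<comment> \<open>the monomial conjugated by \<open>w\<close>\<close>
    let ?s = "monomial c (dual_act (winv w) x) (winv w y) id"
    have s: "?s \<in> carrier (HG G)" by (rule monomial_closed) (use add in auto)
    have "monomial c x y w = monomial 1 0 0 w \<otimes>\<^bsub>HW\<^esub> ?s"
      using add by (subst monomial_mult) (auto simp: blinfun.zero_right W_winv_apply)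
    then have "Z.tens (monomial c x y w) v = Z.tens (monomial 1 0 0 w) (?s \<odot>\<^bsub>VV\<^esub> v)"
      using Z_balanced[OF _ tens(2) s, of "monomial 1 0 0 w"] add by simp
    then obtain P where P: "normal_form P (Z.tens (monomial c x y w) v)"
      using w_case[OF add(3) V_smult_closed[OF s tens(2)]] by auto
    obtain P' where P': "normal_form P' (Z.tens F v)" using add by blast
    have "Z.tens (monomial c x y w \<oplus>\<^bsub>HW\<^esub> F) v = Z.tens (monomial c x y w) v \<oplus>\<^bsub>ZZ\<^esub> Z.tens F v"
      by (rule Z_tens_add_left) (use add tens in auto)
    then show ?case using normal_form_add[OF P P'] by simp
  qed
qed

lemma component_weight_space: assumes "\<nu> \<in> orbit" "t \<in> carrier \<xi>" shows "psi (component \<nu> t) \<in> weight_space \<nu>"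
  using psi_elem_weight_space[OF rep[OF assms(1)] assms(2)] assms rep[OF assms(1)] unfolding component_def by simp

lemma normal_form_kill: "normal_form P z \<Longrightarrow> a \<in> carrier HW \<Longrightarrow> (\<forall>\<mu>\<in>P. \<forall>m\<in>weight_space \<mu>. a \<cdot> m = \<zero>) \<Longrightarrow> a \<cdot> psi z = \<zero>"
proof (induction rule: normal_form.induct)
  case normal_form_zero
  then show ?case by (simp add: psi_zero)
next
  case (normal_form_step P z \<nu> t)
  have z: "z \<in> carrier ZZ" using normal_form_facts normal_form_step by blast
  have "a \<cdot> psi (component \<nu> t) = \<zero>" using normal_form_step component_weight_space by blast
  then show ?case using normal_form_step z by (simp add: psi_add smult_r_distr)
qed

text \<open>
  An element that acts as one on weight \<open>\<nu>\<close> and as zero on the remaining weights isolates the component of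
  weight \<open>\<nu>\<close> of the image. So this component is sent to zero, hence vanishes, and the other weights remain.
\<close>

lemma normal_form_inj: "normal_form P z \<Longrightarrow> psi z = \<zero> \<Longrightarrow> z = \<zero>\<^bsub>ZZ\<^esub>"
proof (induction rule: normal_form.induct)
  case (normal_form_step P z \<nu> t)
  have z: "z \<in> carrier ZZ" "finite P" "P \<subseteq> TT" using normal_form_facts[OF normal_form_step.hyps(1)] by auto
  obtain a where a: "a \<in> carrier HW" "\<forall>m\<in>weight_space \<nu>. a \<cdot> m = m" "\<forall>\<mu>\<in>P. \<forall>m\<in>weight_space \<mu>. a \<cdot> m = \<zero>"
    using separate_weights[OF z(2,3) orbit_TT[OF normal_form_step.hyps(2)] normal_form_step.hyps(3)] by blast
  have c: "component \<nu> t \<in> carrier ZZ" using normal_form_step by simp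
  have sum: "psi (component \<nu> t) \<oplus> psi z = \<zero>" using normal_form_step.prems psi_add[OF c z(1)] by simp
  have "\<zero> = a \<cdot> (psi (component \<nu> t) \<oplus> psi z)" using sum a(1) by simp
  also have "\<dots> = a \<cdot> psi (component \<nu> t) \<oplus> a \<cdot> psi z" by (rule smult_r_distr) (use a c z in auto)
  also have "\<dots> = psi (component \<nu> t)"
    using normal_form_kill[OF normal_form_step.hyps(1) a(1,3)] a(2) component_weight_space[OF normal_form_step.hyps(2,4)] psi_closed[OF c] by simp
  finally have 0: "psi (component \<nu> t) = \<zero>" by simp
  have "t = \<zero>\<^bsub>\<xi>\<^esub>"
    using psi_elem_eq_zero[OF rep[OF normal_form_step.hyps(2)] normal_form_step.hyps(4)] 0 unfolding component_def by simp
  then have c0: "component \<nu> t = \<zero>\<^bsub>ZZ\<^esub>"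
    unfolding component_def using elem_zero[OF rep[OF normal_form_step.hyps(2)]] by simp
  have "psi z = \<zero>" using sum 0 psi_closed[OF z(1)] by simp
  then have "z = \<zero>\<^bsub>ZZ\<^esub>" by (rule normal_form_step.IH)
  then show ?case using c0 by simp
qed simp

theorem induced_isomorphic: "module_isomorphic HW M ZZ"
proof (rule module_isomorphic_from_inverse[where f = psi])
  have "inj_on psi (carrier ZZ)"
  proof (rule inj_onI)
    fix z z' assume z: "z \<in> carrier ZZ" "z' \<in> carrier ZZ" and eq: "psi z = psi z'"
    have "psi (z \<oplus>\<^bsub>ZZ\<^esub> (\<ominus>\<^bsub>ZZ\<^esub> z')) = psi z \<oplus> (\<ominus> psi z')" using z by (simp add: psi_add psi_minus)
    also have "\<dots> = \<zero>" unfolding eq using z by (simp add: M.r_neg)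
    finally have "psi (z \<oplus>\<^bsub>ZZ\<^esub> (\<ominus>\<^bsub>ZZ\<^esub> z')) = \<zero>" .
    moreover have "z \<oplus>\<^bsub>ZZ\<^esub> (\<ominus>\<^bsub>ZZ\<^esub> z') \<in> carrier ZZ" using z by simp
    ultimately have "z \<oplus>\<^bsub>ZZ\<^esub> (\<ominus>\<^bsub>ZZ\<^esub> z') = \<zero>\<^bsub>ZZ\<^esub>" using normal_form_exists normal_form_inj by blast
    then show "z = z'" using z ZZ.minus_equality[of z "\<ominus>\<^bsub>ZZ\<^esub> z'"] by simp
  qed
  then show "bij_betw psi (carrier ZZ) (carrier M)" using psi_surj by (simp add: bij_betw_def)
qed (simp_all add: Z_smult_closed psi_add psi_smult)

end

section \<open>Simple modules are induced\<close>

theorem proposition3p5: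
  fixes \<Delta> :: "'h::euclidean_space set"
    and X :: "'h dual set" and Y :: "'h set"
    and n :: nat and q r :: complex
    and S :: "'h torus_elem set"
    and M :: "(('h \<Rightarrow> 'h) \<Rightarrow> 'h qtorus_elem, 'm) module"
  assumes "reduced_root_system \<Delta>"
    and "is_lattice X" and "is_lattice Y"
    and "\<forall>w\<in>weyl_group \<Delta>. dual_act w ` X = X"
    and "\<forall>w\<in>weyl_group \<Delta>. w ` Y = Y"
    and "n > 0"
    and "\<forall>x\<in>X. \<forall>y\<in>Y. \<exists>a::int. blinfun_apply x y = of_int a / of_nat n"
    and "q \<noteq> 0" and "\<forall>k::nat. k > 0 \<longrightarrow> q ^ k \<noteq> 1"
    and "r ^ n = q"
    and "orbit_representatives \<Delta> X Y n r S"
    and "simple_module (qtorus_tga X Y n r (weyl_group \<Delta>)) M"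
    and "locally_finite_action (qtorus_scalar X Y n r) (invariant_CX \<Delta> X Y n r) M"
  shows "\<exists>l\<in>S. \<exists>\<xi>\<in>simple_group_modules (isotropy_group \<Delta> X Y n r l).
           module_isomorphic (qtorus_tga X Y n r (weyl_group \<Delta>)) M (Z_module \<Delta> X Y n r l \<xi>)"
proof -
  have mod: "left_module (qtorus_tga X Y n r (weyl_group \<Delta>)) M"
    using assms(12) by (simp add: simple_module_def)
  have r0: "r \<noteq> 0" using assms(6,8,10) by (metis power_0_left less_numeral_extra(3))
  have root: "r ^ k \<noteq> 1" if "k > 0" for k
  proof
    assume "r ^ k = 1"
    then have "q ^ k = 1" unfolding assms(10)[symmetric] by (metis mult.commute power_mult power_one)
    then show False using assms(9) that by blast
  qed
  interpret lf_module \<Delta> X Y n r M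
  proof (intro lf_module.intro module_data.intro torus_data.intro weyl_data.intro mod
      torus_data_axioms.intro lf_module_axioms.intro)
    show "carrier M \<noteq> {\<zero>\<^bsub>M\<^esub>}" using assms(12) by (simp add: simple_module_def)
  qed (rule assms r0 root bspec[OF assms(4)] bspec[OF assms(5)]; assumption?)+
  obtain \<mu> v where \<mu>: "\<mu> \<in> TT" and v: "v \<in> weight_space \<mu>" "v \<noteq> \<zero>\<^bsub>M\<^esub>" using weight_vector_exists by blast
  have "torus_class X Y n r \<mu> \<in> Lambda X Y n r"
    using \<mu> by (auto simp: Lambda_def FactGroup_def RCOSETS_def torus_class_def)
  then have "Lambda_orbit \<Delta> X (torus_class X Y n r \<mu>) \<in> (\<lambda>l. Lambda_orbit \<Delta> X (torus_class X Y n r l)) ` S"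
    using assms(11) unfolding orbit_representatives_def bij_betw_def by simp
  then obtain l where l: "l \<in> S" "Lambda_orbit \<Delta> X (torus_class X Y n r \<mu>) = Lambda_orbit \<Delta> X (torus_class X Y n r l)"
    by (rule imageE)
  have lT: "l \<in> TT" using l(1) assms(11) by (auto simp: orbit_representatives_def)
  have \<mu>_id: "\<mu> \<in> torus_act X id ` torus_class X Y n r \<mu>"
    using class_self[OF \<mu>] \<mu> by (intro image_eqI[of _ _ \<mu>]) auto
  have "torus_act X id ` torus_class X Y n r \<mu> \<in> Lambda_orbit \<Delta> X (torus_class X Y n r l)"
    unfolding l(2)[symmetric] unfolding Lambda_orbit_def by (rule CollectI, rule exI[of _ id]) simp
  then obtain w where w': "w \<in> W" "torus_act X id ` torus_class X Y n r \<mu> = torus_act X w ` torus_class X Y n r l"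
    unfolding Lambda_orbit_def by (elim CollectE exE conjE)
  have w: "w \<in> W" "\<mu> \<in> torus_act X w ` torus_class X Y n r l"
    using w'(1) \<mu>_id unfolding w'(2) by simp_all
  from w(2) obtain y where y: "y \<in> Y" "\<mu> = torus_act X w (shift l y)"
    unfolding torus_class_eq[OF lT] by (elim imageE) simp
  \<comment> \<open>the vector \<open>v\<close> is moved to the weight \<open>l\<close> by \<open>e\<^sup>-\<^sup>y w\<^sup>-\<^sup>1\<close>\<close>
  have wm: "shift (torus_act X (winv w) \<mu>) (- y) = l"
    unfolding y(2) using w(1) y(1) lT by (simp add: shift_shift)
  let ?v = "monomial 1 0 (- y) (winv w) \<cdot> v"
  have vM: "v \<in> carrier M" by (rule weight_space_carrier[OF v(1)])
  have "?v \<in> weight_space l" using monomial_weight_space(1)[OF v(1) \<mu>, of "winv w" 0 "- y" 1] w y unfolding wm by simp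
  moreover have "?v \<noteq> \<zero>\<^bsub>M\<^esub>"
  proof
    assume 0: "?v = \<zero>\<^bsub>M\<^esub>"
    have "monomial 1 0 (w y) w \<cdot> ?v = scal 1 \<cdot> v"
      using w y vM by (subst monomial_smult_monomial) (auto simp: blinfun.zero_left W_minus)
    also have "\<dots> = v" using vM by simp
    finally show False using 0 v(2) w y by simp
  qed
  ultimately have wl: "weight_space l \<noteq> {\<zero>\<^bsub>M\<^esub>}" by blast
  interpret wm: weight_module \<Delta> X Y n r M l
    by (intro weight_module.intro module_data_axioms weight_module_axioms.intro assms(12) lT wl)
  obtain \<xi> :: "(('h \<Rightarrow> 'h) \<Rightarrow> complex, nat \<Rightarrow> complex) module" and i where xi:
    "\<xi> \<in> simple_group_modules wm.G" "bij_betw i (carrier \<xi>) (weight_space l)"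
     "\<forall>s\<in>carrier \<xi>. \<forall>t\<in>carrier \<xi>. i (s \<oplus>\<^bsub>\<xi>\<^esub> t) = i s \<oplus>\<^bsub>M\<^esub> i t"
     "\<forall>F\<in>carrier wm.CG. \<forall>t\<in>carrier \<xi>. i (F \<odot>\<^bsub>\<xi>\<^esub> t) = wm.untwist F \<cdot> i t"
    using wm.weight_space_coordinates by blast
  have "left_module wm.CG \<xi>" using xi(1) by (simp add: simple_group_modules_def simple_module_def)
  then interpret im: induced_module \<Delta> X Y n r M l \<xi> i
    by (intro induced_module.intro wm.weight_module_axioms induced_module_axioms.intro) (use xi in auto)
  show ?thesis using l(1) xi(1) im.induced_isomorphic by blast
qed

end
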